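(* Let $(\mathbf{M}^n,g(t),H(t))$, $t\in[0,T]$, be a solution of the generalized Ricci flow on an $n$-dimensional closed manifold $\mathbf{M}$, satisfying $-\frac{K_1}{t}g\le \mathrm{Ric}\le \frac{K_2}{t}g$ and $H^2\le \frac{K_3}{t}g$, where $K_1,K_2,K_3$ and $T<\infty$ are positive constants. Assume that $|\nabla H^2|\le K_4$ for some constant $K_4>0$. Let $u:\mathbf{M}\times[0,T]\to\mathbb{R}$ be a smooth positive solution of the heat equation $\partial_t u=\Delta_{g(t)}u$. Then for every $\alpha>1$ and all $a>0$, $b>0$ with $a+2b=\frac1\alpha$, the following holds on $\mathbf{M}\times(0,T]$: $$\frac{|\nabla u|^2}{u^2}-\alpha\frac{\partial_t u}{u}\le \sqrt{\frac{n\alpha}{2a}}\left[\left(\sqrt{\frac{n\alpha}{2a}}+\sqrt{B_2}\right)\frac1t+\frac{\sqrt{B_3}}{\sqrt t}+\sqrt{B_1}\right],$$ where $$B_1=\frac{n\alpha^3}{512a(\alpha-1)^2}+\frac{3n\alpha K_4^2}{8},$$ $$B_2=\frac{n\alpha^3}{2a(\alpha-1)^2}\left(K_1+\frac{(\alpha-1)K_3}{4\alpha}\right)^2+\frac{n\alpha K}{2b}+\frac{n\alpha K_3^2}{32b},$$ $$B_3=\frac{n\alpha^3}{16a(\alpha-1)^2}\left(K_1+\frac{(\alpha-1)K_3}{4\alpha}\right),\qquad K=\max\{K_1^2,K_2^2\}.$$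
   Context: Closed means compact without boundary. A solution of the generalized Ricci flow on $\mathbf{M}$ is a smooth one-parameter family $(g(t),H(t))$ of Riemannian metrics $g(t)$ and closed three-forms $H(t)$ on $\mathbf{M}$ with $$\partial_t g=-2\,\mathrm{Ric}+\tfrac12H^2,\qquad \partial_t H=-d\,d^*_gH,$$ where $\mathrm{Ric}$ is the Ricci tensor of $g(t)$, $d^*_g$ is the adjoint of the exterior derivative $d$ with respect to $g(t)$, and $H^2$ is the positive semidefinite symmetric 2-tensor $H^2(X,Y)=\langle i_XH,i_YH\rangle_{g(t)}$, with $i_X$ the interior product (in index notation $H^2_{ij}=g^{kl}g^{pq}H_{ikp}H_{jlq}$). $\nabla$, norms and $\Delta_{g(t)}=\mathrm{tr}_{g(t)}\nabla^2_{g(t)}$ are taken with respect to $g(t)$. Inequalities between symmetric 2-tensors are in the sense of quadratic forms; the bounds involving $1/t$ are understood for $t\in(0,T]$, and $|\nabla H^2|\le K_4$ on $\mathbf{M}\times[0,T]$. *)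

theory Defs
  imports "HOL-Analysis.Analysis"
begin

section \<open>Smooth maps\<close>

text \<open>
  The derivative is taken within \<open>S\<close>, so that the definition also covers the space-time sets
  \<open>V \<times> {0..T}\<close> (\<open>V\<close> open, \<open>T > 0\<close>) with one-sided time derivatives at the two ends. It is used
  only for open sets and for sets of this kind, where the derivative within \<open>S\<close> is unique.
\<close>

primrec Ck_on :: "nat \<Rightarrow> ('a::real_normed_vector) set \<Rightarrow> ('a \<Rightarrow> 'b::real_normed_vector) \<Rightarrow> bool" where
  "Ck_on 0 S f \<longleftrightarrow> continuous_on S f"
| "Ck_on (Suc k) S f \<longleftrightarrow> f differentiable_on S \<and>
     (\<forall>v. Ck_on k S (\<lambda>x. frechet_derivative f (at x within S) v))"

definition smooth_on :: "('a::real_normed_vector) set \<Rightarrow> ('a \<Rightarrow> 'b::real_normed_vector) \<Rightarrow> bool" where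
  "smooth_on S f \<longleftrightarrow> (\<forall>k. Ck_on k S f)"


section \<open>Closed manifolds\<close>

text \<open>
  The manifold is the whole type \<open>'m\<close>, its dimension is \<open>CARD('n)\<close>, and its smooth structure is
  given by an atlas. A chart is a pair of its domain and its coordinate map; the values of the
  map outside the domain are irrelevant.
\<close>

type_synonym ('m, 'n) chart = "'m set \<times> ('m \<Rightarrow> real ^ 'n)"

definition cinv :: "('m, 'n::finite) chart \<Rightarrow> real ^ 'n \<Rightarrow> 'm" where
  "cinv c = inv_into (fst c) (snd c)"

definition smooth_atlas ::
    "('m::{t2_space, second_countable_topology}, 'n::finite) chart set \<Rightarrow> bool" where
  "smooth_atlas A \<longleftrightarrow>
     (\<forall>c\<in>A. open (fst c) \<and> open (snd c ` fst c) \<and>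
        homeomorphism (fst c) (snd c ` fst c) (snd c) (cinv c)) \<and>
     (\<Union>c\<in>A. fst c) = UNIV \<and>
     (\<forall>c\<in>A. \<forall>c'\<in>A. smooth_on (snd c ` (fst c \<inter> fst c')) (\<lambda>x. snd c' (cinv c x)))"

definition closed_manifold ::
    "('m::{t2_space, second_countable_topology}, 'n::finite) chart set \<Rightarrow> bool" where
  "closed_manifold A \<longleftrightarrow> smooth_atlas A \<and> compact (UNIV :: 'm set)"

definition partial :: "('m, 'n::finite) chart \<Rightarrow> 'n \<Rightarrow> ('m \<Rightarrow> real) \<Rightarrow> 'm \<Rightarrow> real" where
  "partial c i f p = frechet_derivative (\<lambda>x. f (cinv c x)) (at (snd c p)) (axis i 1)"


section \<open>Covariant tensor fields\<close>

text \<open>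
  A covariant tensor field of rank \<open>k\<close> is given classically, by its components in each chart:
  \<open>F c p [i\<^sub>1, \<dots>, i\<^sub>k]\<close> is the value of \<open>F\<close> at the point \<open>p\<close> on the coordinate vector fields
  number \<open>i\<^sub>1, \<dots>, i\<^sub>k\<close> of the chart \<open>c\<close>. Only charts of the atlas, points in their domain and
  multi-indices of length \<open>k\<close> matter. Components in different charts are related by the
  tensor transformation law.
\<close>

type_synonym ('m, 'n) tensor = "('m, 'n) chart \<Rightarrow> 'm \<Rightarrow> 'n list \<Rightarrow> real"

definition multi_index :: "nat \<Rightarrow> 'n list set" where
  "multi_index k = {I. length I = k}"

text \<open>\<open>jacobian c c' p i j\<close> is the partial derivative of the \<open>i\<close>-th coordinate of \<open>c\<close> with
  respect to the \<open>j\<close>-th coordinate of \<open>c'\<close>.\<close>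

definition jacobian :: "('m, 'n::finite) chart \<Rightarrow> ('m, 'n) chart \<Rightarrow> 'm \<Rightarrow> 'n \<Rightarrow> 'n \<Rightarrow> real" where
  "jacobian c c' p i j = partial c' j (\<lambda>q. snd c q $ i) p"

definition tensor_field :: "('m, 'n::finite) chart set \<Rightarrow> nat \<Rightarrow> ('m, 'n) tensor \<Rightarrow> bool" where
  "tensor_field A k F \<longleftrightarrow>
     (\<forall>c\<in>A. \<forall>c'\<in>A. \<forall>p\<in>fst c \<inter> fst c'. \<forall>J\<in>multi_index k.
        F c' p J = (\<Sum>I\<in>multi_index k. (\<Prod>l<k. jacobian c c' p (I ! l) (J ! l)) * F c p I))"

definition smooth_tensor :: "('m, 'n::finite) chart set \<Rightarrow> nat \<Rightarrow> ('m, 'n) tensor \<Rightarrow> bool" where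
  "smooth_tensor A k F \<longleftrightarrow> tensor_field A k F \<and>
     (\<forall>c\<in>A. \<forall>I\<in>multi_index k. smooth_on (snd c ` fst c) (\<lambda>x. F c (cinv c x) I))"

definition smooth_tensor_family ::
    "('m, 'n::finite) chart set \<Rightarrow> real \<Rightarrow> nat \<Rightarrow> (real \<Rightarrow> ('m, 'n) tensor) \<Rightarrow> bool" where
  "smooth_tensor_family A T k F \<longleftrightarrow> (\<forall>t\<in>{0..T}. tensor_field A k (F t)) \<and>
     (\<forall>c\<in>A. \<forall>I\<in>multi_index k.
        smooth_on (snd c ` fst c \<times> {0..T}) (\<lambda>(x, t). F t c (cinv c x) I))"

definition smooth_function_family ::
    "('m, 'n::finite) chart set \<Rightarrow> real \<Rightarrow> (real \<Rightarrow> 'm \<Rightarrow> real) \<Rightarrow> bool" where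
  "smooth_function_family A T u \<longleftrightarrow>
     (\<forall>c\<in>A. smooth_on (snd c ` fst c \<times> {0..T}) (\<lambda>(x, t). u t (cinv c x)))"

text \<open>Inequality of symmetric 2-tensors in the sense of quadratic forms.\<close>

definition tensor_le :: "('m, 'n::finite) chart set \<Rightarrow> ('m, 'n) tensor \<Rightarrow> ('m, 'n) tensor \<Rightarrow> bool" where
  "tensor_le A R S \<longleftrightarrow> (\<forall>c\<in>A. \<forall>p\<in>fst c. \<forall>v :: real ^ 'n.
     (\<Sum>i\<in>UNIV. \<Sum>j\<in>UNIV. R c p [i, j] * v $ i * v $ j)
       \<le> (\<Sum>i\<in>UNIV. \<Sum>j\<in>UNIV. S c p [i, j] * v $ i * v $ j))"

definition tensor_scale :: "real \<Rightarrow> ('m, 'n) tensor \<Rightarrow> ('m, 'n) tensor" where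
  "tensor_scale r F = (\<lambda>c p I. r * F c p I)"

definition differential :: "('m \<Rightarrow> real) \<Rightarrow> ('m, 'n::finite) tensor" where
  "differential f = (\<lambda>c p I. partial c (hd I) f p)"


section \<open>Differential forms\<close>

definition alternating :: "('m, 'n::finite) chart set \<Rightarrow> nat \<Rightarrow> ('m, 'n) tensor \<Rightarrow> bool" where
  "alternating A k F \<longleftrightarrow> (\<forall>c\<in>A. \<forall>p\<in>fst c. \<forall>I\<in>multi_index k. \<forall>i<k. \<forall>j<k. i \<noteq> j \<longrightarrow>
     F c p (I[i := I ! j, j := I ! i]) = - F c p I)"

definition smooth_form :: "('m, 'n::finite) chart set \<Rightarrow> nat \<Rightarrow> ('m, 'n) tensor \<Rightarrow> bool" where
  "smooth_form A k F \<longleftrightarrow> smooth_tensor A k F \<and> alternating A k F"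

definition ext_d :: "('m, 'n::finite) tensor \<Rightarrow> ('m, 'n) tensor" where
  "ext_d F = (\<lambda>c p I. \<Sum>l<length I.
     (-1) ^ l * partial c (I ! l) (\<lambda>q. F c q (take l I @ drop (Suc l) I)) p)"

definition closed_form :: "('m, 'n::finite) chart set \<Rightarrow> nat \<Rightarrow> ('m, 'n) tensor \<Rightarrow> bool" where
  "closed_form A k F \<longleftrightarrow>
     (\<forall>c\<in>A. \<forall>p\<in>fst c. \<forall>I\<in>multi_index (Suc k). ext_d F c p I = 0)"


section \<open>Riemannian metrics\<close>

definition riemannian_metric :: "('m, 'n::finite) chart set \<Rightarrow> ('m, 'n) tensor \<Rightarrow> bool" where
  "riemannian_metric A g \<longleftrightarrow> smooth_tensor A 2 g \<and>
     (\<forall>c\<in>A. \<forall>p\<in>fst c.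
        (\<forall>i j. g c p [i, j] = g c p [j, i]) \<and>
        (\<forall>v :: real ^ 'n. v \<noteq> 0 \<longrightarrow> (\<Sum>i\<in>UNIV. \<Sum>j\<in>UNIV. g c p [i, j] * v $ i * v $ j) > 0))"

definition metric_matrix :: "('m, 'n::finite) tensor \<Rightarrow> ('m, 'n) chart \<Rightarrow> 'm \<Rightarrow> real ^ 'n ^ 'n" where
  "metric_matrix g c p = (\<chi> i j. g c p [i, j])"

text \<open>The components with upper indices.\<close>

definition ginv :: "('m, 'n::finite) tensor \<Rightarrow> ('m, 'n) chart \<Rightarrow> 'm \<Rightarrow> 'n \<Rightarrow> 'n \<Rightarrow> real" where
  "ginv g c p i j = matrix_inv (metric_matrix g c p) $ i $ j"

text \<open>Inner product and norm of two rank \<open>k\<close> tensors at a point, given by their components in the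
  chart \<open>c\<close> (full contraction, without combinatorial factor).\<close>

definition tensor_inner :: "nat \<Rightarrow> ('m, 'n::finite) tensor \<Rightarrow> ('m, 'n) chart \<Rightarrow> 'm \<Rightarrow>
    ('n list \<Rightarrow> real) \<Rightarrow> ('n list \<Rightarrow> real) \<Rightarrow> real" where
  "tensor_inner k g c p R S = (\<Sum>I\<in>multi_index k. \<Sum>J\<in>multi_index k.
     (\<Prod>l<k. ginv g c p (I ! l) (J ! l)) * R I * S J)"

definition tensor_norm :: "nat \<Rightarrow> ('m, 'n::finite) tensor \<Rightarrow> ('m, 'n) chart \<Rightarrow> 'm \<Rightarrow>
    ('n list \<Rightarrow> real) \<Rightarrow> real" where
  "tensor_norm k g c p R = sqrt (tensor_inner k g c p R R)"

definition christoffel ::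
    "('m, 'n::finite) tensor \<Rightarrow> ('m, 'n) chart \<Rightarrow> 'm \<Rightarrow> 'n \<Rightarrow> 'n \<Rightarrow> 'n \<Rightarrow> real" where
  "christoffel g c p m i j = 1 / 2 * (\<Sum>l\<in>UNIV. ginv g c p m l *
     (partial c i (\<lambda>q. g c q [j, l]) p + partial c j (\<lambda>q. g c q [i, l]) p
        - partial c l (\<lambda>q. g c q [i, j]) p))"

text \<open>Levi-Civita covariant derivative; the direction of differentiation is the first index of the
  result.\<close>

definition nabla :: "('m, 'n::finite) tensor \<Rightarrow> ('m, 'n) tensor \<Rightarrow> ('m, 'n) tensor" where
  "nabla g F = (\<lambda>c p I. let j = hd I; J = tl I in
     partial c j (\<lambda>q. F c q J) p
       - (\<Sum>l<length J. \<Sum>m\<in>UNIV. christoffel g c p m j (J ! l) * F c p (J[l := m])))"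

definition laplacian ::
    "('m, 'n::finite) tensor \<Rightarrow> ('m \<Rightarrow> real) \<Rightarrow> ('m, 'n) chart \<Rightarrow> 'm \<Rightarrow> real" where
  "laplacian g f c p =
     (\<Sum>i\<in>UNIV. \<Sum>j\<in>UNIV. ginv g c p i j * nabla g (differential f) c p [i, j])"

text \<open>\<open>riemann g c p l k i j\<close> is the \<open>l\<close>-th component of \<open>R(\<partial>\<^sub>i, \<partial>\<^sub>j) \<partial>\<^sub>k\<close>, where
  \<open>R(X, Y) = \<nabla>\<^sub>X \<nabla>\<^sub>Y - \<nabla>\<^sub>Y \<nabla>\<^sub>X - \<nabla>\<^bsub>[X, Y]\<^esub>\<close>, and \<open>Ric(Y, Z)\<close> is the trace of \<open>X \<mapsto> R(X, Y) Z\<close>.\<close>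

definition riemann ::
    "('m, 'n::finite) tensor \<Rightarrow> ('m, 'n) chart \<Rightarrow> 'm \<Rightarrow> 'n \<Rightarrow> 'n \<Rightarrow> 'n \<Rightarrow> 'n \<Rightarrow> real" where
  "riemann g c p l k i j =
     partial c i (\<lambda>q. christoffel g c q l j k) p - partial c j (\<lambda>q. christoffel g c q l i k) p
     + (\<Sum>m\<in>UNIV. christoffel g c p l i m * christoffel g c p m j k
                  - christoffel g c p l j m * christoffel g c p m i k)"

definition ricci :: "('m, 'n::finite) tensor \<Rightarrow> ('m, 'n) tensor" where
  "ricci g = (\<lambda>c p I. \<Sum>i\<in>UNIV. riemann g c p i (I ! 1) i (I ! 0))"


section \<open>Volume and the codifferential\<close>

definition volume :: "('m::topological_space, 'n::finite) chart set \<Rightarrow> ('m, 'n) tensor \<Rightarrow> 'm measure" where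
  "volume A g = (THE \<mu>. sets \<mu> = sets borel \<and>
     (\<forall>c\<in>A. \<forall>B\<in>sets borel. B \<subseteq> fst c \<longrightarrow>
        emeasure \<mu> B =
          (\<integral>\<^sup>+x. ennreal (sqrt (det (metric_matrix g c (cinv c x)))) * indicator (snd c ` B) x \<partial>lborel)))"

text \<open>Pointwise inner product of \<open>k\<close>-forms, normalised so that \<open>dx\<^bsup>i\<^sub>1\<^esup> \<and> \<dots> \<and> dx\<^bsup>i\<^sub>k\<^esup>\<close> has norm 1
  in orthonormal coordinates. Its value does not depend on the chart.\<close>

definition form_inner :: "('m, 'n::finite) chart set \<Rightarrow> nat \<Rightarrow> ('m, 'n) tensor \<Rightarrow>
    ('m, 'n) tensor \<Rightarrow> ('m, 'n) tensor \<Rightarrow> 'm \<Rightarrow> real" where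
  "form_inner A k g R S p = (let c = (SOME c. c \<in> A \<and> p \<in> fst c) in
     tensor_inner k g c p (R c p) (S c p) / fact k)"

text \<open>\<open>codifferential A g k \<omega> \<eta>\<close> says that the \<open>k\<close>-form \<open>\<eta>\<close> is \<open>d\<^sup>* \<omega>\<close> for the \<open>(k+1)\<close>-form \<open>\<omega>\<close>,
  where \<open>d\<^sup>*\<close> is the adjoint of \<open>d\<close> for the \<open>L\<^sup>2\<close> inner products of \<open>g\<close> on a closed manifold.
  It is a relation because a tensor is unspecified on irrelevant arguments.\<close>

definition codifferential :: "('m::topological_space, 'n::finite) chart set \<Rightarrow> ('m, 'n) tensor \<Rightarrow>
    nat \<Rightarrow> ('m, 'n) tensor \<Rightarrow> ('m, 'n) tensor \<Rightarrow> bool" where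
  "codifferential A g k \<omega> \<eta> \<longleftrightarrow> smooth_form A k \<eta> \<and>
     (\<forall>\<theta>. smooth_form A k \<theta> \<longrightarrow>
        (LINT p|volume A g. form_inner A (Suc k) g (ext_d \<theta>) \<omega> p)
          = (LINT p|volume A g. form_inner A k g \<theta> \<eta> p))"


section \<open>Generalized Ricci flow\<close>

definition interior_coord :: "'n \<Rightarrow> ('m, 'n) tensor \<Rightarrow> ('m, 'n) tensor" where
  "interior_coord i H = (\<lambda>c p I. H c p (i # I))"

text \<open>The components of \<open>H\<^sup>2(X, Y) = \<langle>i\<^sub>X H, i\<^sub>Y H\<rangle>\<close>, with the tensor inner product,
  so that \<open>H\<^sup>2\<^sub>i\<^sub>j = g\<^sup>k\<^sup>l g\<^sup>p\<^sup>q H\<^sub>i\<^sub>k\<^sub>p H\<^sub>j\<^sub>l\<^sub>q\<close>.\<close>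

definition H_squared :: "('m, 'n::finite) tensor \<Rightarrow> ('m, 'n) tensor \<Rightarrow> ('m, 'n) tensor" where
  "H_squared g H = (\<lambda>c p I.
     tensor_inner 2 g c p (interior_coord (I ! 0) H c p) (interior_coord (I ! 1) H c p))"

definition generalized_ricci_flow :: "('m::topological_space, 'n::finite) chart set \<Rightarrow> real \<Rightarrow>
    (real \<Rightarrow> ('m, 'n) tensor) \<Rightarrow> (real \<Rightarrow> ('m, 'n) tensor) \<Rightarrow> bool" where
  "generalized_ricci_flow A T g H \<longleftrightarrow>
     smooth_tensor_family A T 2 g \<and> smooth_tensor_family A T 3 H \<and>
     (\<forall>t\<in>{0..T}.
        riemannian_metric A (g t) \<and> smooth_form A 3 (H t) \<and> closed_form A 3 (H t) \<and>
        (\<forall>c\<in>A. \<forall>p\<in>fst c. \<forall>I\<in>multi_index 2.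
           ((\<lambda>s. g s c p I) has_real_derivative
              (- 2 * ricci (g t) c p I + 1 / 2 * H_squared (g t) (H t) c p I)) (at t within {0..T})) \<and>
        (\<exists>\<eta>. codifferential A (g t) 2 (H t) \<eta> \<and>
           (\<forall>c\<in>A. \<forall>p\<in>fst c. \<forall>I\<in>multi_index 3.
              ((\<lambda>s. H s c p I) has_real_derivative (- ext_d \<eta> c p I)) (at t within {0..T}))))"

definition heat_solution :: "('m, 'n::finite) chart set \<Rightarrow> real \<Rightarrow> (real \<Rightarrow> ('m, 'n) tensor) \<Rightarrow>
    (real \<Rightarrow> 'm \<Rightarrow> real) \<Rightarrow> bool" where
  "heat_solution A T g u \<longleftrightarrow> (\<forall>t\<in>{0..T}. \<forall>c\<in>A. \<forall>p\<in>fst c.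
     ((\<lambda>s. u s p) has_real_derivative laplacian (g t) (u t) c p) (at t within {0..T}))"

end

theory Submission
  imports Defs
begin

text \<open>
  Put \<open>f = ln u\<close> and \<open>q = |\<nabla>f|\<^sup>2 - \<alpha> \<partial>\<^sub>t f\<close>. Bochner's formula and the evolution equation of the Laplacian give, with
  \<open>S = Ric - H\<^sup>2/4\<close> and \<open>V = 2 div S - \<nabla> tr S\<close>,
  \<open>(\<Delta> - \<partial>\<^sub>t) q + 2 \<langle>\<nabla>f, \<nabla>q\<rangle> = 2 |\<nabla>\<^sup>2f|\<^sup>2 + 2\<alpha> \<langle>S, \<nabla>\<^sup>2f\<rangle> + 2\<alpha> Ric(\<nabla>f, \<nabla>f) - (\<alpha> - 1)/2 H\<^sup>2(\<nabla>f, \<nabla>f) + \<alpha> \<langle>V, \<nabla>f\<rangle>\<close>.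
  The contracted Bianchi identity removes the Ricci part of \<open>V\<close>, so that \<open>16 |V|\<^sup>2 \<le> (3n - 2) |\<nabla>H\<^sup>2|\<^sup>2\<close>.
  Splitting \<open>2 |\<nabla>\<^sup>2f|\<^sup>2\<close> according to \<open>\<alpha> (a + 2b) = 1\<close> and using Young's inequality bounds the right-hand side
  from below by a quadratic polynomial in \<open>q\<close>, and the maximum principle for \<open>t q\<close> gives the estimate for \<open>t < T\<close>;
  it extends to \<open>t = T\<close> by continuity.

  The tensor identities are derived in fixed coordinates, as identities in a commutative ring with commuting
  derivations, which is then instantiated by the smooth functions on a ball.
\<close>


section \<open>Calculus on sets with unique derivatives\<close>

text \<open>The heat equation reads \<open>Dt f = Lap f + W\<close> with
  \<open>W = |grad f|^2\<close>, so \<open>- \<alpha> * Lap f = q + (\<alpha> - 1) * W\<close>. The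
  share \<open>a\<close> of the Hessian bounds \<open>(Lap f)^2\<close>; where \<open>q >= 0\<close>
  this controls \<open>q^2\<close> and \<open>W^2\<close> separately, and \<open>W^2\<close> absorbs
  every term linear in \<open>W\<close>. Their coefficient is
  \<open>\<alpha> * (2 * C / t + 1 / 8)\<close>, with
  \<open>C = K1 + (\<alpha> - 1) * K3 / (4 * \<alpha>)\<close> from the curvature bounds and
  \<open>1 / 8\<close> from the term with \<open>V\<close>. The square of this bracket is the source
  of the parts of \<open>B2\<close>, \<open>B3\<close>, \<open>B1\<close> with
  \<open>(\<alpha> - 1)^2\<close> in the denominator. Two obstacles shape the formal proof.
  Derivatives are one-sided at the times \<open>0\<close> and \<open>T\<close>, whereas the tensor
  identities rest on commuting derivations, so they are used at interior points only. And in a ring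
  derivations are total, which keeps differentiability conditions out of long index computations;
  the price is that a ring need not contain one half, so some identities are doubled.\<close>

text \<open>The hypothesis of \<open>frechet_derivative_unique_within\<close>.\<close>

definition fat :: "'a::euclidean_space set \<Rightarrow> bool" where
  "fat S \<longleftrightarrow> (\<forall>x\<in>S. \<forall>i\<in>Basis. \<forall>e>0. \<exists>d. 0 < \<bar>d\<bar> \<and> \<bar>d\<bar> < e \<and> x + d *\<^sub>R i \<in> S)"

definition dir :: "'a::real_normed_vector set \<Rightarrow> 'a \<Rightarrow> ('a \<Rightarrow> real) \<Rightarrow> 'a \<Rightarrow> real" where
  "dir S v f x = frechet_derivative f (at x within S) v"

lemma fat_open: "open S \<Longrightarrow> fat S"
  unfolding fat_def
proof safe
  fix x i :: 'a and e :: real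
  assume "open S" "x \<in> S" "i \<in> Basis" "e > 0"
  then obtain r where r: "r > 0" "ball x r \<subseteq> S"
    by (meson openE)
  define d where "d = min (e / 2) (r / 2)"
  have "x + d *\<^sub>R i \<in> ball x r"
    using \<open>i \<in> Basis\<close> r \<open>e > 0\<close> by (auto simp: d_def dist_norm)
  thus "\<exists>d. 0 < \<bar>d\<bar> \<and> \<bar>d\<bar> < e \<and> x + d *\<^sub>R i \<in> S"
    using r \<open>e > 0\<close> by (intro exI[of _ d]) (auto simp: d_def)
qed

lemma fat_Times_interval:
  fixes V :: "'a::euclidean_space set" and T :: real
  assumes V: "open V" and T: "T > 0"
  shows "fat (V \<times> {0..T})"
  unfolding fat_def
proof safe
  fix x and t e :: real and a :: 'a and b :: real
  assume xt: "x \<in> V" "t \<in> {0..T}" "(a, b) \<in> Basis" "e > 0"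
  consider "b = 0" "a \<in> Basis" | "a = 0" "b = 1"
    using xt(3) by (auto simp: Basis_prod_def)
  thus "\<exists>d. 0 < \<bar>d\<bar> \<and> \<bar>d\<bar> < e \<and> (x, t) + d *\<^sub>R (a, b) \<in> V \<times> {0..T}"
  proof cases
    case 1
    thus ?thesis
      using fat_open[OF V, unfolded fat_def, rule_format, OF xt(1) 1(2) xt(4)] xt by auto
  next
    case 2
    \<comment> \<open>At \<open>t = T\<close> the step goes back in time, and the minimum with
      \<open>T\<close> keeps it inside the interval.\<close>
    define d where "d = (if t < T then min (e / 2) (T - t) else - min (e / 2) T)"
    show ?thesis
      using xt T 2 by (intro exI[of _ d]) (auto simp: d_def)
  qed
qed

lemma has_derivative_cong_on:
  assumes "x \<in> S" "\<And>y. y \<in> S \<Longrightarrow> f y = g y"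
  shows "(f has_derivative D) (at x within S) \<longleftrightarrow> (g has_derivative D) (at x within S)"
  using assms by (metis has_derivative_transform)

lemma frechet_derivative_cong_on:
  assumes "x \<in> S" "\<And>y. y \<in> S \<Longrightarrow> f y = g y"
  shows "frechet_derivative f (at x within S) = frechet_derivative g (at x within S)"
  unfolding frechet_derivative_def using has_derivative_cong_on[OF assms] by simp

lemma dir_cong: "x \<in> S \<Longrightarrow> (\<And>y. y \<in> S \<Longrightarrow> f y = g y) \<Longrightarrow> dir S v f x = dir S v g x"
  unfolding dir_def by (metis frechet_derivative_cong_on)

lemma Ck_on_cong:
  assumes "\<And>y. y \<in> S \<Longrightarrow> f y = g y"
  shows "Ck_on k S f \<longleftrightarrow> Ck_on k S g"
  using assms
proof (induction k arbitrary: f g)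
  case 0
  thus ?case by (simp cong: continuous_on_cong)
next
  case (Suc k)
  have "f differentiable_on S \<longleftrightarrow> g differentiable_on S"
    unfolding differentiable_on_def differentiable_def
    using has_derivative_cong_on[of _ S f g] Suc.prems by blast
  moreover have "Ck_on k S (\<lambda>x. frechet_derivative f (at x within S) v)
      \<longleftrightarrow> Ck_on k S (\<lambda>x. frechet_derivative g (at x within S) v)" for v
    using frechet_derivative_cong_on[of _ S f g] Suc.prems by (intro Suc.IH) simp
  ultimately show ?case by simp
qed

lemma smooth_on_cong: "(\<And>y. y \<in> S \<Longrightarrow> f y = g y) \<Longrightarrow> smooth_on S f \<longleftrightarrow> smooth_on S g"
  unfolding smooth_on_def using Ck_on_cong by blast

lemma Ck_on_SucD: "Ck_on (Suc k) S f \<Longrightarrow> Ck_on k S f"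
proof (induction k arbitrary: f)
  case 0
  thus ?case by (simp add: differentiable_imp_continuous_on)
next
  case (Suc k)
  thus ?case by (subst Ck_on.simps) (auto simp del: Ck_on.simps(2) simp: Ck_on.simps(2)[of "Suc k"])
qed

lemma Ck_on_Suc_iff: "Ck_on (Suc k) S f \<longleftrightarrow> f differentiable_on S \<and> (\<forall>v. Ck_on k S (dir S v f))"
  by (simp add: dir_def[abs_def])

text \<open>Inside an open \<open>U\<close> the filters \<open>at x within S\<close> and
  \<open>at x within U\<close> coincide, so all iterated derivatives agree.\<close>

lemma Ck_on_subset_open:
  assumes "open U" "U \<subseteq> S" "Ck_on k S f"
  shows "Ck_on k U f"
  using assms(3)
proof (induction k arbitrary: f)
  case 0
  thus ?case using assms(2) by (simp add: continuous_on_subset)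
next
  case (Suc k)
  have "at x within S = at x within U" if "x \<in> U" for x
    using that assms(1,2) by (metis at_within_open at_within_open_subset)
  hence "Ck_on k U (\<lambda>x. frechet_derivative f (at x within U) v)" for v
    using Suc.IH[of "\<lambda>x. frechet_derivative f (at x within S) v"] Suc.prems
    by (subst Ck_on_cong[where g = "\<lambda>x. frechet_derivative f (at x within S) v"]) auto
  moreover have "f differentiable_on U"
    using Suc.prems assms(2) by (auto intro: differentiable_on_subset)
  ultimately show ?case by simp
qed

lemma smooth_on_subset_open: "smooth_on S f \<Longrightarrow> open U \<Longrightarrow> U \<subseteq> S \<Longrightarrow> smooth_on U f"
  unfolding smooth_on_def using Ck_on_subset_open by blast

lemma dir_subset_open: "open U \<Longrightarrow> U \<subseteq> S \<Longrightarrow> x \<in> U \<Longrightarrow> dir U v f x = dir S v f x"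
  unfolding dir_def by (metis at_within_open at_within_open_subset)

lemma smooth_on_imp_continuous_on: "smooth_on S f \<Longrightarrow> continuous_on S f"
  unfolding smooth_on_def by (metis Ck_on.simps(1))

lemma smooth_on_dir: "smooth_on S f \<Longrightarrow> smooth_on S (dir S v f)"
  unfolding smooth_on_def dir_def[abs_def] using Ck_on.simps(2) by blast

lemma has_derivative_frechet:
  "f differentiable_on S \<Longrightarrow> x \<in> S \<Longrightarrow> (f has_derivative frechet_derivative f (at x within S)) (at x within S)"
  unfolding differentiable_on_def using frechet_derivative_works by blast

lemma smooth_on_has_derivative:
  "smooth_on S f \<Longrightarrow> x \<in> S \<Longrightarrow> (f has_derivative (\<lambda>v. dir S v f x)) (at x within S)"
  unfolding dir_def using has_derivative_frechet[of f S x]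
  by (metis smooth_on_def Ck_on.simps(2))

text \<open>On a fat set the derivative is determined, so the value picked by
  \<open>frechet_derivative\<close> agrees with any derivative that can be exhibited. The calculus
  rules for \<open>dir\<close> are obtained from rules for \<open>has_derivative\<close> in this
  way.\<close>

lemma dir_unique:
  assumes "fat S" "x \<in> S" "(f has_derivative D) (at x within S)"
  shows "dir S v f x = D v"
proof -
  have "(f has_derivative frechet_derivative f (at x within S)) (at x within S)"
    using assms(3) differentiable_def frechet_derivative_works by blast
  hence "frechet_derivative f (at x within S) = D"
    using assms by (intro frechet_derivative_unique_within) (auto simp: fat_def)
  thus ?thesis by (simp add: dir_def)
qed

context
  fixes S :: "'a::euclidean_space set"
  assumes fat: "fat S"
begin

lemma dir_rules:
  assumes "x \<in> S" "f differentiable_on S" "g differentiable_on S"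
  shows "dir S v (\<lambda>x. f x + g x) x = dir S v f x + dir S v g x"
    and "dir S v (\<lambda>x. f x * g x) x = dir S v f x * g x + f x * dir S v g x"
    and "dir S v (\<lambda>x. - f x) x = - dir S v f x"
    and "f x \<noteq> 0 \<Longrightarrow> dir S v (\<lambda>x. inverse (f x)) x = - (inverse (f x) * dir S v f x * inverse (f x))"
    and "f x > 0 \<Longrightarrow> dir S v (\<lambda>x. ln (f x)) x = dir S v f x * inverse (f x)"
proof -
  note D = has_derivative_frechet[OF assms(2) assms(1)] has_derivative_frechet[OF assms(3) assms(1)]
  show "dir S v (\<lambda>x. f x + g x) x = dir S v f x + dir S v g x"
    using dir_unique[OF fat assms(1) has_derivative_add[OF D]] by (simp add: dir_def)
  show "dir S v (\<lambda>x. f x * g x) x = dir S v f x * g x + f x * dir S v g x"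
    using dir_unique[OF fat assms(1) has_derivative_mult[OF D]] by (simp add: dir_def)
  show "dir S v (\<lambda>x. - f x) x = - dir S v f x"
    using dir_unique[OF fat assms(1) has_derivative_minus[OF D(1)]] by (simp add: dir_def)
  show "dir S v (\<lambda>x. inverse (f x)) x = - (inverse (f x) * dir S v f x * inverse (f x))" if "f x \<noteq> 0"
    using dir_unique[OF fat assms(1) Deriv.has_derivative_inverse[OF that D(1)]] by (simp add: dir_def)
  show "dir S v (\<lambda>x. ln (f x)) x = dir S v f x * inverse (f x)" if "f x > 0"
    using dir_unique[OF fat assms(1) has_derivative_ln[OF that D(1)]] by (simp add: dir_def divide_inverse)
qed

lemma dir_const: "x \<in> S \<Longrightarrow> dir S v (\<lambda>x. c) x = 0"
  using dir_unique[OF fat _ has_derivative_const] by blast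

lemma Ck_on_const: "Ck_on k S (\<lambda>x. c :: real)"
proof (induction k arbitrary: c)
  case (Suc k)
  have "Ck_on k S (dir S v (\<lambda>x. c))" for v
    using Suc.IH[of 0] by (subst Ck_on_cong[where g = "\<lambda>x. 0"]) (auto simp: dir_const)
  thus ?case unfolding Ck_on_Suc_iff by simp
qed simp

lemma Ck_on_add: "Ck_on k S f \<Longrightarrow> Ck_on k S g \<Longrightarrow> Ck_on k S (\<lambda>x. f x + g x :: real)"
proof (induction k arbitrary: f g)
  case 0
  thus ?case by (simp add: continuous_on_add)
next
  case (Suc k)
  hence "Ck_on k S (\<lambda>x. dir S v f x + dir S v g x)" for v
    unfolding Ck_on_Suc_iff by simp
  hence "Ck_on k S (dir S v (\<lambda>x. f x + g x))" for v
    using Suc.prems unfolding Ck_on_Suc_iff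
    by (subst Ck_on_cong[where g = "\<lambda>x. dir S v f x + dir S v g x"]) (simp_all add: dir_rules)
  thus ?case using Suc.prems unfolding Ck_on_Suc_iff by simp
qed

text \<open>The Leibniz rule differentiates one factor and keeps the other, so the induction
  generalises over both, and \<open>Ck_on_SucD\<close> lowers the order of the factor that is
  kept.\<close>

lemma Ck_on_mult: "Ck_on k S f \<Longrightarrow> Ck_on k S g \<Longrightarrow> Ck_on k S (\<lambda>x. f x * g x :: real)"
proof (induction k arbitrary: f g)
  case 0
  thus ?case by (simp add: continuous_on_mult)
next
  case (Suc k)
  hence "Ck_on k S (\<lambda>x. dir S v f x * g x + f x * dir S v g x)" for v
    using Ck_on_SucD[OF Suc.prems(1)] Ck_on_SucD[OF Suc.prems(2)]
    unfolding Ck_on_Suc_iff by (intro Ck_on_add) simp_all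
  hence "Ck_on k S (dir S v (\<lambda>x. f x * g x))" for v
    using Suc.prems unfolding Ck_on_Suc_iff
    by (subst Ck_on_cong[where g = "\<lambda>x. dir S v f x * g x + f x * dir S v g x"]) (simp_all add: dir_rules)
  thus ?case using Suc.prems unfolding Ck_on_Suc_iff by simp
qed

lemma Ck_on_minus: "Ck_on k S f \<Longrightarrow> Ck_on k S (\<lambda>x. - f x :: real)"
  using Ck_on_mult[OF Ck_on_const[of k "-1"]] by simp

text \<open>The derivative is a product of \<open>inverse (f x)\<close>, covered by the induction
  hypothesis for the same \<open>f\<close>, and of \<open>dir S v f\<close>.\<close>

lemma Ck_on_inverse:
  "Ck_on k S f \<Longrightarrow> (\<And>x. x \<in> S \<Longrightarrow> f x \<noteq> 0) \<Longrightarrow> Ck_on k S (\<lambda>x. inverse (f x) :: real)"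
proof (induction k)
  case 0
  thus ?case by (simp add: continuous_on_inverse)
next
  case (Suc k)
  have "Ck_on k S (\<lambda>x. - (inverse (f x) * dir S v f x * inverse (f x)))" for v
    using Suc.IH Ck_on_SucD[OF Suc.prems(1)] Suc.prems unfolding Ck_on_Suc_iff
    by (intro Ck_on_minus Ck_on_mult) simp_all
  hence "Ck_on k S (dir S v (\<lambda>x. inverse (f x)))" for v
    using Suc.prems unfolding Ck_on_Suc_iff
    by (subst Ck_on_cong[where g = "\<lambda>x. - (inverse (f x) * dir S v f x * inverse (f x))"]) (simp_all add: dir_rules(4)[of _ f f])
  moreover have "(\<lambda>x. inverse (f x)) differentiable_on S"
    using Suc.prems unfolding Ck_on_Suc_iff by (simp add: differentiable_on_inverse)
  ultimately show ?case unfolding Ck_on_Suc_iff by simp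
qed

text \<open>A case distinction replaces induction: the derivative is a product of
  \<open>dir S v f\<close> and the inverse of \<open>f\<close>, whose regularity is known.\<close>

lemma Ck_on_ln:
  assumes "Ck_on k S f" and pos: "\<And>x. x \<in> S \<Longrightarrow> f x > 0"
  shows "Ck_on k S (\<lambda>x. ln (f x :: real))"
proof (cases k)
  case 0
  have "\<forall>x\<in>S. f x \<noteq> 0" using pos by (metis order.irrefl)
  thus ?thesis using assms 0 by (simp add: continuous_on_ln)
next
  case (Suc j)
  have "Ck_on j S (\<lambda>x. dir S v f x * inverse (f x))" for v
    using assms Ck_on_SucD[of j S f] unfolding Suc Ck_on_Suc_iff
    by (intro Ck_on_mult Ck_on_inverse) (auto simp: less_imp_neq[symmetric])
  hence "Ck_on j S (dir S v (\<lambda>x. ln (f x)))" for v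
    using assms unfolding Suc Ck_on_Suc_iff
    by (subst Ck_on_cong[where g = "\<lambda>x. dir S v f x * inverse (f x)"]) (simp_all add: dir_rules(5)[of _ f f])
  moreover have "(\<lambda>x. ln (f x)) differentiable_on S"
    unfolding differentiable_on_def
  proof
    fix x assume "x \<in> S"
    hence "((\<lambda>x. ln (f x)) has_derivative (\<lambda>v. frechet_derivative f (at x within S) v * inverse (f x))) (at x within S)"
      using assms has_derivative_ln[OF pos has_derivative_frechet[of f S x]] unfolding Suc Ck_on_Suc_iff
      by (simp add: divide_inverse mult.commute)
    thus "(\<lambda>x. ln (f x)) differentiable (at x within S)"
      unfolding differentiable_def by blast
  qed
  ultimately show ?thesis unfolding Suc Ck_on_Suc_iff by simp
qed

lemma smooth_on_const: "smooth_on S (\<lambda>x. c :: real)"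
  and smooth_on_add: "smooth_on S f \<Longrightarrow> smooth_on S g \<Longrightarrow> smooth_on S (\<lambda>x. f x + g x :: real)"
  and smooth_on_mult: "smooth_on S f \<Longrightarrow> smooth_on S g \<Longrightarrow> smooth_on S (\<lambda>x. f x * g x :: real)"
  and smooth_on_minus: "smooth_on S f \<Longrightarrow> smooth_on S (\<lambda>x. - f x :: real)"
  and smooth_on_inverse: "smooth_on S f \<Longrightarrow> (\<And>x. x \<in> S \<Longrightarrow> f x \<noteq> 0) \<Longrightarrow> smooth_on S (\<lambda>x. inverse (f x) :: real)"
  and smooth_on_ln: "smooth_on S f \<Longrightarrow> (\<And>x. x \<in> S \<Longrightarrow> f x > 0) \<Longrightarrow> smooth_on S (\<lambda>x. ln (f x :: real))"
  unfolding smooth_on_def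
  by (blast intro: Ck_on_const Ck_on_add Ck_on_mult Ck_on_minus Ck_on_inverse Ck_on_ln)+

lemma smooth_on_diff: "smooth_on S f \<Longrightarrow> smooth_on S g \<Longrightarrow> smooth_on S (\<lambda>x. f x - g x :: real)"
  using smooth_on_add[OF _ smooth_on_minus] by fastforce

lemma smooth_on_divide:
  "smooth_on S f \<Longrightarrow> smooth_on S g \<Longrightarrow> (\<And>x. x \<in> S \<Longrightarrow> g x \<noteq> 0) \<Longrightarrow> smooth_on S (\<lambda>x. f x / g x :: real)"
  unfolding divide_inverse by (intro smooth_on_mult smooth_on_inverse)

lemma smooth_on_sum: "(\<And>i. i \<in> I \<Longrightarrow> smooth_on S (F i)) \<Longrightarrow> smooth_on S (\<lambda>x. \<Sum>i\<in>I. F i x :: real)"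
  by (induction I rule: infinite_finite_induct) (simp_all add: smooth_on_const smooth_on_add)

lemma smooth_on_prod: "(\<And>i. i \<in> I \<Longrightarrow> smooth_on S (F i)) \<Longrightarrow> smooth_on S (\<lambda>x. \<Prod>i\<in>I. F i x :: real)"
  by (induction I rule: infinite_finite_induct) (simp_all add: smooth_on_const smooth_on_mult)

lemma smooth_on_det: "(\<And>i j. smooth_on S (\<lambda>x. M x $ i $ j)) \<Longrightarrow> smooth_on S (\<lambda>x. det (M x :: real^'n^'n))"
  unfolding det_def by (intro smooth_on_sum smooth_on_mult smooth_on_const smooth_on_prod)

end

section \<open>Smooth dependence of the inverse matrix\<close>

lemma matrix_inv_invertible:
  assumes "invertible (M :: real^'n^'n)"
  shows "M ** matrix_inv M = mat 1" "matrix_inv M ** M = mat 1"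
  using someI_ex[OF assms[unfolded invertible_def]] unfolding matrix_inv_def by auto

text \<open>Cramer's rule for the \<open>j\<close>-th column of the inverse. It exhibits the entries
  as quotients of polynomials in the entries of \<open>M\<close>, which makes smoothness in a
  parameter visible.\<close>

lemma matrix_inv_cofactor:
  fixes M :: "real^'n^'n"
  assumes "det M \<noteq> 0"
  shows "matrix_inv M $ i $ j = det (\<chi> k l. if l = i then axis j 1 $ k else M $ k $ l) / det M"
proof -
  have inv: "invertible M"
    using assms by (simp add: invertible_det_nz)
  define x where "x = matrix_inv M *v axis j 1"
  have "M *v x = axis j 1"
    using matrix_inv_invertible(1)[OF inv] by (simp add: x_def matrix_vector_mul_assoc)
  hence "x = (\<chi> k. det (\<chi> i l. if l = k then axis j 1 $ i else M $ i $ l) / det M)"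
    using cramer[OF assms, of x "axis j 1"] by blast
  moreover have "x $ i = matrix_inv M $ i $ j"
    by (simp add: x_def matrix_vector_mul_component inner_axis)
  ultimately show ?thesis by (metis (no_types, lifting) vec_lambda_beta)
qed

lemma smooth_on_matrix_inv:
  fixes M :: "'a::euclidean_space \<Rightarrow> real^'n^'n"
  assumes fat: "fat S" and M: "\<And>i j. smooth_on S (\<lambda>x. M x $ i $ j)" and nz: "\<And>x. x \<in> S \<Longrightarrow> det (M x) \<noteq> 0"
  shows "smooth_on S (\<lambda>x. matrix_inv (M x) $ i $ j)"
proof -
  have "smooth_on S (\<lambda>x. det (\<chi> k l. if l = i then axis j 1 $ k else M x $ k $ l) / det (M x))"
  proof (intro smooth_on_divide[OF fat] smooth_on_det[OF fat] M nz)
    fix k l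
    show "smooth_on S (\<lambda>x. (\<chi> k l. if l = i then axis j 1 $ k else M x $ k $ l) $ k $ l)"
      using M smooth_on_const[OF fat] by (cases "l = i") simp_all
  qed
  thus ?thesis
    using smooth_on_cong matrix_inv_cofactor[OF nz] by (metis (no_types, lifting))
qed

lemma smooth_on_differentiable: "smooth_on S f \<Longrightarrow> f differentiable_on S"
  unfolding smooth_on_def by (metis Ck_on.simps(2))

section \<open>Symmetry of second derivatives\<close>

lemma DERIV_dir:
  assumes "y + s *\<^sub>R v \<in> interior S" "smooth_on S f"
  shows "((\<lambda>s. f (y + s *\<^sub>R v)) has_real_derivative dir S v f (y + s *\<^sub>R v)) (at s)"
proof -
  let ?z = "y + s *\<^sub>R v"
  have 1: "(f has_derivative (\<lambda>v. dir S v f ?z)) (at ?z)"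
    using smooth_on_has_derivative[OF assms(2) interior_subset[THEN subsetD, OF assms(1)]] at_within_interior[OF assms(1)]
    by simp
  have "((\<lambda>s. y + s *\<^sub>R v) has_derivative (\<lambda>h. h *\<^sub>R v)) (at s)"
    by (auto intro!: derivative_eq_intros)
  from diff_chain_at[OF this 1] have "((\<lambda>s. f (y + s *\<^sub>R v)) has_derivative (\<lambda>h. dir S (h *\<^sub>R v) f ?z)) (at s)"
    by (simp add: o_def)
  moreover have "dir S (h *\<^sub>R v) f ?z = h * dir S v f ?z" for h
    using linear_cmul[OF has_derivative_linear[OF 1]] by simp
  hence "(\<lambda>h. dir S (h *\<^sub>R v) f ?z) = (*) (dir S v f ?z)"
    by (simp add: fun_eq_iff mult.commute)
  ultimately show ?thesis
    by (simp add: has_field_derivative_def)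
qed

text \<open>The mean value theorem is used for the \<open>w\<close>-difference of \<open>f\<close>
  as a function along \<open>v\<close>, and again for the \<open>v\<close>-derivative along
  \<open>w\<close>. The left-hand side is symmetric in \<open>v\<close> and \<open>w\<close>, so
  exchanging them evaluates it by the other mixed derivative.\<close>

lemma second_difference:
  assumes S: "open S" "smooth_on S f" and h: "h > 0"
    and box: "\<And>s t. s \<in> {0..h} \<Longrightarrow> t \<in> {0..h} \<Longrightarrow> z + s *\<^sub>R v + t *\<^sub>R w \<in> S"
  obtains s t where "s \<in> {0..h}" "t \<in> {0..h}"
    "f (z + h *\<^sub>R v + h *\<^sub>R w) - f (z + h *\<^sub>R v) - f (z + h *\<^sub>R w) + f z
      = h * h * dir S w (dir S v f) (z + s *\<^sub>R v + t *\<^sub>R w)"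
proof -
  define \<phi> where "\<phi> s = f (z + h *\<^sub>R w + s *\<^sub>R v) - f (z + s *\<^sub>R v)" for s
  have "(\<phi> has_real_derivative dir S v f (z + h *\<^sub>R w + s *\<^sub>R v) - dir S v f (z + s *\<^sub>R v)) (at s)"
    if "0 \<le> s" "s \<le> h" for s
    unfolding \<phi>_def using box[of s h] box[of s 0] that h S
    by (intro DERIV_diff DERIV_dir) (auto simp: algebra_simps interior_open)
  from MVT2[OF h this] obtain s where s: "0 < s" "s < h"
    "\<phi> h - \<phi> 0 = h * (dir S v f (z + h *\<^sub>R w + s *\<^sub>R v) - dir S v f (z + s *\<^sub>R v))"
    by auto
  define \<psi> where "\<psi> t = dir S v f (z + s *\<^sub>R v + t *\<^sub>R w)" for t
  have "(\<psi> has_real_derivative dir S w (dir S v f) (z + s *\<^sub>R v + t *\<^sub>R w)) (at t)"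
    if "0 \<le> t" "t \<le> h" for t
    unfolding \<psi>_def using box[of s t] that s S
    by (intro DERIV_dir smooth_on_dir) (auto simp: interior_open)
  from MVT2[OF h this] obtain t where t: "0 < t" "t < h"
    "\<psi> h - \<psi> 0 = h * dir S w (dir S v f) (z + s *\<^sub>R v + t *\<^sub>R w)"
    by auto
  have "\<phi> h - \<phi> 0 = h * (\<psi> h - \<psi> 0)"
    using s(3) by (simp add: \<psi>_def algebra_simps)
  thus ?thesis
    using that[of s t] s(1,2) t by (simp add: \<phi>_def algebra_simps)
qed

text \<open>The second difference over a small parallelogram is \<open>h * h\<close> times a value
  of either mixed derivative. Both are continuous, so these equal values lie within \<open>e\<close>
  of two numbers whose distance is \<open>2 * e\<close>.\<close>

lemma dir_commute:
  fixes S :: "'a::euclidean_space set"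
  assumes S: "open S" "smooth_on S f" and z: "z \<in> S"
  shows "dir S w (dir S v f) z = dir S v (dir S w f) z"
proof (rule ccontr)
  let ?A = "dir S w (dir S v f)" and ?B = "dir S v (dir S w f)"
  define e where "e = \<bar>?A z - ?B z\<bar> / 2"
  assume "?A z \<noteq> ?B z"
  hence e: "e > 0" by (simp add: e_def)
  have "continuous_on S ?A" "continuous_on S ?B"
    using S by (simp_all add: smooth_on_dir smooth_on_imp_continuous_on)
  hence "isCont ?A z" "isCont ?B z"
    using S(1) z by (simp_all add: continuous_on_eq_continuous_at)
  then obtain d1 d2 where d: "d1 > 0" "d2 > 0"
    "\<And>y. dist y z < d1 \<Longrightarrow> dist (?A y) (?A z) < e" "\<And>y. dist y z < d2 \<Longrightarrow> dist (?B y) (?B z) < e"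
    using e unfolding continuous_at_eps_delta dist_norm by metis
  obtain r where r: "r > 0" "ball z r \<subseteq> S"
    using S(1) z openE by blast
  define \<delta> where "\<delta> = min r (min d1 d2)"
  have "\<delta> > 0" using r d by (simp add: \<delta>_def)
  \<comment> \<open>The parallelogram stays within \<open>h * (norm v + norm w)\<close> of
    \<open>z\<close>, which is below \<open>h * (2 * N) = \<delta>\<close>; the summand 1 keeps
    \<open>N\<close> positive if both vectors vanish.\<close>
  define N where "N = norm v + norm w + 1"
  have "N > 0" by (simp add: N_def add_nonneg_pos)
  define h where "h = \<delta> / (2 * N)"
  have h: "h > 0" using \<open>\<delta> > 0\<close> \<open>N > 0\<close> by (simp add: h_def)
  have near: "dist (z + s *\<^sub>R v + t *\<^sub>R w) z < \<delta>" if "s \<in> {0..h}" "t \<in> {0..h}" for s t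
  proof -
    have "dist (z + s *\<^sub>R v + t *\<^sub>R w) z = norm (s *\<^sub>R v + t *\<^sub>R w)"
      by (simp add: dist_norm algebra_simps)
    also have "\<dots> \<le> s * norm v + t * norm w"
      using norm_triangle_ineq[of "s *\<^sub>R v" "t *\<^sub>R w"] that by simp
    also have "\<dots> \<le> h * norm v + h * norm w"
      using that by (intro add_mono mult_right_mono) auto
    also have "\<dots> < h * (2 * N)"
      using h by (simp add: N_def algebra_simps add_nonneg_pos)
    also have "\<dots> = \<delta>" using \<open>N > 0\<close> by (simp add: h_def)
    finally show ?thesis .
  qed
  have near': "dist (z + t *\<^sub>R w + s *\<^sub>R v) z < \<delta>" if "s \<in> {0..h}" "t \<in> {0..h}" for s t
    using near[OF that] by (simp add: algebra_simps)
  have inS: "y \<in> S" if "dist y z < \<delta>" for y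
    using that r by (auto simp: \<delta>_def dist_commute)
  obtain s t where st: "s \<in> {0..h}" "t \<in> {0..h}"
    "f (z + h *\<^sub>R v + h *\<^sub>R w) - f (z + h *\<^sub>R v) - f (z + h *\<^sub>R w) + f z = h * h * ?A (z + s *\<^sub>R v + t *\<^sub>R w)"
    using second_difference[OF S h, of z v w] inS near by metis
  obtain s' t' where st': "s' \<in> {0..h}" "t' \<in> {0..h}"
    "f (z + h *\<^sub>R w + h *\<^sub>R v) - f (z + h *\<^sub>R w) - f (z + h *\<^sub>R v) + f z = h * h * ?B (z + s' *\<^sub>R w + t' *\<^sub>R v)"
    using second_difference[OF S h, of z w v] inS near' by metis
  have "h * h * ?A (z + s *\<^sub>R v + t *\<^sub>R w) = h * h * ?B (z + s' *\<^sub>R w + t' *\<^sub>R v)"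
    using st(3) st'(3) by (simp add: algebra_simps)
  hence "?A (z + s *\<^sub>R v + t *\<^sub>R w) = ?B (z + s' *\<^sub>R w + t' *\<^sub>R v)"
    using h by simp
  moreover have "dist (?A (z + s *\<^sub>R v + t *\<^sub>R w)) (?A z) < e" "dist (?B (z + s' *\<^sub>R w + t' *\<^sub>R v)) (?B z) < e"
    using d near[OF st(1,2)] near'[OF st'(2,1)] by (auto simp: \<delta>_def)
  moreover have "2 * e = \<bar>?A z - ?B z\<bar>"
    by (simp add: e_def)
  ultimately show False
    unfolding dist_real_def by linarith
qed


section \<open>Tensor calculus in a differential ring\<close>

text \<open>Additivity and the Leibniz rule already annihilate the integers, the only numerical
  factors in the tensor identities, so linearity over a field of scalars is not part of the
  notion.\<close>

locale derivation =
  fixes d :: "'r::comm_ring_1 \<Rightarrow> 'r"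
  assumes add: "d (x + y) = d x + d y"
    and mult: "d (x * y) = d x * y + x * d y"
begin

lemma zero: "d 0 = 0"
  using add[of 0 0] by simp

lemma one: "d 1 = 0"
  using mult[of 1 1] by simp

lemma minus: "d (- x) = - d x"
  using add[of x "- x"] zero by (simp add: eq_neg_iff_add_eq_0 add.commute)

lemma diff: "d (x - y) = d x - d y"
  using add[of x "- y"] minus by simp

lemma sum: "d (\<Sum>i\<in>I. F i) = (\<Sum>i\<in>I. d (F i))"
  by (induction I rule: infinite_finite_induct) (simp_all add: zero add)

lemmas rules = zero one add minus diff mult sum

end

text \<open>\<open>h\<close> is the inverse metric and \<open>G k i j\<close> the Christoffel symbol
  with upper index \<open>k\<close>. The connection is characterised by symmetry and metric
  compatibility, since its explicit formula contains one half.\<close>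

locale levi_civita =
  fixes d :: "'n::finite \<Rightarrow> 'r::comm_ring_1 \<Rightarrow> 'r"
    and g h :: "'n \<Rightarrow> 'n \<Rightarrow> 'r"
    and G :: "'n \<Rightarrow> 'n \<Rightarrow> 'n \<Rightarrow> 'r"
  assumes derivation_d: "derivation (d i)"
    and d_commute: "d i (d j x) = d j (d i x)"
    and g_sym: "g i j = g j i"
    and h_sym: "h i j = h j i"
    and g_h: "(\<Sum>k\<in>UNIV. g i k * h k j) = (if i = j then 1 else 0)"
    and G_sym: "G k i j = G k j i"
    and g_parallel: "d k (g i j) = (\<Sum>m\<in>UNIV. G m k i * g m j) + (\<Sum>m\<in>UNIV. G m k j * g i m)"
begin

lemmas d_rules = derivation.rules[OF derivation_d]

lemma h_g: "(\<Sum>k\<in>UNIV. h i k * g k j) = (if i = j then 1 else 0)"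
proof -
  have "(\<Sum>k\<in>UNIV. h i k * g k j) = (\<Sum>k\<in>UNIV. g j k * h k i)"
    by (simp add: g_sym[of j] h_sym[of i] mult.commute)
  thus ?thesis by (simp add: g_h)
qed

lemma delta: "(\<Sum>j\<in>(UNIV::'n set). (if i = j then 1 else 0) * X j) = (X i :: 'r)"
  by (simp add: if_distrib[where f = "\<lambda>c. c * _"] cong: if_cong)

lemma raise_lower: "(\<Sum>a\<in>UNIV. h i a * (\<Sum>b\<in>UNIV. g a b * X b)) = X i"
proof -
  have "(\<Sum>a\<in>UNIV. h i a * (\<Sum>b\<in>UNIV. g a b * X b)) = (\<Sum>b\<in>UNIV. (\<Sum>a\<in>UNIV. h i a * g a b) * X b)"
    unfolding sum_distrib_left sum_distrib_right by (subst sum.swap) (simp add: mult_ac)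
  thus ?thesis by (simp add: h_g delta)
qed

text \<open>Apply \<open>e\<close> to \<open>g h = 1\<close> and multiply by \<open>h\<close>. The
  derivation is arbitrary because the formula serves both the coordinate derivatives and the time
  derivative.\<close>

lemma derivation_inverse:
  assumes "derivation e"
  shows "e (h i j) = - (\<Sum>a\<in>UNIV. h i a * (\<Sum>b\<in>UNIV. e (g a b) * h b j))"
proof -
  interpret e: derivation e by fact
  have "(\<Sum>b\<in>UNIV. g a b * e (h b j)) = - (\<Sum>b\<in>UNIV. e (g a b) * h b j)" for a
  proof -
    have "e (\<Sum>b\<in>UNIV. g a b * h b j) = 0"
      by (simp add: g_h e.rules)
    thus ?thesis
      by (simp add: e.rules sum.distrib eq_neg_iff_add_eq_0 add.commute)
  qed
  hence "(\<Sum>a\<in>UNIV. h i a * (\<Sum>b\<in>UNIV. g a b * e (h b j)))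
      = - (\<Sum>a\<in>UNIV. h i a * (\<Sum>b\<in>UNIV. e (g a b) * h b j))"
    by (simp add: sum_negf)
  thus ?thesis by (simp add: raise_lower)
qed

lemma h_parallel: "d k (h i j) = - (\<Sum>m\<in>UNIV. G i k m * h m j) - (\<Sum>m\<in>UNIV. G j k m * h i m)"
proof -
  have "(\<Sum>b\<in>UNIV. d k (g a b) * h b j) = G j k a + (\<Sum>m\<in>UNIV. g a m * (\<Sum>b\<in>UNIV. G m k b * h b j))" for a
  proof -
    have "(\<Sum>b\<in>UNIV. d k (g a b) * h b j)
        = (\<Sum>b\<in>UNIV. \<Sum>m\<in>UNIV. G m k a * (g m b * h b j)) + (\<Sum>b\<in>UNIV. \<Sum>m\<in>UNIV. g a m * (G m k b * h b j))"
      by (simp add: g_parallel ring_distribs sum.distrib sum_distrib_left sum_distrib_right mult_ac)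
    also have "(\<Sum>b\<in>UNIV. \<Sum>m\<in>UNIV. G m k a * (g m b * h b j)) = (\<Sum>m\<in>UNIV. (if j = m then 1 else 0) * G m k a)"
      by (subst sum.swap) (auto simp add: sum_distrib_left[symmetric] g_h mult.commute intro!: sum.cong)
    also have "(\<Sum>b\<in>UNIV. \<Sum>m\<in>UNIV. g a m * (G m k b * h b j)) = (\<Sum>m\<in>UNIV. g a m * (\<Sum>b\<in>UNIV. G m k b * h b j))"
      by (subst sum.swap) (simp add: sum_distrib_left)
    finally show ?thesis by (simp add: delta)
  qed
  thus ?thesis
    by (subst derivation_inverse[OF derivation_d])
      (simp add: distrib_left sum.distrib raise_lower mult.commute)
qed

section \<open>Covariant derivatives, traces and curvature\<close>

definition cov1 :: "'n \<Rightarrow> ('n \<Rightarrow> 'r) \<Rightarrow> 'n \<Rightarrow> 'r" where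
  "cov1 k X i = d k (X i) - (\<Sum>m\<in>UNIV. G m k i * X m)"

definition cov2 :: "'n \<Rightarrow> ('n \<Rightarrow> 'n \<Rightarrow> 'r) \<Rightarrow> 'n \<Rightarrow> 'n \<Rightarrow> 'r" where
  "cov2 k P i j = d k (P i j) - (\<Sum>m\<in>UNIV. G m k i * P m j) - (\<Sum>m\<in>UNIV. G m k j * P i m)"

definition tr :: "('n \<Rightarrow> 'n \<Rightarrow> 'r) \<Rightarrow> 'r" where
  "tr P = (\<Sum>i\<in>UNIV. \<Sum>j\<in>UNIV. h i j * P i j)"

definition lap :: "'r \<Rightarrow> 'r" where
  "lap \<phi> = tr (\<lambda>i. cov1 i (\<lambda>j. d j \<phi>))"

definition Rm :: "'n \<Rightarrow> 'n \<Rightarrow> 'n \<Rightarrow> 'n \<Rightarrow> 'r" where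
  "Rm l k i j = d i (G l j k) - d j (G l i k) + (\<Sum>m\<in>UNIV. G l i m * G m j k - G l j m * G m i k)"

definition Ric :: "'n \<Rightarrow> 'n \<Rightarrow> 'r" where
  "Ric a b = (\<Sum>i\<in>UNIV. Rm i b i a)"

lemma tr_add: "tr (\<lambda>i j. P i j + Q i j) = tr P + tr Q"
  by (simp add: tr_def distrib_left sum.distrib)

lemma tr_diff: "tr (\<lambda>i j. P i j - Q i j) = tr P - tr Q"
  by (simp add: tr_def right_diff_distrib sum_subtractf)

lemma tr_cmult: "tr (\<lambda>i j. c * P i j) = c * tr P"
  by (simp add: tr_def sum_distrib_left mult_ac)

lemma tr_sum: "tr (\<lambda>i j. \<Sum>m\<in>(UNIV::'n set). P m i j) = (\<Sum>m\<in>UNIV. tr (P m))"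
proof -
  have "tr (\<lambda>i j. \<Sum>m\<in>UNIV. P m i j) = (\<Sum>i\<in>UNIV. \<Sum>m\<in>UNIV. \<Sum>j\<in>UNIV. h i j * P m i j)"
    unfolding tr_def sum_distrib_left by (intro sum.cong refl sum.swap)
  also have "\<dots> = (\<Sum>m\<in>UNIV. tr (P m))"
    unfolding tr_def by (rule sum.swap)
  finally show ?thesis .
qed

lemma tr_transpose: "tr (\<lambda>i j. P j i) = tr P"
  unfolding tr_def by (subst sum.swap) (simp add: h_sym)

text \<open>As \<open>h\<close> is parallel, trace and covariant derivative commute: differentiating
  \<open>h\<close> produces the connection terms of \<open>cov2\<close> up to a renaming of
  summation indices.\<close>

lemma d_tr: "d k (tr P) = tr (cov2 k P)"
proof -
  have "(\<Sum>i\<in>UNIV. \<Sum>j\<in>UNIV. \<Sum>m\<in>UNIV. G i k m * (h m j * P i j))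
      = (\<Sum>i\<in>UNIV. \<Sum>m\<in>UNIV. \<Sum>j\<in>UNIV. G i k m * (h m j * P i j))"
    by (intro sum.cong refl sum.swap)
  also have "\<dots> = (\<Sum>m\<in>UNIV. \<Sum>i\<in>UNIV. \<Sum>j\<in>UNIV. G i k m * (h m j * P i j))"
    by (rule sum.swap)
  also have "\<dots> = (\<Sum>m\<in>UNIV. \<Sum>j\<in>UNIV. \<Sum>i\<in>UNIV. G i k m * (h m j * P i j))"
    by (intro sum.cong refl sum.swap)
  finally have 1: "(\<Sum>i\<in>UNIV. \<Sum>j\<in>UNIV. \<Sum>m\<in>UNIV. G i k m * (h m j * P i j))
      = (\<Sum>i\<in>UNIV. \<Sum>j\<in>UNIV. \<Sum>m\<in>UNIV. G m k i * (h i j * P m j))" .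
  have 2: "(\<Sum>i\<in>UNIV. \<Sum>j\<in>UNIV. \<Sum>m\<in>UNIV. G j k m * (h i m * P i j))
      = (\<Sum>i\<in>UNIV. \<Sum>j\<in>UNIV. \<Sum>m\<in>UNIV. G m k j * (h i j * P i m))"
    by (intro sum.cong refl sum.swap)
  show ?thesis
    using 1 2
    by (simp add: tr_def cov2_def d_rules h_parallel sum.distrib sum_subtractf sum_distrib_left
        sum_distrib_right algebra_simps)
qed

text \<open>For a one-form whose components are traces, \<open>d_tr\<close> takes care of the two
  traced indices. The index \<open>j\<close> is a mere label for \<open>cov2\<close>, so its
  connection term appears explicitly.\<close>

lemma cov1_tr: "cov1 i (\<lambda>j. tr (T j)) j = tr (\<lambda>k l. cov2 i (T j) k l - (\<Sum>m\<in>UNIV. G m i j * T m k l))"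
  by (simp add: cov1_def d_tr tr_diff tr_sum tr_cmult)

lemma cov2_product: "cov2 k (\<lambda>i j. X i * Y j) i j = cov1 k X i * Y j + X i * cov1 k Y j"
  by (simp add: cov2_def cov1_def d_rules algebra_simps sum_distrib_left)

lemma Rm_antisym: "Rm l k i j = - Rm l k j i"
  by (simp add: Rm_def sum_subtractf)

text \<open>The curvature annihilates the parallel tensor \<open>h\<close>. Expanding
  \<open>d i (d j (h a b))\<close> by \<open>h_parallel\<close> and antisymmetrising in
  \<open>i, j\<close> leaves exactly the two curvature terms, and the commutator of derivations is
  zero.\<close>

lemma Rm_antisym_raised:
  "(\<Sum>m\<in>UNIV. h b m * Rm a m i j) = - (\<Sum>m\<in>UNIV. h a m * Rm b m i j)"
proof -
  define W where "W a b i j = (\<Sum>m\<in>UNIV. \<Sum>n\<in>UNIV. G a j m * (G b i n * h m n))" for a b i j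
  define U where "U a b i j = (\<Sum>m\<in>UNIV. d i (G a j m) * h m b)" for a b i j
  define T where "T a b i j = (\<Sum>m\<in>UNIV. \<Sum>n\<in>UNIV. G a i m * (G m j n * h n b))" for a b i j
  \<comment> \<open>By this relation the part of the second derivative with one coefficient on each
    index, \<open>W a b i j + W b a i j\<close>, is symmetric in \<open>i, j\<close> and drops out
    of the commutator.\<close>
  have W_swap: "W b a i j = W a b j i" for a b i j
    unfolding W_def by (subst sum.swap) (simp add: h_sym mult_ac)
  have hess: "d i (d j (h a b)) = - U a b i j + T a b j i + W a b i j - U b a i j + T b a j i + W b a i j" for a b i j
  proof -
    have "d i (d j (h a b)) = d i (- (\<Sum>m\<in>UNIV. G a j m * h m b) - (\<Sum>m\<in>UNIV. G b j m * h m a))"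
      by (simp add: h_parallel h_sym)
    also have "\<dots> = - U a b i j + T a b j i + W a b i j - U b a i j + T b a j i + W b a i j"
      unfolding U_def T_def W_def
      by (simp add: d_rules h_parallel sum.distrib sum_subtractf sum_negf sum_distrib_left algebra_simps)
    finally show ?thesis .
  qed
  have curv: "(\<Sum>m\<in>UNIV. h b m * Rm a m i j) = U a b i j - U a b j i + T a b i j - T a b j i" for a b
  proof -
    have "(\<Sum>m\<in>UNIV. h b m * (\<Sum>n\<in>UNIV. G a i n * G n j m)) = T a b i j" for i j
      unfolding T_def sum_distrib_left by (subst sum.swap) (simp add: h_sym[of b] mult_ac)
    note this[of i j] this[of j i]
    thus ?thesis
      by (simp add: Rm_def U_def sum_subtractf sum.distrib ring_distribs h_sym[of b] mult.commute)
  qed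
  have "d i (d j (h a b)) - d j (d i (h a b)) = 0"
    by (simp add: d_commute[of i])
  thus ?thesis
    unfolding curv hess W_swap[of b a] by (simp add: algebra_simps)
qed

section \<open>The Bianchi identities\<close>

definition covRm :: "'n \<Rightarrow> 'n \<Rightarrow> 'n \<Rightarrow> 'n \<Rightarrow> 'n \<Rightarrow> 'r" where
  "covRm p l k i j = d p (Rm l k i j) + (\<Sum>m\<in>UNIV. G l p m * Rm m k i j) - (\<Sum>m\<in>UNIV. G m p k * Rm l m i j)
     - (\<Sum>m\<in>UNIV. G m p i * Rm l k m j) - (\<Sum>m\<in>UNIV. G m p j * Rm l k i m)"

text \<open>The Jacobi identity for the operators \<open>\<partial>\<^sub>i + \<Gamma>\<^sub>i\<close>, where the indices \<open>i, j, p\<close> are mere labels.\<close>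

lemma bianchi_labels:
  defines "B \<equiv> \<lambda>p l k i j. d p (Rm l k i j) + (\<Sum>m\<in>UNIV. G l p m * Rm m k i j) - (\<Sum>m\<in>UNIV. G m p k * Rm l m i j)"
  shows "B p l k i j + B i l k j p + B j l k p i = 0"
proof -
  define T where "T p i j = (\<Sum>m\<in>UNIV. \<Sum>n\<in>UNIV. G l p m * (G m i n * G n j k))" for p i j
  define U where "U p i j = (\<Sum>m\<in>UNIV. G l p m * d i (G m j k))" for p i j
  define V where "V p i j = (\<Sum>m\<in>UNIV. d i (G l j m) * G m p k)" for p i j
  have 1: "(\<Sum>m\<in>UNIV. G l p m * Rm m k i j) = U p i j - U p j i + T p i j - T p j i" for p i j
    by (simp add: Rm_def U_def T_def sum_subtractf sum.distrib ring_distribs sum_distrib_left)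
  have 2: "(\<Sum>m\<in>UNIV. G m p k * Rm l m i j) = V p i j - V p j i + T i j p - T j i p" for p i j
  proof -
    have "(\<Sum>m\<in>UNIV. G m p k * (\<Sum>n\<in>UNIV. G l i n * G n j m)) = T i j p" for i j
      unfolding T_def sum_distrib_left by (subst sum.swap) (simp add: mult_ac)
    note this[of i j] this[of j i]
    thus ?thesis
      by (simp add: Rm_def V_def sum_subtractf sum.distrib ring_distribs mult.commute)
  qed
  have 3: "d p (Rm l k i j) = d p (d i (G l j k)) - d p (d j (G l i k)) + V j p i + U i p j - V i p j - U j p i" for p i j
    by (simp add: Rm_def U_def V_def d_rules sum_subtractf sum.distrib)
  show ?thesis
    unfolding B_def 1 2 3
    by (simp add: d_commute[of i p] d_commute[of j p] d_commute[of j i])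
qed

text \<open>Compared with \<open>bianchi_labels\<close>, only the connection terms of the indices
  \<open>i, j, p\<close> are new. They cancel in pairs in the cyclic sum, by the symmetry of
  \<open>G\<close> and the antisymmetry of \<open>Rm\<close>.\<close>

lemma second_bianchi: "covRm p l k i j + covRm i l k j p + covRm j l k p i = 0"
proof -
  have 1: "(\<Sum>m\<in>UNIV. G m a b * Rm l k c m) = - (\<Sum>m\<in>UNIV. G m b a * Rm l k m c)" for a b c
    unfolding sum_negf[symmetric]
    by (rule sum.cong[OF refl]) (simp add: G_sym[of _ a b] Rm_antisym[of l k c])
  show ?thesis
    using bianchi_labels[of p l k i j] unfolding covRm_def 1
    by (simp add: algebra_simps)
qed

lemma covRm_antisym: "covRm p l k i j = - covRm p l k j i"
proof -
  have "covRm p l k i j = d p (- Rm l k j i) + (\<Sum>m\<in>UNIV. G l p m * - Rm m k j i) - (\<Sum>m\<in>UNIV. G m p k * - Rm l m j i)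
     - (\<Sum>m\<in>UNIV. G m p i * - Rm l k j m) - (\<Sum>m\<in>UNIV. G m p j * - Rm l k m i)"
    unfolding covRm_def by (simp only: Rm_antisym[symmetric])
  thus ?thesis by (simp add: covRm_def d_rules sum_negf)
qed

text \<open>The connection terms of the upper index and of the lower index contracted with it
  cancel, so contraction commutes with covariant differentiation.\<close>

lemma covRm_contract: "(\<Sum>l\<in>UNIV. covRm p l k l j) = cov2 p Ric j k"
proof -
  have "(\<Sum>l\<in>UNIV. \<Sum>m\<in>UNIV. G l p m * Rm m k l j) = (\<Sum>l\<in>UNIV. \<Sum>m\<in>UNIV. G m p l * Rm l k m j)"
    by (rule sum.swap)
  moreover have "(\<Sum>l\<in>UNIV. \<Sum>m\<in>UNIV. G m p k * Rm l m l j) = (\<Sum>m\<in>UNIV. G m p k * Ric j m)"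
    unfolding Ric_def sum_distrib_left by (rule sum.swap)
  moreover have "(\<Sum>l\<in>UNIV. \<Sum>m\<in>UNIV. G m p j * Rm l k l m) = (\<Sum>m\<in>UNIV. G m p j * Ric m k)"
    unfolding Ric_def sum_distrib_left by (rule sum.swap)
  ultimately show ?thesis
    by (simp add: covRm_def cov2_def sum.distrib sum_subtractf) (simp add: Ric_def d_rules)
qed

text \<open>\<open>Rm_antisym_raised\<close> exchanges \<open>l\<close> and \<open>j\<close>, so
  that the upper index is contracted with a form index, which is the Ricci contraction.\<close>

lemma tr_Rm: "tr (\<lambda>j k. Rm l k j p) = - (\<Sum>k\<in>UNIV. h l k * Ric p k)"
proof -
  have "tr (\<lambda>j k. Rm l k j p) = - (\<Sum>j\<in>UNIV. \<Sum>k\<in>UNIV. h l k * Rm j k j p)"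
    unfolding tr_def Rm_antisym_raised[of _ l] by (simp add: sum_negf)
  also have "(\<Sum>j\<in>UNIV. \<Sum>k\<in>UNIV. h l k * Rm j k j p) = (\<Sum>k\<in>UNIV. h l k * Ric p k)"
    unfolding Ric_def sum_distrib_left by (rule sum.swap)
  finally show ?thesis .
qed

text \<open>This is \<open>tr_Rm\<close> differentiated. Only \<open>j, k\<close> are tensor indices
  for \<open>cov2\<close>; the connection terms of the labels \<open>l\<close> and \<open>p\<close>
  are carried along.\<close>

lemma tr_covRm: "tr (\<lambda>j k. covRm q l k j p) = - (\<Sum>k\<in>UNIV. h l k * cov2 q Ric p k)"
proof -
  define Z where "Z l p = tr (\<lambda>j k. Rm l k j p)" for l p
  have "(\<lambda>j k. covRm q l k j p)
      = (\<lambda>j k. cov2 q (\<lambda>j k. Rm l k j p) j k + (\<Sum>m\<in>UNIV. G l q m * Rm m k j p) - (\<Sum>m\<in>UNIV. G m q p * Rm l k j m))"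
    by (simp add: covRm_def cov2_def fun_eq_iff)
  hence "tr (\<lambda>j k. covRm q l k j p) = d q (Z l p) + (\<Sum>m\<in>UNIV. G l q m * Z m p) - (\<Sum>m\<in>UNIV. G m q p * Z l m)"
    by (simp add: tr_diff tr_add tr_sum tr_cmult d_tr[symmetric] Z_def)
  also have "\<dots> = - (\<Sum>k\<in>UNIV. h l k * cov2 q Ric p k)"
  proof -
    have "(\<Sum>k\<in>UNIV. \<Sum>m\<in>UNIV. G k q m * (h l m * Ric p k)) = (\<Sum>k\<in>UNIV. \<Sum>m\<in>UNIV. G m q k * (h l k * Ric p m))"
      by (rule sum.swap)
    moreover have "(\<Sum>k\<in>UNIV. \<Sum>m\<in>UNIV. G l q m * (h m k * Ric p k)) = (\<Sum>m\<in>UNIV. \<Sum>k\<in>UNIV. G l q m * (h m k * Ric p k))"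
      by (rule sum.swap)
    moreover have "(\<Sum>k\<in>UNIV. \<Sum>m\<in>UNIV. G m q p * (h l k * Ric m k)) = (\<Sum>m\<in>UNIV. \<Sum>k\<in>UNIV. G m q p * (h l k * Ric m k))"
      by (rule sum.swap)
    ultimately show ?thesis
      by (simp add: Z_def tr_Rm d_rules h_parallel cov2_def sum.distrib sum_subtractf sum_negf sum_distrib_left
          sum_distrib_right algebra_simps)
  qed
  finally show ?thesis .
qed

text \<open>By \<open>d_tr\<close> the left-hand side is the derivative of the scalar curvature. In
  \<open>second_bianchi\<close> the upper index is contracted with \<open>i\<close> and the result
  is traced over \<open>j, k\<close>; each of the other two terms becomes minus the divergence of
  \<open>Ric\<close>.\<close>

lemma contracted_bianchi: "tr (cov2 p Ric) = 2 * tr (\<lambda>i j. cov2 i Ric p j)"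
proof -
  have "cov2 p Ric j k + (\<Sum>l\<in>UNIV. covRm l l k j p) - cov2 j Ric p k = 0" for j k
  proof -
    have "(\<Sum>l\<in>UNIV. covRm p l k l j + covRm l l k j p + covRm j l k p l) = 0"
      by (simp add: second_bianchi)
    moreover have "covRm j l k p l = - covRm j l k l p" for l
      by (rule covRm_antisym)
    ultimately show ?thesis
      by (simp add: sum.distrib sum_subtractf covRm_contract)
  qed
  hence "tr (\<lambda>j k. cov2 p Ric j k + (\<Sum>l\<in>UNIV. covRm l l k j p) - cov2 j Ric p k) = 0"
    by (simp add: tr_def)
  hence "tr (cov2 p Ric) + (\<Sum>l\<in>UNIV. tr (\<lambda>j k. covRm l l k j p)) - tr (\<lambda>j k. cov2 j Ric p k) = 0"
    by (simp add: tr_diff tr_add tr_sum)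
  thus ?thesis
    by (simp add: tr_covRm sum_negf) (simp add: tr_def algebra_simps)
qed


section \<open>The Ricci identity and Bochner's formula\<close>

lemma cov1_cmult: "d k c = 0 \<Longrightarrow> cov1 k (\<lambda>i. c * X i) = (\<lambda>j. c * cov1 k X j)"
  by (simp add: fun_eq_iff cov1_def d_rules sum_distrib_left algebra_simps)

lemma cov1_add: "cov1 k (\<lambda>i. X i + Y i) = (\<lambda>j. cov1 k X j + cov1 k Y j)"
  by (simp add: fun_eq_iff cov1_def d_rules sum.distrib algebra_simps)

lemma cov2_add: "cov2 k (\<lambda>i j. P i j + Q i j) i j = cov2 k P i j + cov2 k Q i j"
  by (simp add: cov2_def d_rules sum.distrib algebra_simps)

lemma cov2_cmult: "d k c = 0 \<Longrightarrow> cov2 k (\<lambda>i j. c * P i j) i j = c * cov2 k P i j"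
  by (simp add: cov2_def d_rules sum_distrib_left algebra_simps)

lemma cov2_sym: "(\<And>i j. P i j = P j i) \<Longrightarrow> cov2 k P i j = cov2 k P j i"
  by (simp add: cov2_def)

lemma d_numeral: "d k (numeral n) = 0"
proof -
  have "d k (of_nat n) = 0" for n
    by (induction n) (simp_all add: d_rules)
  thus ?thesis by (metis of_nat_numeral)
qed

lemma tr_swap: "tr (\<lambda>i j. tr (\<lambda>k l. F i j k l)) = tr (\<lambda>k l. tr (\<lambda>i j. F i j k l))"
  by (subst (2) tr_def) (simp only: tr_sum tr_cmult tr_def[of "\<lambda>k l. tr (\<lambda>i j. F i j k l)"])

lemma ricci_identity:
  "cov2 i (\<lambda>k j. cov1 k X j) k j - cov2 k (\<lambda>i j. cov1 i X j) i j = - (\<Sum>m\<in>UNIV. Rm m j i k * X m)"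
proof -
  have 1: "(\<Sum>m\<in>UNIV. \<Sum>n\<in>UNIV. G m i j * (G n k m * X n)) = (\<Sum>m\<in>UNIV. \<Sum>n\<in>UNIV. G m k n * (G n i j * X m))" for i k
    by (subst sum.swap) (simp add: mult_ac)
  show ?thesis
    using 1[of i k] 1[of k i]
    by (simp add: cov2_def cov1_def Rm_def d_rules d_commute[of k i] G_sym[of _ k i] sum.distrib sum_subtractf sum_distrib_left
        sum_distrib_right algebra_simps)
qed

definition hess :: "'r \<Rightarrow> 'n \<Rightarrow> 'n \<Rightarrow> 'r" where
  "hess f i j = cov1 i (\<lambda>j. d j f) j"

definition grad :: "'r \<Rightarrow> 'n \<Rightarrow> 'r" where
  "grad f i = (\<Sum>j\<in>UNIV. h i j * d j f)"

definition gsq :: "'r \<Rightarrow> 'r" where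
  "gsq f = tr (\<lambda>i j. d i f * d j f)"

lemma hess_sym: "hess f i j = hess f j i"
  by (simp add: hess_def cov1_def d_commute[of i] G_sym[of _ i])

lemma lap_hess: "lap f = tr (hess f)"
  by (simp add: lap_def hess_def[abs_def])

lemma lap_add: "lap (x + y) = lap x + lap y"
  by (simp add: lap_def d_rules cov1_add tr_add)

lemma tr_grad: "tr (\<lambda>i j. X i * d j f) = (\<Sum>i\<in>UNIV. grad f i * X i)"
  by (simp add: tr_def grad_def sum_distrib_left sum_distrib_right mult_ac)

text \<open>The symmetry of the Hessian places \<open>k\<close> next to the outer derivative, and
  the Ricci identity moves it outside. What remains inside traces to \<open>lap f\<close>, while the
  commutator contracts to Ricci curvature by \<open>tr_Rm\<close>.\<close>

lemma div_hess: "tr (\<lambda>i j. cov2 i (hess f) j k) = d k (lap f) + (\<Sum>b\<in>UNIV. Ric k b * grad f b)"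
proof -
  have "cov2 i (hess f) j k = cov2 k (hess f) i j - (\<Sum>m\<in>UNIV. d m f * Rm m j i k)" for i j
  proof -
    have "cov2 i (hess f) j k = cov2 i (hess f) k j"
      by (rule cov2_sym) (rule hess_sym)
    thus ?thesis
      using ricci_identity[of i "\<lambda>j. d j f" k j]
      by (simp add: hess_def[abs_def] algebra_simps)
  qed
  hence "tr (\<lambda>i j. cov2 i (hess f) j k) = d k (lap f) - (\<Sum>m\<in>UNIV. d m f * tr (\<lambda>i j. Rm m j i k))"
    by (simp add: tr_diff tr_sum tr_cmult d_tr lap_hess)
  also have "(\<Sum>m\<in>UNIV. d m f * tr (\<lambda>i j. Rm m j i k)) = - (\<Sum>m\<in>UNIV. \<Sum>b\<in>UNIV. d m f * (h m b * Ric k b))"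
    by (simp add: tr_Rm sum_negf sum_distrib_left)
  also have "(\<Sum>m\<in>UNIV. \<Sum>b\<in>UNIV. d m f * (h m b * Ric k b)) = (\<Sum>b\<in>UNIV. Ric k b * grad f b)"
    unfolding grad_def sum_distrib_left by (subst sum.swap) (simp add: h_sym mult_ac)
  finally show ?thesis by simp
qed

lemma d_gsq: "d j (gsq f) = 2 * tr (\<lambda>k l. hess f j k * d l f)"
proof -
  have 1: "cov2 j (\<lambda>k l. d k f * d l f) = (\<lambda>k l. hess f j k * d l f + hess f j l * d k f)"
    by (simp only: fun_eq_iff cov2_product hess_def[symmetric] mult.commute[of "d _ f" "hess _ _ _"] simp_thms)
  have "d j (gsq f) = tr (\<lambda>k l. hess f j k * d l f) + tr (\<lambda>k l. hess f j l * d k f)"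
    unfolding gsq_def d_tr
    by (simp only: 1 tr_add)
  also have "tr (\<lambda>k l. hess f j l * d k f) = tr (\<lambda>k l. hess f j k * d l f)"
    by (rule tr_transpose)
  finally show ?thesis by simp
qed

text \<open>The Leibniz rule is used twice on the trace defining \<open>gsq f\<close>; third
  derivatives of \<open>f\<close> then enter only through the divergence of the Hessian. The nested
  trace is the squared norm of the Hessian.\<close>

lemma bochner:
  "lap (gsq f) = 2 * (\<Sum>k\<in>UNIV. grad f k * d k (lap f)) + 2 * (\<Sum>k\<in>UNIV. \<Sum>b\<in>UNIV. Ric k b * grad f k * grad f b)
     + 2 * tr (\<lambda>i j. tr (\<lambda>k l. hess f i l * hess f j k))"
proof -
  define Q where "Q i j k = cov2 i (hess f) j k" for i j k
  have "cov1 i (\<lambda>j. tr (\<lambda>k l. hess f j k * d l f)) j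
      = tr (\<lambda>k l. Q i j k * d l f + hess f i l * hess f j k)" for i j
  proof -
    have "cov2 i (\<lambda>k l. hess f j k * d l f) k l - (\<Sum>m\<in>UNIV. G m i j * (hess f m k * d l f))
        = Q i j k * d l f + hess f i l * hess f j k" for k l
      using cov2_product[of i "hess f j" "\<lambda>l. d l f" k l]
      by (simp add: Q_def cov2_def[of i "hess f" j k] cov1_def[of i "hess f j"] hess_def[symmetric]
          sum_distrib_left sum_distrib_right ring_distribs mult_ac)
    thus ?thesis by (simp add: cov1_tr)
  qed
  hence "lap (gsq f) = 2 * tr (\<lambda>i j. tr (\<lambda>k l. Q i j k * d l f + hess f i l * hess f j k))"
    by (simp add: lap_def d_gsq cov1_cmult d_numeral tr_cmult)
  also have "\<dots> = 2 * tr (\<lambda>i j. tr (\<lambda>k l. Q i j k * d l f)) + 2 * tr (\<lambda>i j. tr (\<lambda>k l. hess f i l * hess f j k))"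
    by (simp add: tr_add ring_distribs)
  also have "tr (\<lambda>i j. tr (\<lambda>k l. Q i j k * d l f)) = tr (\<lambda>k l. tr (\<lambda>i j. Q i j k) * d l f)"
    by (subst tr_swap) (simp add: mult.commute[of _ "d _ f"] tr_cmult)
  also have "\<dots> = (\<Sum>k\<in>UNIV. grad f k * (d k (lap f) + (\<Sum>b\<in>UNIV. Ric k b * grad f b)))"
    by (simp only: tr_grad Q_def div_hess)
  finally show ?thesis
    by (simp add: ring_distribs sum.distrib sum_distrib_left mult_ac)
qed

end

text \<open>\<open>e\<close> is the time derivative and \<open>f\<close> stands for the logarithm of
  a positive solution of the heat equation. The tensor \<open>B\<close>, later half of
  \<open>H^2\<close>, stays arbitrary.\<close>

locale heat_flow = levi_civita d g h G
  for d :: "'n::finite \<Rightarrow> 'r::comm_ring_1 \<Rightarrow> 'r" and g h G +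
  fixes e :: "'r \<Rightarrow> 'r" and f :: 'r and B :: "'n \<Rightarrow> 'n \<Rightarrow> 'r"
  assumes derivation_e: "derivation e"
    and e_commute: "e (d i x) = d i (e x)"
    and heat: "e f = lap f + gsq f"
    and flow: "e (g i j) = B i j - 2 * Ric i j"
begin

sublocale e: derivation e by (rule derivation_e)

abbreviation s where "s i j \<equiv> e (g i j)"

text \<open>The trace of the time derivative of the connection, through which the commutator of
  \<open>e\<close> and \<open>lap\<close> acts on first derivatives.\<close>

definition E :: "'n \<Rightarrow> 'r" where "E m = tr (\<lambda>i j. e (G m i j))"

lemma e_h: "e (h i j) = - (\<Sum>a\<in>UNIV. \<Sum>b\<in>UNIV. s a b * h a i * h b j)"
  by (simp add: derivation_inverse[OF derivation_e] sum_distrib_left h_sym[of _ i] mult_ac)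

lemma e_h_contract:
  "(\<Sum>i\<in>UNIV. \<Sum>j\<in>UNIV. e (h i j) * P i j)
     = - (\<Sum>a\<in>UNIV. \<Sum>b\<in>UNIV. s a b * (\<Sum>i\<in>UNIV. \<Sum>j\<in>UNIV. h a i * h b j * P i j))"
proof -
  let ?F = "\<lambda>i j a b. s a b * h a i * h b j * P i j"
  have "(\<Sum>i\<in>UNIV. \<Sum>j\<in>UNIV. \<Sum>a\<in>UNIV. \<Sum>b\<in>UNIV. ?F i j a b)
      = (\<Sum>i\<in>UNIV. \<Sum>a\<in>UNIV. \<Sum>j\<in>UNIV. \<Sum>b\<in>UNIV. ?F i j a b)"
    by (intro sum.cong refl sum.swap)
  also have "\<dots> = (\<Sum>a\<in>UNIV. \<Sum>i\<in>UNIV. \<Sum>j\<in>UNIV. \<Sum>b\<in>UNIV. ?F i j a b)"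
    by (rule sum.swap)
  also have "\<dots> = (\<Sum>a\<in>UNIV. \<Sum>i\<in>UNIV. \<Sum>b\<in>UNIV. \<Sum>j\<in>UNIV. ?F i j a b)"
    by (intro sum.cong refl sum.swap)
  also have "\<dots> = (\<Sum>a\<in>UNIV. \<Sum>b\<in>UNIV. \<Sum>i\<in>UNIV. \<Sum>j\<in>UNIV. ?F i j a b)"
    by (intro sum.cong refl sum.swap)
  finally show ?thesis
    by (simp add: e_h sum_distrib_left sum_distrib_right sum_negf mult_ac)
qed

lemma e_tr: "e (tr P) = tr (\<lambda>i j. e (P i j)) + (\<Sum>i\<in>UNIV. \<Sum>j\<in>UNIV. e (h i j) * P i j)"
  by (simp add: tr_def e.rules sum.distrib add.commute)

lemma e_gsq:
  "e (gsq f) = 2 * (\<Sum>i\<in>UNIV. grad f i * d i (lap f + gsq f)) - (\<Sum>a\<in>UNIV. \<Sum>b\<in>UNIV. s a b * grad f a * grad f b)"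
proof -
  have "tr (\<lambda>i j. e (d i f * d j f)) = tr (\<lambda>i j. d i (e f) * d j f) + tr (\<lambda>i j. d j (e f) * d i f)"
    by (simp add: e.rules e_commute tr_add[symmetric] mult.commute)
  also have "tr (\<lambda>i j. d j (e f) * d i f) = tr (\<lambda>i j. d i (e f) * d j f)"
    by (rule tr_transpose)
  finally have 1: "tr (\<lambda>i j. e (d i f * d j f)) = 2 * (\<Sum>i\<in>UNIV. grad f i * d i (e f))"
    by (simp add: tr_grad)
  have "(\<Sum>i\<in>UNIV. \<Sum>j\<in>UNIV. h a i * h b j * (d i f * d j f)) = grad f a * grad f b" for a b
    by (simp add: grad_def sum_product mult_ac)
  thus ?thesis
    using e_h_contract[of "\<lambda>i j. d i f * d j f"]
    unfolding gsq_def[of f] e_tr 1 unfolding gsq_def[symmetric] heat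
    by (simp add: mult_ac)
qed

text \<open>As \<open>e\<close> commutes with coordinate derivatives, its commutator with
  \<open>lap\<close> comes from the variation of \<open>G\<close>, which gives \<open>E\<close>, and
  from that of \<open>h\<close>, which pairs \<open>s\<close> with the Hessian.\<close>

lemma e_lap:
  "e (lap f) = lap (lap f) + lap (gsq f) - (\<Sum>m\<in>UNIV. E m * d m f)
     - (\<Sum>a\<in>UNIV. \<Sum>b\<in>UNIV. s a b * (\<Sum>i\<in>UNIV. \<Sum>j\<in>UNIV. h a i * h b j * hess f i j))"
proof -
  have "e (hess f i j) = hess (e f) i j - (\<Sum>m\<in>UNIV. d m f * e (G m i j))" for i j
    by (simp add: hess_def cov1_def e.rules e_commute sum.distrib algebra_simps)
  hence "tr (\<lambda>i j. e (hess f i j)) = lap (e f) - (\<Sum>m\<in>UNIV. E m * d m f)"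
    by (simp add: tr_diff tr_sum tr_cmult E_def lap_hess mult.commute)
  thus ?thesis
    unfolding lap_hess[of f] e_tr e_h_contract unfolding lap_hess[symmetric] heat lap_add by simp
qed

text \<open>\<open>C\<close> is the time derivative of \<open>G\<close> with the index lowered.
  Differentiating \<open>g_parallel\<close> in time expresses the covariant derivative of
  \<open>s\<close> by \<open>C\<close>, and the symmetry of \<open>C\<close> allows solving for its
  trace, much as the Christoffel symbols are found from the metric.\<close>

lemma lower_E: "2 * (\<Sum>m\<in>UNIV. g l m * E m) = 2 * tr (\<lambda>i j. cov2 i s l j) - tr (cov2 l s)"
proof -
  define C where "C k i j = (\<Sum>m\<in>UNIV. e (G m k i) * g m j)" for k i j
  have C_sym: "C k i j = C i k j" for i j k
    by (simp add: C_def G_sym[of _ k])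
  have 1: "cov2 k s i j = C k i j + C k j i" for k i j
  proof -
    have "e (d k (g i j)) = C k i j + (\<Sum>m\<in>UNIV. G m k i * s m j) + (C k j i + (\<Sum>m\<in>UNIV. G m k j * s i m))"
    proof -
      have "(\<Sum>m\<in>UNIV. e (G m k j) * g i m) = C k j i"
        unfolding C_def by (intro sum.cong refl arg_cong2[where f = "(*)"] g_sym)
      thus ?thesis by (simp add: g_parallel e.rules sum.distrib) (simp add: C_def)
    qed
    thus ?thesis by (simp add: cov2_def e_commute)
  qed
  have "tr (\<lambda>i j. cov2 i s l j) = tr (\<lambda>i j. C l i j) + tr (\<lambda>i j. C i j l)"
    by (simp add: 1 tr_add C_sym[of _ l])
  moreover have "tr (cov2 l s) = 2 * tr (\<lambda>i j. C l i j)"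
    using tr_transpose[of "C l"] by (simp add: 1[abs_def] tr_add)
  moreover have "tr (\<lambda>i j. C i j l) = (\<Sum>m\<in>UNIV. g l m * E m)"
    by (simp add: C_def tr_sum E_def tr_cmult mult.commute[of "e _"] g_sym[of l])
  ultimately show ?thesis by (simp add: algebra_simps)
qed

text \<open>By the contracted Bianchi identity the Ricci part of the flow does not contribute.\<close>

lemma E_df:
  "2 * (\<Sum>m\<in>UNIV. E m * d m f) = (\<Sum>l\<in>UNIV. grad f l * (2 * tr (\<lambda>i j. cov2 i B l j) - tr (cov2 l B)))"
proof -
  have s: "s = (\<lambda>i j. B i j + (- 2) * Ric i j)"
    by (simp add: fun_eq_iff flow)
  have 2: "d k (- 2) = 0" for k
    by (simp add: d_rules d_numeral)
  have 1: "2 * tr (\<lambda>i j. cov2 i s l j) - tr (cov2 l s) = 2 * tr (\<lambda>i j. cov2 i B l j) - tr (cov2 l B)" for l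
  proof -
    have "cov2 i s = (\<lambda>j k. cov2 i B j k + (- 2) * cov2 i Ric j k)" for i
      unfolding s cov2_add cov2_cmult[OF 2] fun_eq_iff by simp
    thus ?thesis
      using contracted_bianchi[of l]
      by (simp only: tr_add tr_cmult) (simp add: algebra_simps)
  qed
  have "(\<Sum>l\<in>UNIV. grad f l * (\<Sum>m\<in>UNIV. g l m * E m)) = (\<Sum>m\<in>UNIV. E m * d m f)"
  proof -
    have "(\<Sum>l\<in>UNIV. grad f l * (\<Sum>m\<in>UNIV. g l m * E m))
        = (\<Sum>j\<in>UNIV. \<Sum>l\<in>UNIV. d j f * (h j l * (\<Sum>m\<in>UNIV. g l m * E m)))"
      unfolding grad_def sum_distrib_right by (subst sum.swap) (simp add: h_sym mult_ac)
    thus ?thesis by (simp add: sum_distrib_left[symmetric] raise_lower mult.commute)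
  qed
  hence "2 * (\<Sum>m\<in>UNIV. E m * d m f) = 2 * (\<Sum>l\<in>UNIV. grad f l * (\<Sum>m\<in>UNIV. g l m * E m))"
    by simp
  also have "\<dots> = (\<Sum>l\<in>UNIV. grad f l * (2 * (\<Sum>m\<in>UNIV. g l m * E m)))"
    by (subst sum_distrib_left) (rule sum.cong[OF refl mult.left_commute])
  finally have "2 * (\<Sum>m\<in>UNIV. E m * d m f) = (\<Sum>l\<in>UNIV. grad f l * (2 * (\<Sum>m\<in>UNIV. g l m * E m)))" .
  thus ?thesis by (simp only: lower_E 1)
qed

text \<open>The terms with the gradient of \<open>lap f\<close> in \<open>bochner\<close> and in
  \<open>e_gsq\<close> cancel.\<close>

lemma evolution_gsq:
  "lap (gsq f) - e (gsq f) = 2 * (\<Sum>k\<in>UNIV. \<Sum>b\<in>UNIV. Ric k b * grad f k * grad f b)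
     + 2 * tr (\<lambda>i j. tr (\<lambda>k l. hess f i l * hess f j k))
     + (\<Sum>a\<in>UNIV. \<Sum>b\<in>UNIV. s a b * grad f a * grad f b) - 2 * (\<Sum>i\<in>UNIV. grad f i * d i (gsq f))"
  unfolding bochner e_gsq by (simp add: d_rules sum.distrib algebra_simps)

text \<open>\<open>lap (lap f)\<close> cancels and \<open>lap (gsq f)\<close> survives with a minus
  sign. In the combination with weights \<open>1 - \<alpha>\<close> and \<open>- \<alpha>\<close>
  the Hessian norms of both identities add up to a term free of \<alpha>.\<close>

lemma evolution_lap:
  "lap (lap f) - e (lap f) = (\<Sum>a\<in>UNIV. \<Sum>b\<in>UNIV. s a b * (\<Sum>i\<in>UNIV. \<Sum>j\<in>UNIV. h a i * h b j * hess f i j))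
     + (\<Sum>m\<in>UNIV. E m * d m f)
     - (2 * (\<Sum>k\<in>UNIV. grad f k * d k (lap f)) + 2 * (\<Sum>k\<in>UNIV. \<Sum>b\<in>UNIV. Ric k b * grad f k * grad f b)
        + 2 * tr (\<lambda>i j. tr (\<lambda>k l. hess f i l * hess f j k)))"
  unfolding e_lap bochner by simp

end


section \<open>Smooth functions as a differential ring\<close>

text \<open>
  Functions are cut off to \<open>0\<close> outside the unit ball, so that two of them are equal if they agree on the ball, and
  the derivatives are total derivations of a commutative ring.
\<close>

typedef (overloaded) 'a smooth_fun =
  "{F :: 'a::euclidean_space \<Rightarrow> real. smooth_on (ball 0 1) F \<and> (\<forall>z. z \<notin> ball 0 1 \<longrightarrow> F z = 0)}"
  morphisms apply_fun Abs_smooth_fun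
  by (rule exI[of _ "\<lambda>z. 0"]) (simp add: smooth_on_const fat_open)

setup_lifting type_definition_smooth_fun

instantiation smooth_fun :: (euclidean_space) comm_ring_1
begin

lift_definition zero_smooth_fun :: "'a smooth_fun" is "\<lambda>z. 0"
  by (simp add: smooth_on_const fat_open)

lift_definition one_smooth_fun :: "'a smooth_fun" is "\<lambda>z. if z \<in> ball 0 1 then 1 else 0"
  by (subst smooth_on_cong[where g = "\<lambda>z. 1"]) (simp_all add: smooth_on_const fat_open)

lift_definition plus_smooth_fun :: "'a smooth_fun \<Rightarrow> 'a smooth_fun \<Rightarrow> 'a smooth_fun" is "\<lambda>F G z. F z + G z"
  by (simp add: smooth_on_add fat_open)

lift_definition times_smooth_fun :: "'a smooth_fun \<Rightarrow> 'a smooth_fun \<Rightarrow> 'a smooth_fun" is "\<lambda>F G z. F z * G z"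
  by (simp add: smooth_on_mult fat_open)

lift_definition minus_smooth_fun :: "'a smooth_fun \<Rightarrow> 'a smooth_fun \<Rightarrow> 'a smooth_fun" is "\<lambda>F G z. F z - G z"
  by (simp add: smooth_on_diff fat_open)

lift_definition uminus_smooth_fun :: "'a smooth_fun \<Rightarrow> 'a smooth_fun" is "\<lambda>F z. - F z"
  by (simp add: smooth_on_minus fat_open)

instance
proof
  show "(0 :: 'a smooth_fun) \<noteq> 1"
    by transfer (metis centre_in_ball zero_less_one zero_neq_one)
qed (transfer; force simp: algebra_simps)+

end

lift_definition sd :: "'a::euclidean_space \<Rightarrow> 'a smooth_fun \<Rightarrow> 'a smooth_fun"
  is "\<lambda>v F z. if z \<in> ball 0 1 then dir (ball 0 1) v F z else 0"
proof -
  fix v :: 'a and F :: "'a \<Rightarrow> real"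
  assume "smooth_on (ball 0 1) F \<and> (\<forall>z. z \<notin> ball 0 1 \<longrightarrow> F z = 0)"
  hence "smooth_on (ball 0 1) (dir (ball 0 1) v F)"
    by (simp add: smooth_on_dir)
  thus "smooth_on (ball 0 1) (\<lambda>z. if z \<in> ball 0 1 then dir (ball 0 1) v F z else 0)
     \<and> (\<forall>z. z \<notin> ball 0 1 \<longrightarrow> (if z \<in> ball 0 1 then dir (ball 0 1) v F z else 0) = 0)"
    by (subst smooth_on_cong[where g = "dir (ball 0 1) v F"]) auto
qed

lemma derivation_sd: "derivation (sd v)"
proof
  fix x y :: "'a smooth_fun"
  show "sd v (x + y) = sd v x + sd v y"
    by transfer (auto simp: fun_eq_iff dir_rules fat_open smooth_on_differentiable)
  show "sd v (x * y) = sd v x * y + x * sd v y"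
    by transfer (auto simp: fun_eq_iff dir_rules fat_open smooth_on_differentiable)
qed

lemma sd_commute: "sd v (sd w x) = sd w (sd v x)"
proof (transfer, rule ext)
  fix v w z :: 'a and F :: "'a \<Rightarrow> real"
  let ?U = "ball 0 1 :: 'a set"
  assume F: "smooth_on ?U F \<and> (\<forall>z. z \<notin> ?U \<longrightarrow> F z = 0)"
  have "dir ?U v (\<lambda>z. if z \<in> ?U then dir ?U w F z else 0) z = dir ?U v (dir ?U w F) z" if "z \<in> ?U" for v w
    using that by (rule dir_cong) simp
  thus "(if z \<in> ?U then dir ?U v (\<lambda>z. if z \<in> ?U then dir ?U w F z else 0) z else 0)
      = (if z \<in> ?U then dir ?U w (\<lambda>z. if z \<in> ?U then dir ?U v F z else 0) z else 0)"
    using dir_commute[of ?U F z v w] F by simp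
qed

lemma apply_fun_simps:
  "apply_fun (x + y) z = apply_fun x z + apply_fun y z"
  "apply_fun (x - y) z = apply_fun x z - apply_fun y z"
  "apply_fun (x * y) z = apply_fun x z * apply_fun y z"
  "apply_fun (- x) z = - apply_fun x z"
  "apply_fun 0 z = 0"
  by (transfer, simp)+

lemma apply_fun_one: "apply_fun 1 (0 :: 'a::euclidean_space) = 1"
  by transfer simp

lemma apply_fun_numeral: "apply_fun (numeral n) (0 :: 'a::euclidean_space) = numeral n"
proof -
  have "apply_fun (of_nat n) (0 :: 'a) = of_nat n" for n
    by (induction n) (simp_all add: apply_fun_simps apply_fun_one)
  thus ?thesis by (metis of_nat_numeral)
qed

lemma apply_fun_sum: "apply_fun (\<Sum>i\<in>I. F i) z = (\<Sum>i\<in>I. apply_fun (F i) z)"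
  by (induction I rule: infinite_finite_induct) (simp_all add: apply_fun_simps)

text \<open>\<open>pull z0 r\<close> restricts a function to \<open>ball z0 r\<close> and rescales it to the unit ball.\<close>

definition pull :: "'a::euclidean_space \<Rightarrow> real \<Rightarrow> ('a \<Rightarrow> real) \<Rightarrow> 'a smooth_fun" where
  "pull z0 r F = Abs_smooth_fun (\<lambda>z. if z \<in> ball 0 1 then F (z0 + r *\<^sub>R z) else 0)"

section \<open>Transfer from a ball around a point to the ring\<close>

lemma has_derivative_rescale:
  assumes "z0 + r *\<^sub>R z \<in> interior S" "F differentiable_on S"
  shows "((\<lambda>z. F (z0 + r *\<^sub>R z)) has_derivative (\<lambda>v. dir S (r *\<^sub>R v) F (z0 + r *\<^sub>R z))) (at z)"
proof -
  have "(F has_derivative (\<lambda>v. dir S v F (z0 + r *\<^sub>R z))) (at (z0 + r *\<^sub>R z))"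
    using has_derivative_frechet[OF assms(2) interior_subset[THEN subsetD, OF assms(1)]] at_within_interior[OF assms(1)]
    by (simp add: dir_def)
  moreover have "((\<lambda>z. z0 + r *\<^sub>R z) has_derivative (\<lambda>v. r *\<^sub>R v)) (at z)"
    by (auto intro!: derivative_eq_intros)
  ultimately show ?thesis
    using diff_chain_at by (fastforce simp: o_def)
qed

context
  fixes S :: "'a::euclidean_space set" and z0 :: 'a and r :: real
  assumes fat: "fat S" and r: "r > 0" and ball: "ball z0 r \<subseteq> S"
begin

lemma rescale_interior: "z \<in> ball 0 1 \<Longrightarrow> z0 + r *\<^sub>R z \<in> interior S"
  using r by (intro subsetD[OF interior_maximal[OF ball open_ball]]) (simp add: dist_norm)

lemma rescale_mem: "z \<in> ball 0 1 \<Longrightarrow> z0 + r *\<^sub>R z \<in> S"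
  using rescale_interior interior_subset by blast

lemma dir_rescale:
  assumes "F differentiable_on S" "z \<in> ball 0 1"
  shows "dir (ball 0 1) v (\<lambda>z. F (z0 + r *\<^sub>R z)) z = dir S (r *\<^sub>R v) F (z0 + r *\<^sub>R z)"
  using has_derivative_rescale[OF rescale_interior[OF assms(2)] assms(1)] assms(2)
  by (intro dir_unique fat_open) (auto intro: has_derivative_at_withinI)

lemma Ck_on_rescale: "Ck_on k S (F :: 'a \<Rightarrow> real) \<Longrightarrow> Ck_on k (ball 0 1) (\<lambda>z. F (z0 + r *\<^sub>R z))"
proof (induction k arbitrary: F)
  case 0
  thus ?case
    using rescale_mem by (auto intro!: continuous_intros continuous_on_compose2[of S F])
next
  case (Suc k)
  hence "Ck_on k (ball 0 1) (\<lambda>z. dir S (r *\<^sub>R v) F (z0 + r *\<^sub>R z))" for v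
    unfolding Ck_on_Suc_iff by blast
  hence "Ck_on k (ball 0 1) (dir (ball 0 1) v (\<lambda>z. F (z0 + r *\<^sub>R z)))" for v
    using Suc.prems unfolding Ck_on_Suc_iff
    by (subst Ck_on_cong[where g = "\<lambda>z. dir S (r *\<^sub>R v) F (z0 + r *\<^sub>R z)"]) (simp_all add: dir_rescale)
  moreover have "(\<lambda>z. F (z0 + r *\<^sub>R z)) differentiable_on ball 0 1"
    unfolding differentiable_on_def differentiable_def
    using has_derivative_rescale[OF rescale_interior] Suc.prems has_derivative_at_withinI
    unfolding Ck_on_Suc_iff by blast
  ultimately show ?case unfolding Ck_on_Suc_iff by blast
qed

lemma apply_pull:
  assumes "smooth_on S F"
  shows "apply_fun (pull z0 r F) = (\<lambda>z. if z \<in> ball 0 1 then F (z0 + r *\<^sub>R z) else 0)"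
proof -
  have "smooth_on (ball 0 1) (\<lambda>z. F (z0 + r *\<^sub>R z))"
    using assms Ck_on_rescale unfolding smooth_on_def by blast
  hence "smooth_on (ball 0 1) (\<lambda>z. if z \<in> ball 0 1 then F (z0 + r *\<^sub>R z) else 0)"
    by (subst smooth_on_cong[where g = "\<lambda>z. F (z0 + r *\<^sub>R z)"]) auto
  thus ?thesis
    unfolding pull_def by (intro Abs_smooth_fun_inverse) simp
qed

text \<open>The centre of the unit ball corresponds to \<open>z0\<close>, so a ring identity
  evaluated at \<open>0\<close> is an identity at \<open>z0\<close>.\<close>

lemma apply_pull_0: "smooth_on S F \<Longrightarrow> apply_fun (pull z0 r F) 0 = F z0"
  by (simp add: apply_pull)

lemma pull_cong: "(\<And>z. z \<in> S \<Longrightarrow> F z = G z) \<Longrightarrow> pull z0 r F = pull z0 r G"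
  unfolding pull_def by (rule arg_cong[where f = Abs_smooth_fun]) (simp add: fun_eq_iff rescale_mem del: mem_ball)

lemma pull_add: "smooth_on S F \<Longrightarrow> smooth_on S G \<Longrightarrow> pull z0 r (\<lambda>z. F z + G z) = pull z0 r F + pull z0 r G"
  and pull_mult: "smooth_on S F \<Longrightarrow> smooth_on S G \<Longrightarrow> pull z0 r (\<lambda>z. F z * G z) = pull z0 r F * pull z0 r G"
  and pull_diff: "smooth_on S F \<Longrightarrow> smooth_on S G \<Longrightarrow> pull z0 r (\<lambda>z. F z - G z) = pull z0 r F - pull z0 r G"
  by (auto simp: apply_fun_inject[symmetric] fun_eq_iff apply_fun_simps apply_pull
      smooth_on_add smooth_on_mult smooth_on_diff fat)

lemma pull_0: "pull z0 r (\<lambda>z. 0) = 0"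
  by (simp add: apply_fun_inject[symmetric] fun_eq_iff apply_fun_simps apply_pull smooth_on_const fat)

lemma pull_1: "pull z0 r (\<lambda>z. 1) = 1"
  by (simp add: apply_fun_inject[symmetric] fun_eq_iff apply_pull smooth_on_const fat one_smooth_fun.rep_eq)

lemma pull_numeral: "pull z0 r (\<lambda>z. numeral n) = numeral n"
proof -
  have "pull z0 r (\<lambda>z. of_nat n) = of_nat n" for n
    using pull_add[of "\<lambda>z. 1" "\<lambda>z. of_nat _"]
    by (induction n) (simp_all add: pull_0 pull_1 smooth_on_const fat)
  thus ?thesis by (metis of_nat_numeral)
qed

lemma pull_sum: "(\<And>i. i \<in> I \<Longrightarrow> smooth_on S (F i)) \<Longrightarrow> pull z0 r (\<lambda>z. \<Sum>i\<in>I. F i z) = (\<Sum>i\<in>I. pull z0 r (F i))"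
  by (induction I rule: infinite_finite_induct) (simp_all add: pull_0 pull_add smooth_on_sum fat)

text \<open>The chain rule for the rescaling produces a factor \<open>r\<close>, which the factor
  \<open>1 / r\<close> in the direction removes.\<close>

lemma sd_pull:
  assumes "smooth_on S F"
  shows "sd ((1 / r) *\<^sub>R v) (pull z0 r F) = pull z0 r (dir S v F)"
proof -
  have "dir (ball 0 1) ((1 / r) *\<^sub>R v) (\<lambda>z. if z \<in> ball 0 1 then F (z0 + r *\<^sub>R z) else 0) z = dir S v F (z0 + r *\<^sub>R z)"
    if "z \<in> ball 0 1" for z
    using that r assms dir_rescale[of F z "(1 / r) *\<^sub>R v"]
    by (subst dir_cong[where g = "\<lambda>z. F (z0 + r *\<^sub>R z)"]) (auto simp: smooth_on_differentiable)
  thus ?thesis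
    by (simp add: apply_fun_inject[symmetric] fun_eq_iff apply_pull sd.rep_eq assms smooth_on_dir del: mem_ball)
qed

end


section \<open>Coordinate expressions on space-time\<close>

type_synonym 'n spacetime = "(real^'n) \<times> real"

text \<open>The set is only fat, since in the application it contains the times \<open>0\<close> and
  \<open>T\<close>, where time derivatives are one-sided.\<close>

locale local_flow =
  fixes S :: "'n::finite spacetime set"
    and gg hh :: "'n \<Rightarrow> 'n \<Rightarrow> 'n spacetime \<Rightarrow> real"
    and GG :: "'n \<Rightarrow> 'n \<Rightarrow> 'n \<Rightarrow> 'n spacetime \<Rightarrow> real"
    and BB :: "'n \<Rightarrow> 'n \<Rightarrow> 'n spacetime \<Rightarrow> real"
    and ff :: "'n spacetime \<Rightarrow> real"
  assumes fat_S: "fat S"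
    and smooth_gg: "smooth_on S (gg i j)" and smooth_hh: "smooth_on S (hh i j)"
    and smooth_GG: "smooth_on S (GG k i j)" and smooth_BB: "smooth_on S (BB i j)" and smooth_ff: "smooth_on S ff"
begin

definition D :: "'n \<Rightarrow> ('n spacetime \<Rightarrow> real) \<Rightarrow> 'n spacetime \<Rightarrow> real" where
  "D i = dir S (axis i 1, 0)"

definition Dt :: "('n spacetime \<Rightarrow> real) \<Rightarrow> 'n spacetime \<Rightarrow> real" where
  "Dt = dir S (0, 1)"

definition Hess :: "('n spacetime \<Rightarrow> real) \<Rightarrow> 'n \<Rightarrow> 'n \<Rightarrow> 'n spacetime \<Rightarrow> real" where
  "Hess \<phi> i j z = D i (D j \<phi>) z - (\<Sum>m\<in>UNIV. GG m i j z * D m \<phi> z)"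

definition Lap :: "('n spacetime \<Rightarrow> real) \<Rightarrow> 'n spacetime \<Rightarrow> real" where
  "Lap \<phi> z = (\<Sum>i\<in>UNIV. \<Sum>j\<in>UNIV. hh i j z * Hess \<phi> i j z)"

definition Gsq :: "('n spacetime \<Rightarrow> real) \<Rightarrow> 'n spacetime \<Rightarrow> real" where
  "Gsq \<phi> z = (\<Sum>i\<in>UNIV. \<Sum>j\<in>UNIV. hh i j z * (D i \<phi> z * D j \<phi> z))"

definition Grad :: "('n spacetime \<Rightarrow> real) \<Rightarrow> 'n \<Rightarrow> 'n spacetime \<Rightarrow> real" where
  "Grad \<phi> i z = (\<Sum>j\<in>UNIV. hh i j z * D j \<phi> z)"

definition Riem :: "'n \<Rightarrow> 'n \<Rightarrow> 'n \<Rightarrow> 'n \<Rightarrow> 'n spacetime \<Rightarrow> real" where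
  "Riem l k i j z = D i (GG l j k) z - D j (GG l i k) z
     + (\<Sum>m\<in>UNIV. GG l i m z * GG m j k z - GG l j m z * GG m i k z)"

definition Ricc :: "'n \<Rightarrow> 'n \<Rightarrow> 'n spacetime \<Rightarrow> real" where
  "Ricc a b z = (\<Sum>i\<in>UNIV. Riem i b i a z)"

definition Cov :: "'n \<Rightarrow> ('n \<Rightarrow> 'n \<Rightarrow> 'n spacetime \<Rightarrow> real) \<Rightarrow> 'n \<Rightarrow> 'n \<Rightarrow> 'n spacetime \<Rightarrow> real" where
  "Cov k P i j z = D k (P i j) z - (\<Sum>m\<in>UNIV. GG m k i z * P m j z) - (\<Sum>m\<in>UNIV. GG m k j z * P i m z)"

lemmas smooth_rules = smooth_on_const[OF fat_S] smooth_on_add[OF fat_S] smooth_on_diff[OF fat_S] smooth_on_mult[OF fat_S]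
  smooth_on_sum[OF fat_S] smooth_gg smooth_hh smooth_GG smooth_BB smooth_ff

lemma smooth_D: "smooth_on S \<phi> \<Longrightarrow> smooth_on S (D i \<phi>)"
  by (simp add: D_def smooth_on_dir)

lemma smooth_Dt: "smooth_on S \<phi> \<Longrightarrow> smooth_on S (Dt \<phi>)"
  by (simp add: Dt_def smooth_on_dir)

lemma smooth_Hess: "smooth_on S \<phi> \<Longrightarrow> smooth_on S (Hess \<phi> i j)"
  unfolding Hess_def[abs_def] by (intro smooth_rules smooth_D)

lemma smooth_Lap: "smooth_on S \<phi> \<Longrightarrow> smooth_on S (Lap \<phi>)"
  unfolding Lap_def[abs_def] by (intro smooth_rules smooth_Hess)

lemma smooth_Gsq: "smooth_on S \<phi> \<Longrightarrow> smooth_on S (Gsq \<phi>)"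
  unfolding Gsq_def[abs_def] by (intro smooth_rules smooth_D)

lemma smooth_Riem: "smooth_on S (Riem l k i j)"
  unfolding Riem_def[abs_def] by (intro smooth_rules smooth_D)

lemma smooth_Ricc: "smooth_on S (Ricc i j)"
  unfolding Ricc_def[abs_def] by (intro smooth_rules smooth_Riem)

end

locale local_heat_flow = local_flow S gg hh GG BB ff
  for S :: "'n::finite spacetime set" and gg hh :: "'n \<Rightarrow> 'n \<Rightarrow> 'n spacetime \<Rightarrow> real" and GG BB ff +
  assumes gg_sym: "z \<in> S \<Longrightarrow> gg i j z = gg j i z" and hh_sym: "z \<in> S \<Longrightarrow> hh i j z = hh j i z"
    and GG_sym: "z \<in> S \<Longrightarrow> GG k i j z = GG k j i z"
    and gg_hh: "z \<in> S \<Longrightarrow> (\<Sum>k\<in>UNIV. gg i k z * hh k j z) = (if i = j then 1 else 0)"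
    and gg_parallel: "z \<in> S \<Longrightarrow> D k (gg i j) z = (\<Sum>m\<in>UNIV. GG m k i z * gg m j z) + (\<Sum>m\<in>UNIV. GG m k j z * gg i m z)"
    and heat_ff: "z \<in> S \<Longrightarrow> Dt ff z = Lap ff z + Gsq ff z"
    and flow_gg: "z \<in> S \<Longrightarrow> Dt (gg i j) z = BB i j z - 2 * Ricc i j z"
begin

text \<open>On a ball around the interior point the data are elements of the ring, where the
  evolution identities hold; they are evaluated at its centre. The second identity is doubled so
  that \<open>E_df\<close> can be inserted.\<close>

lemma evolution:
  assumes z: "z0 \<in> interior S"
  shows "Lap (Gsq ff) z0 - Dt (Gsq ff) z0 = 2 * (\<Sum>k\<in>UNIV. \<Sum>b\<in>UNIV. Ricc k b z0 * Grad ff k z0 * Grad ff b z0)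
     + 2 * (\<Sum>i\<in>UNIV. \<Sum>j\<in>UNIV. hh i j z0 * (\<Sum>k\<in>UNIV. \<Sum>l\<in>UNIV. hh k l z0 * (Hess ff i l z0 * Hess ff j k z0)))
     + (\<Sum>a\<in>UNIV. \<Sum>b\<in>UNIV. Dt (gg a b) z0 * Grad ff a z0 * Grad ff b z0) - 2 * (\<Sum>i\<in>UNIV. Grad ff i z0 * D i (Gsq ff) z0)"
    (is ?gsq)
    and "2 * (Lap (Lap ff) z0 - Dt (Lap ff) z0)
      = 2 * (\<Sum>a\<in>UNIV. \<Sum>b\<in>UNIV. Dt (gg a b) z0 * (\<Sum>i\<in>UNIV. \<Sum>j\<in>UNIV. hh a i z0 * hh b j z0 * Hess ff i j z0))
     + (\<Sum>l\<in>UNIV. Grad ff l z0 * (2 * (\<Sum>i\<in>UNIV. \<Sum>j\<in>UNIV. hh i j z0 * Cov i BB l j z0)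
          - (\<Sum>i\<in>UNIV. \<Sum>j\<in>UNIV. hh i j z0 * Cov l BB i j z0)))
     - 2 * (2 * (\<Sum>k\<in>UNIV. Grad ff k z0 * D k (Lap ff) z0)
        + 2 * (\<Sum>k\<in>UNIV. \<Sum>b\<in>UNIV. Ricc k b z0 * Grad ff k z0 * Grad ff b z0)
        + 2 * (\<Sum>i\<in>UNIV. \<Sum>j\<in>UNIV. hh i j z0 * (\<Sum>k\<in>UNIV. \<Sum>l\<in>UNIV. hh k l z0 * (Hess ff i l z0 * Hess ff j k z0))))"
    (is ?lap)
proof -
  obtain r where r: "r > 0" "ball z0 r \<subseteq> S"
    using z mem_interior by blast
  note ctx = fat_S r
  define p where "p = pull z0 r"
  define d where "d i = sd ((1 / r) *\<^sub>R (axis i 1, 0) :: 'n spacetime)" for i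
  define e where "e = sd ((1 / r) *\<^sub>R (0, 1) :: 'n spacetime)"
  define g where "g i j = p (gg i j)" for i j
  define h where "h i j = p (hh i j)" for i j
  define G where "G k i j = p (GG k i j)" for k i j
  define f where "f = p ff"
  define B where "B i j = p (BB i j)" for i j
  note cong = pull_cong[OF ctx, folded p_def]
  note pull_rules = pull_add[OF ctx, folded p_def] pull_diff[OF ctx, folded p_def] pull_mult[OF ctx, folded p_def]
    pull_sum[OF ctx, folded p_def] pull_numeral[OF ctx, folded p_def]
  have d_p: "d i (p F) = p (D i F)" if "smooth_on S F" for i F
    unfolding d_def p_def D_def by (rule sd_pull[OF ctx that])
  have e_p: "e (p F) = p (Dt F)" if "smooth_on S F" for F
    unfolding e_def p_def Dt_def by (rule sd_pull[OF ctx that])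
  note smooth = smooth_rules smooth_D smooth_Dt smooth_Hess smooth_Lap smooth_Gsq smooth_Riem smooth_Ricc
  interpret levi_civita d g h G
  proof
    show "d i (x + y) = d i x + d i y" "d i (x * y) = d i x * y + x * d i y" for i x y
      unfolding d_def using derivation.add[OF derivation_sd] derivation.mult[OF derivation_sd] by blast+
    show "d i (d j x) = d j (d i x)" for i j x
      unfolding d_def by (rule sd_commute)
    show "g i j = g j i" "h i j = h j i" "G k i j = G k j i" for i j k
      unfolding g_def h_def G_def by (rule cong; simp add: gg_sym hh_sym GG_sym)+
    show "(\<Sum>k\<in>UNIV. g i k * h k j) = (if i = j then 1 else 0)" for i j
    proof -
      have "(\<Sum>k\<in>UNIV. g i k * h k j) = p (\<lambda>z. \<Sum>k\<in>UNIV. gg i k z * hh k j z)"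
        by (simp add: g_def h_def pull_rules smooth)
      also have "\<dots> = p (\<lambda>z. if i = j then 1 else 0)"
        by (rule cong) (simp add: gg_hh)
      also have "\<dots> = (if i = j then 1 else 0)"
        by (simp add: p_def pull_0[OF ctx] pull_1[OF ctx])
      finally show ?thesis .
    qed
    show "d k (g i j) = (\<Sum>m\<in>UNIV. G m k i * g m j) + (\<Sum>m\<in>UNIV. G m k j * g i m)" for k i j
    proof -
      have "d k (g i j) = p (\<lambda>z. (\<Sum>m\<in>UNIV. GG m k i z * gg m j z) + (\<Sum>m\<in>UNIV. GG m k j z * gg i m z))"
        by (simp add: g_def d_p smooth) (rule cong, simp add: gg_parallel)
      thus ?thesis by (simp add: pull_rules smooth g_def G_def)
    qed
  qed
  have hess: "hess (p \<phi>) i j = p (Hess \<phi> i j)" if "smooth_on S \<phi>" for \<phi> i j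
    unfolding Hess_def[abs_def] using that by (simp add: hess_def cov1_def d_p pull_rules smooth G_def)
  have lap: "lap (p \<phi>) = p (Lap \<phi>)" if "smooth_on S \<phi>" for \<phi>
    unfolding Lap_def[abs_def] using that by (simp add: lap_hess tr_def hess pull_rules smooth h_def)
  have gsq: "gsq (p \<phi>) = p (Gsq \<phi>)" if "smooth_on S \<phi>" for \<phi>
    unfolding Gsq_def[abs_def] using that by (simp add: gsq_def tr_def d_p pull_rules smooth h_def)
  have grad: "grad (p \<phi>) i = p (Grad \<phi> i)" if "smooth_on S \<phi>" for \<phi> i
    unfolding Grad_def[abs_def] using that by (simp add: grad_def d_p pull_rules smooth h_def)
  have Rm: "Rm l k i j = p (Riem l k i j)" for l k i j
    unfolding Riem_def[abs_def] by (simp add: Rm_def d_p pull_rules smooth G_def)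
  have Ric: "Ric i j = p (Ricc i j)" for i j
    unfolding Ricc_def[abs_def] by (simp add: Ric_def Rm pull_rules smooth)
  have Cov: "cov2 k B i j = p (Cov k BB i j)" for k i j
    unfolding Cov_def[abs_def] by (simp add: cov2_def d_p pull_rules smooth B_def G_def)
  interpret heat_flow d g h G e f B
  proof
    show "e (x + y) = e x + e y" "e (x * y) = e x * y + x * e y" for x y
      unfolding e_def using derivation.add[OF derivation_sd] derivation.mult[OF derivation_sd] by blast+
    show "e (d i x) = d i (e x)" for i x
      unfolding d_def e_def by (rule sd_commute)
    show "e f = lap f + gsq f"
    proof -
      have "e f = p (\<lambda>z. Lap ff z + Gsq ff z)"
        by (simp add: f_def e_p smooth) (rule cong, simp add: heat_ff)
      thus ?thesis by (simp add: pull_rules smooth f_def lap gsq)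
    qed
    show "e (g i j) = B i j - 2 * Ric i j" for i j
    proof -
      have "e (g i j) = p (\<lambda>z. BB i j z - 2 * Ricc i j z)"
        by (simp add: g_def e_p smooth) (rule cong, simp add: flow_gg)
      thus ?thesis by (simp add: pull_rules smooth B_def Ric)
    qed
  qed
  have smooth_Cov: "smooth_on S (Cov k BB i j)" for k i j
    unfolding Cov_def[abs_def] by (intro smooth)
  have smooth_Grad: "smooth_on S (Grad ff i)" for i
    unfolding Grad_def[abs_def] by (intro smooth)
  note to_pull = f_def g_def h_def lap gsq grad hess Ric Cov d_p e_p smooth tr_def
  note at_0 = apply_fun_simps apply_fun_sum apply_fun_numeral apply_pull_0[OF ctx, folded p_def] smooth smooth_Cov smooth_Grad
  have "apply_fun (lap (gsq f) - e (gsq f)) 0 = apply_fun (2 * (\<Sum>k\<in>UNIV. \<Sum>b\<in>UNIV. Ric k b * grad f k * grad f b)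
     + 2 * tr (\<lambda>i j. tr (\<lambda>k l. hess f i l * hess f j k))
     + (\<Sum>a\<in>UNIV. \<Sum>b\<in>UNIV. e (g a b) * grad f a * grad f b) - 2 * (\<Sum>i\<in>UNIV. grad f i * d i (gsq f))) 0"
    by (simp only: evolution_gsq)
  thus ?gsq
    by (simp add: to_pull at_0)
  have "2 * (lap (lap f) - e (lap f))
      = 2 * (\<Sum>a\<in>UNIV. \<Sum>b\<in>UNIV. e (g a b) * (\<Sum>i\<in>UNIV. \<Sum>j\<in>UNIV. h a i * h b j * hess f i j))
     + 2 * (\<Sum>m\<in>UNIV. E m * d m f)
     - 2 * (2 * (\<Sum>k\<in>UNIV. grad f k * d k (lap f)) + 2 * (\<Sum>k\<in>UNIV. \<Sum>b\<in>UNIV. Ric k b * grad f k * grad f b)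
        + 2 * tr (\<lambda>i j. tr (\<lambda>k l. hess f i l * hess f j k)))"
    unfolding evolution_lap by (simp add: algebra_simps)
  hence "apply_fun (2 * (lap (lap f) - e (lap f))) 0
      = apply_fun (2 * (\<Sum>a\<in>UNIV. \<Sum>b\<in>UNIV. e (g a b) * (\<Sum>i\<in>UNIV. \<Sum>j\<in>UNIV. h a i * h b j * hess f i j))
     + (\<Sum>l\<in>UNIV. grad f l * (2 * tr (\<lambda>i j. cov2 i B l j) - tr (cov2 l B)))
     - 2 * (2 * (\<Sum>k\<in>UNIV. grad f k * d k (lap f)) + 2 * (\<Sum>k\<in>UNIV. \<Sum>b\<in>UNIV. Ric k b * grad f k * grad f b)
        + 2 * tr (\<lambda>i j. tr (\<lambda>k l. hess f i l * hess f j k)))) 0"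
    by (simp only: E_df)
  thus ?lap
    by (simp add: to_pull at_0)
qed

end


section \<open>Pointwise estimates\<close>

definition bil :: "('n::finite \<Rightarrow> 'n \<Rightarrow> real) \<Rightarrow> real^'n \<Rightarrow> real^'n \<Rightarrow> real" where
  "bil g v w = (\<Sum>i\<in>UNIV. \<Sum>j\<in>UNIV. g i j * v $ i * w $ j)"

lemma bil_add: "bil g (u + v) w = bil g u w + bil g v w" "bil g w (u + v) = bil g w u + bil g w v"
  by (simp_all add: bil_def algebra_simps sum.distrib)

lemma bil_scale: "bil g (c *\<^sub>R v) w = c * bil g v w" "bil g v (c *\<^sub>R w) = c * bil g v w"
  by (simp_all add: bil_def algebra_simps sum_distrib_left)

lemma bil_diff: "bil g (u - v) w = bil g u w - bil g v w" "bil g w (u - v) = bil g w u - bil g w v"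
  by (simp_all add: bil_def algebra_simps sum_subtractf)

lemma bil_sum: "bil g (\<Sum>b\<in>B. F b) w = (\<Sum>b\<in>B. bil g (F b) w)"
  by (induction B rule: infinite_finite_induct) (simp_all add: bil_add, simp_all add: bil_def)

lemma bil_sym: "(\<And>i j. g i j = g j i) \<Longrightarrow> bil g v w = bil g w v"
  unfolding bil_def by (subst sum.swap) (simp add: mult_ac)

text \<open>Gram-Schmidt for the form \<open>g\<close>: fewer than \<open>CARD('n)\<close> vectors
  do not span, and a vector outside their span is made orthogonal to them and normalised.\<close>

lemma orthonormal_set_exists:
  fixes g :: "'n::finite \<Rightarrow> 'n \<Rightarrow> real"
  assumes sym: "\<And>i j. g i j = g j i" and pos: "\<And>v. v \<noteq> 0 \<Longrightarrow> bil g v v > 0"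
    and m: "m \<le> CARD('n)"
  shows "\<exists>B :: (real^'n) set. finite B \<and> card B = m \<and> (\<forall>u\<in>B. \<forall>v\<in>B. bil g u v = (if u = v then 1 else 0))"
  using m
proof (induction m)
  case 0
  show ?case by (rule exI[of _ "{}"]) simp
next
  case (Suc m)
  then obtain B :: "(real^'n) set" where B: "finite B" "card B = m"
    "\<And>u v. u \<in> B \<Longrightarrow> v \<in> B \<Longrightarrow> bil g u v = (if u = v then 1 else 0)"
    by auto
  have "dim B < DIM(real^'n)"
    using dim_le_card'[OF B(1)] B(2) Suc.prems by simp
  then obtain v where v: "v \<notin> span B"
    by (metis dim_eq_full nat_neq_iff UNIV_eq_I)
  define w where "w = v - (\<Sum>u\<in>B. bil g v u *\<^sub>R u)"
  have "w \<noteq> 0"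
  proof
    assume "w = 0"
    hence "v = (\<Sum>u\<in>B. bil g v u *\<^sub>R u)" by (simp add: w_def)
    moreover have "\<dots> \<in> span B" by (intro span_sum span_scale span_base)
    ultimately show False using v by simp
  qed
  have w_B: "bil g w u = 0" if "u \<in> B" for u
  proof -
    have "(\<Sum>x\<in>B. bil g v x * bil g x u) = (\<Sum>x\<in>B. if x = u then bil g v x else 0)"
      using B(3) that by (intro sum.cong) auto
    also have "\<dots> = bil g v u" using B(1) that by simp
    finally show ?thesis by (simp add: w_def bil_diff bil_sum bil_scale)
  qed
  define c where "c = sqrt (bil g w w)"
  have c: "c > 0" "c * c = bil g w w"
    using pos[OF \<open>w \<noteq> 0\<close>] by (simp_all add: c_def)
  define w' where "w' = (1 / c) *\<^sub>R w"
  have w'_B: "bil g w' u = 0" "bil g u w' = 0" if "u \<in> B" for u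
    using w_B[OF that] bil_sym[of g, OF sym, of u w] by (simp_all add: w'_def bil_scale)
  have w'_w': "bil g w' w' = 1"
    using c pos[OF \<open>w \<noteq> 0\<close>] by (simp add: w'_def bil_scale field_simps)
  have "w' \<notin> B"
    using w'_B w'_w' by force
  thus ?case
    using B w'_B w'_w' by (intro exI[of _ "insert w' B"]) auto
qed

text \<open>The frame vectors are the columns of \<open>N\<close>. Orthonormality reads
  \<open>N^T g N = 1\<close>, and a one-sided inverse of a square matrix is two-sided, so
  \<open>N N^T\<close> is the inverse of \<open>g\<close>, that is \<open>h\<close>.\<close>

lemma orthonormal_frame_exists:
  fixes g h :: "'n::finite \<Rightarrow> 'n \<Rightarrow> real"
  assumes sym: "\<And>i j. g i j = g j i" and pos: "\<And>v. v \<noteq> 0 \<Longrightarrow> bil g v v > 0"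
    and inv: "\<And>i j. (\<Sum>k\<in>UNIV. g i k * h k j) = (if i = j then 1 else 0)"
  obtains N :: "'n \<Rightarrow> 'n \<Rightarrow> real"
  where "\<And>i j. h i j = (\<Sum>a\<in>UNIV. N i a * N j a)"
    "\<And>a b. (\<Sum>i\<in>UNIV. \<Sum>j\<in>UNIV. g i j * N i a * N j b) = (if a = b then 1 else 0)"
proof -
  obtain B :: "(real^'n) set" where B: "finite B" "card B = CARD('n)"
    "\<And>u v. u \<in> B \<Longrightarrow> v \<in> B \<Longrightarrow> bil g u v = (if u = v then 1 else 0)"
    using orthonormal_set_exists[OF sym pos order.refl] by blast
  then obtain e :: "'n \<Rightarrow> real^'n" where e: "bij_betw e UNIV B"
    using finite_same_card_bij[of "UNIV :: 'n set" B] by auto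
  have e_on: "bil g (e a) (e b) = (if a = b then 1 else 0)" for a b
    using B(3) bij_betwE[OF e] bij_betw_imp_inj_on[OF e] by (simp add: inj_eq)
  define N where "N i a = e a $ i" for i a
  define MN MG MH :: "real^'n^'n" where "MN = (\<chi> i a. N i a)" "MG = (\<chi> i j. g i j)" "MH = (\<chi> i j. h i j)"
  note M_defs = MN_MG_MH_def
  have "transpose MN ** MG ** MN = mat 1"
  proof -
    have "(transpose MN ** MG ** MN) $ a $ b = bil g (e a) (e b)" for a b
      unfolding bil_def matrix_matrix_mult_def transpose_def M_defs N_def
      by (simp add: sum_distrib_left sum_distrib_right mult_ac) (rule sum.swap)
    thus ?thesis by (simp add: vec_eq_iff mat_def e_on)
  qed
  hence "MN ** (transpose MN ** MG) = mat 1"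
    using matrix_left_right_inverse by blast
  moreover have "MG ** MH = mat 1"
    by (simp add: vec_eq_iff mat_def matrix_matrix_mult_def M_defs inv)
  ultimately have "MH = MN ** transpose MN"
    by (metis matrix_mul_assoc matrix_mul_lid matrix_mul_rid)
  hence "h i j = (\<Sum>a\<in>UNIV. N i a * N j a)" for i j
    by (simp add: vec_eq_iff matrix_matrix_mult_def transpose_def M_defs)
  moreover have "(\<Sum>i\<in>UNIV. \<Sum>j\<in>UNIV. g i j * N i a * N j b) = (if a = b then 1 else 0)" for a b
    using e_on[of a b] by (simp add: bil_def N_def)
  ultimately show ?thesis using that by blast
qed

text \<open>Polarisation bounds the length of each row of \<open>R\<close> by \<open>c\<close>, and
  there are \<open>CARD('n)\<close> rows. This avoids diagonalising \<open>R\<close>.\<close>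

lemma sum_sqr_le_of_form_bound:
  fixes R :: "'n::finite \<Rightarrow> 'n \<Rightarrow> real"
  assumes sym: "\<And>i j. R i j = R j i" and c: "c \<ge> 0"
    and bound: "\<And>v. \<bar>bil R v v\<bar> \<le> c * (\<Sum>i\<in>UNIV. (v $ i)\<^sup>2)"
  shows "(\<Sum>a\<in>UNIV. \<Sum>b\<in>UNIV. (R a b)\<^sup>2) \<le> real CARD('n) * c\<^sup>2"
proof -
  have row: "(\<Sum>b\<in>UNIV. (R a b)\<^sup>2) \<le> c\<^sup>2" for a
  proof -
    define \<rho> where "\<rho> = (\<Sum>b\<in>UNIV. (R a b)\<^sup>2)"
    have "\<rho> \<ge> 0" by (simp add: \<rho>_def sum_nonneg)
    \<comment> \<open>The factor \<open>sqrt \<rho>\<close> gives \<open>v\<close> the same length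
      as the row \<open>w\<close>, so that \<open>4 * sqrt \<rho> * \<rho>\<close> is compared with
      \<open>4 * c * \<rho>\<close>.\<close>
    define v :: "real^'n" where "v = sqrt \<rho> *\<^sub>R axis a 1"
    define w :: "real^'n" where "w = (\<chi> b. R a b)"
    have vw: "bil R v w = sqrt \<rho> * \<rho>"
    proof -
      have "(\<Sum>j\<in>UNIV. R i j * v $ i * w $ j) = (if i = a then sqrt \<rho> * \<rho> else 0)" for i
      proof -
        have "(\<Sum>j\<in>UNIV. R i j * v $ i * w $ j) = (if i = a then \<Sum>j\<in>UNIV. sqrt \<rho> * (R a j)\<^sup>2 else 0)"
          by (simp add: v_def w_def axis_def power2_eq_square mult_ac)
        thus ?thesis by (simp only: sum_distrib_left[symmetric] \<rho>_def[symmetric])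
      qed
      thus ?thesis by (simp add: bil_def)
    qed
    have nv: "(\<Sum>i\<in>UNIV. (v $ i)\<^sup>2) = \<rho>"
      using \<open>\<rho> \<ge> 0\<close> by (simp add: v_def axis_def if_distrib if_distribR power_mult_distrib cong: if_cong)
    have nw: "(\<Sum>i\<in>UNIV. (w $ i)\<^sup>2) = \<rho>"
      by (simp add: w_def \<rho>_def)
    have "4 * bil R v w = bil R (v + w) (v + w) - bil R (v - w) (v - w)"
      using bil_sym[of R, OF sym, of w v] by (simp add: bil_add bil_diff)
    also have "\<dots> \<le> c * (\<Sum>i\<in>UNIV. ((v + w) $ i)\<^sup>2) + c * (\<Sum>i\<in>UNIV. ((v - w) $ i)\<^sup>2)"
      using bound[of "v + w"] bound[of "v - w"] by linarith
    also have "\<dots> = c * (2 * (\<Sum>i\<in>UNIV. (v $ i)\<^sup>2) + 2 * (\<Sum>i\<in>UNIV. (w $ i)\<^sup>2))"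
      by (simp add: sum_distrib_left sum.distrib[symmetric] power2_eq_square algebra_simps)
    also have "\<dots> = 4 * (c * \<rho>)" by (simp add: nv nw)
    finally have "sqrt \<rho> * \<rho> \<le> c * \<rho>" by (simp add: vw)
    hence "sqrt \<rho> \<le> c"
      using \<open>\<rho> \<ge> 0\<close> c by (cases "\<rho> = 0") auto
    hence "(sqrt \<rho>)\<^sup>2 \<le> c\<^sup>2"
      using \<open>\<rho> \<ge> 0\<close> by (intro power_mono) auto
    thus ?thesis using \<open>\<rho> \<ge> 0\<close> by (simp add: \<rho>_def)
  qed
  show ?thesis
    using sum_mono[of UNIV, OF row] by simp
qed

lemma trace_sqr_le:
  fixes P :: "'n::finite \<Rightarrow> 'n \<Rightarrow> real"
  shows "(\<Sum>a\<in>UNIV. P a a)\<^sup>2 \<le> real CARD('n) * (\<Sum>a\<in>UNIV. \<Sum>b\<in>UNIV. (P a b)\<^sup>2)"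
proof -
  have "(\<Sum>a\<in>UNIV. P a a)\<^sup>2 \<le> (\<Sum>a\<in>(UNIV::'n set). 1\<^sup>2) * (\<Sum>a\<in>UNIV. (P a a)\<^sup>2)"
    using Cauchy_Schwarz_ineq_sum[of "\<lambda>_. 1" "\<lambda>a. P a a" UNIV] by simp
  also have "\<dots> \<le> real CARD('n) * (\<Sum>a\<in>UNIV. \<Sum>b\<in>UNIV. (P a b)\<^sup>2)"
    by (simp, intro sum_mono) (rule member_le_sum, auto)
  finally show ?thesis .
qed

text \<open>The factor \<open>3 n\<close> is sharp up to lower order: the tensor paired with \<open>T\<close> has squared norm
  \<open>(3 n - 2) |x|\<^sup>2\<close>.\<close>

lemma divergence_term_le:
  fixes T :: "'n::finite \<Rightarrow> 'n \<Rightarrow> 'n \<Rightarrow> real" and x :: "'n \<Rightarrow> real"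
  assumes sym: "\<And>k i j. T k i j = T k j i"
    and T: "(\<Sum>k\<in>UNIV. \<Sum>i\<in>UNIV. \<Sum>j\<in>UNIV. (T k i j)\<^sup>2) \<le> K\<^sup>2"
  shows "(\<Sum>c\<in>UNIV. x c * (\<Sum>a\<in>UNIV. 2 * T a c a - T c a a))
    \<le> (\<Sum>c\<in>UNIV. (x c)\<^sup>2) / 2 + 3 / 2 * real CARD('n) * K\<^sup>2"
proof -
  define n where "n = real CARD('n)"
  have n: "n \<ge> 1" by (simp add: n_def Suc_leI)
  define \<delta> where "\<delta> i j = (if i = j then 1 else 0 :: real)" for i j :: 'n
  \<comment> \<open>The factor 2 of the divergence is split evenly between the two symmetric index
    positions of \<open>T\<close>.\<close>
  define M where "M k i j = \<delta> k i * x j + \<delta> k j * x i - \<delta> i j * x k" for k i j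
  define W where "W = (\<Sum>c\<in>UNIV. (x c)\<^sup>2)"
  have "W \<ge> 0" by (simp add: W_def sum_nonneg)
  have \<delta>1: "(\<Sum>j\<in>UNIV. \<delta> i j * F j) = F i" "(\<Sum>j\<in>UNIV. \<delta> j i * F j) = F i" for i :: 'n and F :: "'n \<Rightarrow> real"
    by (simp_all add: \<delta>_def if_distrib[where f = "\<lambda>c. c * _"] cong: if_cong)
  have \<delta>2: "\<delta> i j * \<delta> i j = \<delta> i j" for i j by (simp add: \<delta>_def)
  have \<delta>3: "\<delta> i i = 1" for i by (simp add: \<delta>_def)
  have pairing: "(\<Sum>c\<in>UNIV. x c * (\<Sum>a\<in>UNIV. 2 * T a c a - T c a a)) = (\<Sum>k\<in>UNIV. \<Sum>i\<in>UNIV. \<Sum>j\<in>UNIV. T k i j * M k i j)"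
  proof -
    have 1: "(\<Sum>i\<in>UNIV. \<Sum>j\<in>UNIV. \<delta> k i * (T k i j * x j)) = (\<Sum>j\<in>UNIV. T k k j * x j)" for k
      by (simp add: sum_distrib_left[symmetric] \<delta>1)
    have 2: "(\<Sum>i\<in>UNIV. \<Sum>j\<in>UNIV. \<delta> k j * (T k i j * x i)) = (\<Sum>i\<in>UNIV. T k k i * x i)" for k
      by (simp add: \<delta>1 sym[of k _ k])
    have 3: "(\<Sum>i\<in>UNIV. \<Sum>j\<in>UNIV. \<delta> i j * (T k i j * x k)) = (\<Sum>i\<in>UNIV. T k i i * x k)" for k
      by (simp add: \<delta>1)
    have "(\<Sum>i\<in>UNIV. \<Sum>j\<in>UNIV. T k i j * M k i j)
        = 2 * (\<Sum>j\<in>UNIV. T k k j * x j) - (\<Sum>i\<in>UNIV. T k i i * x k)" for k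
      using 1[of k] 2[of k] 3[of k] by (simp add: M_def algebra_simps sum.distrib sum_subtractf)
    hence "(\<Sum>k\<in>UNIV. \<Sum>i\<in>UNIV. \<Sum>j\<in>UNIV. T k i j * M k i j)
        = 2 * (\<Sum>k\<in>UNIV. \<Sum>j\<in>UNIV. T k k j * x j) - (\<Sum>k\<in>UNIV. \<Sum>i\<in>UNIV. T k i i * x k)"
      by (simp add: sum_subtractf sum_distrib_left)
    also have "(\<Sum>k\<in>UNIV. \<Sum>j\<in>UNIV. T k k j * x j) = (\<Sum>j\<in>UNIV. \<Sum>k\<in>UNIV. T k j k * x j)"
      by (subst sum.swap) (simp add: sym)
    finally show ?thesis
      by (simp add: sum_subtractf sum_distrib_left algebra_simps)
  qed
  have norm_M: "(\<Sum>k\<in>UNIV. \<Sum>i\<in>UNIV. \<Sum>j\<in>UNIV. (M k i j)\<^sup>2) = (3 * n - 2) * W"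
  proof -
    have "(M k i j)\<^sup>2 = \<delta> k i * (x j)\<^sup>2 + \<delta> k j * (x i)\<^sup>2 + \<delta> i j * (x k)\<^sup>2
        + 2 * (\<delta> k i * (\<delta> k j * (x i * x j))) - 2 * (\<delta> k i * (\<delta> i j * (x j * x k))) - 2 * (\<delta> k j * (\<delta> i j * (x i * x k)))" for k i j
      by (simp add: M_def \<delta>_def power2_eq_square algebra_simps)
    hence *: "(\<Sum>k\<in>UNIV. \<Sum>i\<in>UNIV. \<Sum>j\<in>UNIV. (M k i j)\<^sup>2)
        = (\<Sum>k\<in>UNIV. \<Sum>i\<in>UNIV. \<Sum>j\<in>UNIV. \<delta> k i * (x j)\<^sup>2) + (\<Sum>k\<in>UNIV. \<Sum>i\<in>UNIV. \<Sum>j\<in>UNIV. \<delta> k j * (x i)\<^sup>2)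
        + (\<Sum>k\<in>UNIV. \<Sum>i\<in>UNIV. \<Sum>j\<in>UNIV. \<delta> i j * (x k)\<^sup>2)
        + 2 * (\<Sum>k\<in>UNIV. \<Sum>i\<in>UNIV. \<Sum>j\<in>UNIV. \<delta> k i * (\<delta> k j * (x i * x j)))
        - 2 * (\<Sum>k\<in>UNIV. \<Sum>i\<in>UNIV. \<Sum>j\<in>UNIV. \<delta> k i * (\<delta> i j * (x j * x k)))
        - 2 * (\<Sum>k\<in>UNIV. \<Sum>i\<in>UNIV. \<Sum>j\<in>UNIV. \<delta> k j * (\<delta> i j * (x i * x k)))"
      by (simp add: sum.distrib sum_subtractf sum_distrib_left)
    have a: "(\<Sum>k\<in>UNIV. \<Sum>i\<in>UNIV. \<Sum>j\<in>UNIV. \<delta> k i * (x j)\<^sup>2) = n * W"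
      by (simp add: sum_distrib_left[symmetric] \<delta>1 W_def n_def)
    have b: "(\<Sum>k\<in>UNIV. \<Sum>i\<in>UNIV. \<Sum>j\<in>UNIV. \<delta> k j * (x i)\<^sup>2) = n * W"
      by (simp add: \<delta>1 W_def n_def)
    have c: "(\<Sum>k\<in>UNIV. \<Sum>i\<in>UNIV. \<Sum>j\<in>UNIV. \<delta> i j * (x k)\<^sup>2) = n * W"
      by (simp add: \<delta>1 W_def n_def sum_distrib_left)
    have d: "(\<Sum>k\<in>UNIV. \<Sum>i\<in>UNIV. \<Sum>j\<in>UNIV. \<delta> k i * (\<delta> k j * (x i * x j))) = W"
      by (simp add: sum_distrib_left[symmetric] \<delta>1 W_def power2_eq_square)
    have e: "(\<Sum>k\<in>UNIV. \<Sum>i\<in>UNIV. \<Sum>j\<in>UNIV. \<delta> k i * (\<delta> i j * (x j * x k))) = W"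
      by (simp add: sum_distrib_left[symmetric] \<delta>1 W_def power2_eq_square)
    have f: "(\<Sum>k\<in>UNIV. \<Sum>i\<in>UNIV. \<Sum>j\<in>UNIV. \<delta> k j * (\<delta> i j * (x i * x k))) = W"
      by (simp add: sum_distrib_left[symmetric] \<delta>1 W_def power2_eq_square)
    show ?thesis unfolding * a b c d e f by (simp add: algebra_simps)
  qed
  \<comment> \<open>Young's inequality with weight \<open>3 * n\<close>: by \<open>norm_M\<close>
    the sum of the last terms is at most \<open>W\<close>, and halving gives the claim.\<close>
  have "2 * (T k i j * M k i j) \<le> 3 * n * (T k i j)\<^sup>2 + (M k i j)\<^sup>2 / (3 * n)" for k i j
  proof -
    have "0 \<le> (3 * n * T k i j - M k i j)\<^sup>2 / (3 * n)"
      using n by simp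
    also have "\<dots> = 3 * n * (T k i j)\<^sup>2 + (M k i j)\<^sup>2 / (3 * n) - 2 * (T k i j * M k i j)"
      using n by (simp add: power2_eq_square field_simps)
    finally show ?thesis by simp
  qed
  hence "(\<Sum>k\<in>UNIV. \<Sum>i\<in>UNIV. \<Sum>j\<in>UNIV. 2 * (T k i j * M k i j))
      \<le> (\<Sum>k\<in>UNIV. \<Sum>i\<in>UNIV. \<Sum>j\<in>UNIV. 3 * n * (T k i j)\<^sup>2 + (M k i j)\<^sup>2 / (3 * n))"
    by (intro sum_mono)
  also have "\<dots> = 3 * n * (\<Sum>k\<in>UNIV. \<Sum>i\<in>UNIV. \<Sum>j\<in>UNIV. (T k i j)\<^sup>2) + (3 * n - 2) * W / (3 * n)"
    by (simp add: sum.distrib sum_distrib_left sum_divide_distrib[symmetric] norm_M)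
  also have "\<dots> \<le> 3 * n * K\<^sup>2 + W"
  proof (intro add_mono mult_left_mono T)
    show "(3 * n - 2) * W / (3 * n) \<le> W"
      using n \<open>W \<ge> 0\<close> by (simp add: field_simps)
  qed (use n in simp)
  finally show ?thesis
    unfolding pairing by (simp add: sum_distrib_left[symmetric] W_def n_def)
qed


text \<open>A share \<open>2 * b\<close> of the squared Hessian pays for one mixed term. For
  \<open>r\<close> an entry of the Ricci tensor the cost is \<open>r^2 / (2 * b)\<close>; for
  \<open>r = - Q / 4\<close> it is \<open>Q^2 / (32 * b)\<close>, the origin of the 32 in
  \<open>B2\<close>.\<close>

lemma young_hessian:
  fixes r x b :: real
  assumes "b > 0"
  shows "2 * b * x\<^sup>2 + 2 * r * x + r\<^sup>2 / (2 * b) \<ge> 0"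
proof -
  have "2 * b * x\<^sup>2 + 2 * r * x + r\<^sup>2 / (2 * b) = 2 * b * (x + r / (2 * b))\<^sup>2"
    using assms by (simp add: power2_eq_square field_simps)
  thus ?thesis using assms by simp
qed

text \<open>Components in an orthonormal frame: \<open>P\<close> is the Hessian of
  \<open>ln u\<close>, \<open>R\<close> the Ricci tensor, \<open>Q\<close> is \<open>H^2\<close>,
  \<open>T\<close> its covariant derivative and \<open>x\<close> the gradient of
  \<open>ln u\<close>. As \<open>\<alpha> * (a + 2 * b) = 1\<close>, the term \<open>2 * N2\<close>
  splits into a share bounded by the trace and two equal shares that absorb the products of
  \<open>P\<close> with \<open>R\<close> and with \<open>Q\<close>.\<close>

lemma reaction_lower_bound:
  fixes P R Q :: "'n::finite \<Rightarrow> 'n \<Rightarrow> real" and T :: "'n \<Rightarrow> 'n \<Rightarrow> 'n \<Rightarrow> real" and x :: "'n \<Rightarrow> real"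
    and \<alpha> a b K1 K2 K3 K4 t :: real
  defines "n \<equiv> real CARD('n)" and "W \<equiv> (\<Sum>c\<in>UNIV. (x c)\<^sup>2)" and "N2 \<equiv> (\<Sum>i\<in>UNIV. \<Sum>j\<in>UNIV. (P i j)\<^sup>2)"
  assumes R_sym: "\<And>i j. R i j = R j i" and Q_sym: "\<And>i j. Q i j = Q j i" and T_sym: "\<And>k i j. T k i j = T k j i"
    and R_lower: "\<And>v. - K1 / t * (\<Sum>i\<in>UNIV. (v $ i)\<^sup>2) \<le> bil R v v"
    and R_upper: "\<And>v. bil R v v \<le> K2 / t * (\<Sum>i\<in>UNIV. (v $ i)\<^sup>2)"
    and Q_lower: "\<And>v. 0 \<le> bil Q v v" and Q_upper: "\<And>v. bil Q v v \<le> K3 / t * (\<Sum>i\<in>UNIV. (v $ i)\<^sup>2)"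
    and T_le: "(\<Sum>k\<in>UNIV. \<Sum>i\<in>UNIV. \<Sum>j\<in>UNIV. (T k i j)\<^sup>2) \<le> K4\<^sup>2"
    and pos: "K1 > 0" "K2 > 0" "K3 > 0" "t > 0" "\<alpha> > 1" "a > 0" "b > 0" and ab: "a + 2 * b = 1 / \<alpha>"
  shows "2 * N2 + 2 * \<alpha> * (\<Sum>i\<in>UNIV. \<Sum>j\<in>UNIV. R i j * x i * x j) + (1 - \<alpha>) / 2 * (\<Sum>i\<in>UNIV. \<Sum>j\<in>UNIV. Q i j * x i * x j)
       + 2 * \<alpha> * (\<Sum>i\<in>UNIV. \<Sum>j\<in>UNIV. R i j * P i j) - \<alpha> / 2 * (\<Sum>i\<in>UNIV. \<Sum>j\<in>UNIV. Q i j * P i j)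
       - \<alpha> / 4 * (\<Sum>c\<in>UNIV. x c * (\<Sum>a\<in>UNIV. 2 * T a c a - T c a a))
     \<ge> 2 * \<alpha> * a / n * (\<Sum>a\<in>UNIV. P a a)\<^sup>2 - \<alpha> * (2 * (K1 + (\<alpha> - 1) * K3 / (4 * \<alpha>)) / t + 1 / 8) * W
        - 3 / 8 * \<alpha> * n * K4\<^sup>2 - \<alpha> * n * max (K1\<^sup>2) (K2\<^sup>2) / (2 * b) / t\<^sup>2 - \<alpha> * n * K3\<^sup>2 / (32 * b) / t\<^sup>2"
proof -
  have n: "n \<ge> 1" by (simp add: n_def Suc_leI)
  define v :: "real^'n" where "v = (\<chi> i. x i)"
  have forms: "(\<Sum>i\<in>UNIV. \<Sum>j\<in>UNIV. F i j * x i * x j) = bil F v v" for F :: "'n \<Rightarrow> 'n \<Rightarrow> real"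
    by (simp add: bil_def v_def)
  have W: "(\<Sum>i\<in>UNIV. (v $ i)\<^sup>2) = W"
    by (simp add: v_def W_def)
  have R_norm: "(\<Sum>i\<in>UNIV. \<Sum>j\<in>UNIV. (R i j)\<^sup>2) \<le> n * max (K1\<^sup>2) (K2\<^sup>2) / t\<^sup>2"
  proof -
    have "\<bar>bil R v v\<bar> \<le> max K1 K2 / t * (\<Sum>i\<in>UNIV. (v $ i)\<^sup>2)" for v
    proof -
      have 1: "0 \<le> (\<Sum>i\<in>UNIV. (v $ i)\<^sup>2)" by (simp add: sum_nonneg)
      have "K1 / t * (\<Sum>i\<in>UNIV. (v $ i)\<^sup>2) \<le> max K1 K2 / t * (\<Sum>i\<in>UNIV. (v $ i)\<^sup>2)"
        "K2 / t * (\<Sum>i\<in>UNIV. (v $ i)\<^sup>2) \<le> max K1 K2 / t * (\<Sum>i\<in>UNIV. (v $ i)\<^sup>2)"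
        using pos by (intro mult_right_mono divide_right_mono 1; simp)+
      thus ?thesis using R_lower[of v] R_upper[of v] by simp
    qed
    hence "(\<Sum>i\<in>UNIV. \<Sum>j\<in>UNIV. (R i j)\<^sup>2) \<le> n * (max K1 K2 / t)\<^sup>2"
      unfolding n_def using pos by (intro sum_sqr_le_of_form_bound R_sym) auto
    also have "(max K1 K2 / t)\<^sup>2 = max (K1\<^sup>2) (K2\<^sup>2) / t\<^sup>2"
      using pos by (simp add: max_def power_divide power2_le_iff_abs_le power_mono_iff)
    finally show ?thesis by simp
  qed
  have Q_norm: "(\<Sum>i\<in>UNIV. \<Sum>j\<in>UNIV. (Q i j)\<^sup>2) \<le> n * K3\<^sup>2 / t\<^sup>2"
  proof -
    have "(\<Sum>i\<in>UNIV. \<Sum>j\<in>UNIV. (Q i j)\<^sup>2) \<le> n * (K3 / t)\<^sup>2"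
      unfolding n_def using pos Q_lower Q_upper by (intro sum_sqr_le_of_form_bound Q_sym) auto
    thus ?thesis by (simp add: power_divide)
  qed
  have RP: "2 * b * N2 + 2 * (\<Sum>i\<in>UNIV. \<Sum>j\<in>UNIV. R i j * P i j) + (\<Sum>i\<in>UNIV. \<Sum>j\<in>UNIV. (R i j)\<^sup>2) / (2 * b) \<ge> 0"
  proof -
    have "0 \<le> (\<Sum>i\<in>UNIV. \<Sum>j\<in>UNIV. 2 * b * (P i j)\<^sup>2 + 2 * R i j * P i j + (R i j)\<^sup>2 / (2 * b))"
      using pos by (intro sum_nonneg young_hessian)
    thus ?thesis by (simp add: N2_def sum.distrib sum_distrib_left sum_divide_distrib mult_ac)
  qed
  have QP: "2 * b * N2 - 1 / 2 * (\<Sum>i\<in>UNIV. \<Sum>j\<in>UNIV. Q i j * P i j) + (\<Sum>i\<in>UNIV. \<Sum>j\<in>UNIV. (Q i j)\<^sup>2) / (32 * b) \<ge> 0"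
  proof -
    have "0 \<le> (\<Sum>i\<in>UNIV. \<Sum>j\<in>UNIV. 2 * b * (P i j)\<^sup>2 + 2 * (- Q i j / 4) * P i j + (- Q i j / 4)\<^sup>2 / (2 * b))"
      using pos by (intro sum_nonneg young_hessian)
    also have "\<dots> = (\<Sum>i\<in>UNIV. \<Sum>j\<in>UNIV. 2 * b * (P i j)\<^sup>2 - 1 / 2 * (Q i j * P i j) + (Q i j)\<^sup>2 / (32 * b))"
      by (intro sum.cong refl) (simp add: power_divide)
    finally show ?thesis
      by (simp only: N2_def sum.distrib sum_subtractf sum_distrib_left sum_divide_distrib)
  qed
  have "2 * \<alpha> * a / n * (\<Sum>a\<in>UNIV. P a a)\<^sup>2 \<le> 2 * \<alpha> * a * N2"
  proof -
    have "2 * \<alpha> * a / n * (\<Sum>a\<in>UNIV. P a a)\<^sup>2 \<le> 2 * \<alpha> * a / n * (n * N2)"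
      unfolding n_def N2_def using pos by (intro mult_left_mono trace_sqr_le) simp
    thus ?thesis using n by simp
  qed
  moreover have "\<alpha> * (2 * b * N2 + 2 * (\<Sum>i\<in>UNIV. \<Sum>j\<in>UNIV. R i j * P i j) + n * max (K1\<^sup>2) (K2\<^sup>2) / t\<^sup>2 / (2 * b)) \<ge> 0"
    using RP divide_right_mono[OF R_norm, of "2 * b"] pos by (intro mult_nonneg_nonneg) linarith+
  moreover have "\<alpha> * (2 * b * N2 - 1 / 2 * (\<Sum>i\<in>UNIV. \<Sum>j\<in>UNIV. Q i j * P i j) + n * K3\<^sup>2 / t\<^sup>2 / (32 * b)) \<ge> 0"
    using QP divide_right_mono[OF Q_norm, of "32 * b"] pos by (intro mult_nonneg_nonneg) linarith+
  moreover have "2 * N2 = 2 * \<alpha> * a * N2 + 2 * (2 * \<alpha> * b * N2)"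
  proof -
    have "\<alpha> * a + 2 * \<alpha> * b = 1" using ab pos by (simp add: field_simps)
    hence "2 * N2 = 2 * (\<alpha> * a + 2 * \<alpha> * b) * N2" by simp
    thus ?thesis by (simp add: algebra_simps)
  qed
  moreover have "2 * \<alpha> * bil R v v \<ge> - 2 * \<alpha> * K1 / t * W"
    using mult_left_mono[OF R_lower[of v], of "2 * \<alpha>"] pos by (simp add: W)
  moreover have "(1 - \<alpha>) / 2 * bil Q v v \<ge> (1 - \<alpha>) / 2 * (K3 / t * W)"
    using Q_upper[of v] pos by (intro mult_left_mono_neg) (simp_all add: W)
  moreover have "\<alpha> / 4 * (\<Sum>c\<in>UNIV. x c * (\<Sum>a\<in>UNIV. 2 * T a c a - T c a a)) \<le> \<alpha> / 4 * (W / 2 + 3 / 2 * n * K4\<^sup>2)"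
    unfolding W_def n_def using pos by (intro mult_left_mono divergence_term_le T_sym T_le) simp
  moreover
  \<comment> \<open>The bounds on \<open>R\<close> and \<open>Q\<close> contribute
    \<open>2 * \<alpha> * K1\<close> and \<open>(\<alpha> - 1) / 2 * K3\<close>; the
    \<open>1 / 8\<close> is \<open>1 / 4\<close> times the \<open>W / 2\<close> of
    \<open>divergence_term_le\<close>.\<close>
  have C: "\<alpha> * (2 * (K1 + (\<alpha> - 1) * K3 / (4 * \<alpha>)) / t + 1 / 8) * W
      = 2 * \<alpha> * K1 / t * W - (1 - \<alpha>) / 2 * (K3 / t * W) + \<alpha> / 8 * W"
    using pos by (simp add: field_simps)
  ultimately show ?thesis
    unfolding forms C by (simp add: algebra_simps add_divide_distrib diff_divide_distrib)
qed

text \<open>Applied with \<open>L = \<Delta> ln u\<close> and \<open>W = |\<nabla> ln u|\<^sup>2\<close>; \<open>W\<close> is eliminated by completing the square.\<close>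

lemma harnack_quadratic:
  fixes q W L n \<alpha> a C t :: real
  assumes "- \<alpha> * L = q + (\<alpha> - 1) * W" "q \<ge> 0" "W \<ge> 0" "n > 0" "\<alpha> > 1" "a > 0" "t > 0"
  shows "2 * \<alpha> * a / n * L\<^sup>2 - \<alpha> * (2 * C / t + 1 / 8) * W
    \<ge> 2 * a / (n * \<alpha>) * q\<^sup>2 - (n * \<alpha> ^ 3 / (2 * a * (\<alpha> - 1)\<^sup>2) * C\<^sup>2 / t\<^sup>2
        + n * \<alpha> ^ 3 / (16 * a * (\<alpha> - 1)\<^sup>2) * C / t + n * \<alpha> ^ 3 / (512 * a * (\<alpha> - 1)\<^sup>2))"
proof -
  define c where "c = 2 * a / (n * \<alpha>) * (\<alpha> - 1)\<^sup>2"
  define y where "y = \<alpha> * (2 * C / t + 1 / 8)"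
  have "c > 0" using assms by (simp add: c_def)
  have "2 * \<alpha> * a / n * L\<^sup>2 = 2 * a / (n * \<alpha>) * (- \<alpha> * L)\<^sup>2"
    using assms by (simp add: power2_eq_square field_simps)
  also have "\<dots> = 2 * a / (n * \<alpha>) * q\<^sup>2 + c * W\<^sup>2 + 2 * a / (n * \<alpha>) * (2 * (\<alpha> - 1) * W * q)"
  proof -
    have "(q + (\<alpha> - 1) * W)\<^sup>2 = q\<^sup>2 + (\<alpha> - 1)\<^sup>2 * W\<^sup>2 + 2 * (\<alpha> - 1) * W * q"
      by (simp add: power2_eq_square algebra_simps)
    thus ?thesis unfolding assms(1) c_def by (simp only: distrib_left mult.assoc)
  qed
  \<comment> \<open>The mixed term is dropped; it is nonnegative because \<open>q\<close>,
    \<open>W\<close> and \<open>\<alpha> - 1\<close> are.\<close>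
  also have "\<dots> \<ge> 2 * a / (n * \<alpha>) * q\<^sup>2 + c * W\<^sup>2"
    using assms by simp
  finally have 1: "2 * \<alpha> * a / n * L\<^sup>2 \<ge> 2 * a / (n * \<alpha>) * q\<^sup>2 + c * W\<^sup>2" .
  have "c * W\<^sup>2 - y * W + y\<^sup>2 / (4 * c) = c * (W - y / (2 * c))\<^sup>2"
    using \<open>c > 0\<close> by (simp add: power2_eq_square field_simps)
  moreover have "c * (W - y / (2 * c))\<^sup>2 \<ge> 0"
    using \<open>c > 0\<close> by simp
  ultimately have 2: "c * W\<^sup>2 - y * W \<ge> - (y\<^sup>2 / (4 * c))"
    by linarith
  have "y\<^sup>2 / (4 * c) = n * \<alpha> ^ 3 / (8 * a * (\<alpha> - 1)\<^sup>2) * (2 * C / t + 1 / 8)\<^sup>2"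
    using assms by (simp add: y_def c_def power2_eq_square power3_eq_cube mult_ac)
  \<comment> \<open>The three summands lead to the first term of \<open>B2\<close>, to
    \<open>B3\<close> and to the first term of \<open>B1\<close>.\<close>
  also have "(2 * C / t + 1 / 8)\<^sup>2 = 4 * C\<^sup>2 / t\<^sup>2 + C / (2 * t) + 1 / 64"
    using assms by (simp add: power2_eq_square field_simps)
  also have "n * \<alpha> ^ 3 / (8 * a * (\<alpha> - 1)\<^sup>2) * (4 * C\<^sup>2 / t\<^sup>2 + C / (2 * t) + 1 / 64)
      = n * \<alpha> ^ 3 / (2 * a * (\<alpha> - 1)\<^sup>2) * C\<^sup>2 / t\<^sup>2 + n * \<alpha> ^ 3 / (16 * a * (\<alpha> - 1)\<^sup>2) * C / t
        + n * \<alpha> ^ 3 / (512 * a * (\<alpha> - 1)\<^sup>2)"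
    by (simp add: distrib_left mult_ac)
  finally show ?thesis
    using 1 2 by (simp add: y_def)
qed

text \<open>With \<open>D\<close> the sum of the last three terms, the hypothesis says
  \<open>F^2 <= N * (F + D)\<close>. For \<open>s = sqrt N * sqrt D\<close> and
  \<open>F > N + s\<close> one would have \<open>F^2 > N * F + s * F >= N * F + N * D\<close>. This
  bound is coarser than the exact root, but subadditivity of the square root splits it into the
  separate terms of the theorem.\<close>

lemma harnack_solve:
  fixes F N B1 B2 B3 t :: real
  assumes "F\<^sup>2 / N \<le> F + B1 * t\<^sup>2 + B2 + B3 * t"
    and "N > 0" "B1 \<ge> 0" "B2 \<ge> 0" "B3 \<ge> 0" "t > 0"
  shows "F \<le> sqrt N * (sqrt N + sqrt B2 + sqrt B3 * sqrt t + sqrt B1 * t)"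
proof (rule ccontr)
  define D where "D = B1 * t\<^sup>2 + B2 + B3 * t"
  have "D \<ge> 0" using assms by (simp add: D_def)
  assume "\<not> ?thesis"
  moreover have "sqrt D \<le> sqrt B1 * t + sqrt B2 + sqrt B3 * sqrt t"
  proof -
    have "sqrt D \<le> sqrt (B1 * t\<^sup>2) + sqrt B2 + sqrt (B3 * t)"
      unfolding D_def using assms sqrt_add_le_add_sqrt[of "B1 * t\<^sup>2 + B2" "B3 * t"] sqrt_add_le_add_sqrt[of "B1 * t\<^sup>2" B2]
      by (smt (verit) mult_nonneg_nonneg zero_le_power2)
    thus ?thesis using assms by (simp add: real_sqrt_mult)
  qed
  hence "sqrt N * (sqrt N + sqrt D) \<le> sqrt N * (sqrt N + sqrt B2 + sqrt B3 * sqrt t + sqrt B1 * t)"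
    using assms by (intro mult_left_mono) auto
  ultimately have F: "F > N + sqrt N * sqrt D"
    using assms by (simp add: distrib_left)
  define s where "s = sqrt N * sqrt D"
  have s: "s \<ge> 0" "s * s = N * D"
    using assms \<open>D \<ge> 0\<close> by (simp_all add: s_def real_sqrt_mult[symmetric])
  have "F\<^sup>2 \<le> N * (F + D)"
    using assms by (simp add: D_def field_simps)
  moreover have "F * F > (N + s) * F"
    using F s assms by (intro mult_strict_right_mono) (auto simp: s_def[symmetric])
  moreover have "s * F \<ge> s * s"
    using F s assms by (intro mult_left_mono) (auto simp: s_def[symmetric])
  ultimately show False
    using s by (simp add: power2_eq_square algebra_simps)
qed


text \<open>\<open>N i a\<close> is the \<open>i\<close>-th coordinate of the \<open>a\<close>-th
  vector of an orthonormal frame. In frame components each contraction with \<open>h\<close> is a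
  diagonal sum.\<close>

locale frame =
  fixes h g N :: "'n::finite \<Rightarrow> 'n \<Rightarrow> real"
  assumes h_N: "h i j = (\<Sum>a\<in>UNIV. N i a * N j a)"
    and g_N: "(\<Sum>i\<in>UNIV. \<Sum>j\<in>UNIV. g i j * N i a * N j b) = (if a = b then 1 else 0)"
begin

definition fr1 :: "('n \<Rightarrow> real) \<Rightarrow> 'n \<Rightarrow> real" where
  "fr1 X a = (\<Sum>i\<in>UNIV. N i a * X i)"

definition fr2 :: "('n \<Rightarrow> 'n \<Rightarrow> real) \<Rightarrow> 'n \<Rightarrow> 'n \<Rightarrow> real" where
  "fr2 P a b = fr1 (\<lambda>i. fr1 (P i) b) a"

definition fr3 :: "('n \<Rightarrow> 'n \<Rightarrow> 'n \<Rightarrow> real) \<Rightarrow> 'n \<Rightarrow> 'n \<Rightarrow> 'n \<Rightarrow> real" where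
  "fr3 T a b c = fr1 (\<lambda>i. fr2 (T i) b c) a"

lemma fr1_diff: "fr1 (\<lambda>i. X i - Y i) a = fr1 X a - fr1 Y a"
  by (simp add: fr1_def right_diff_distrib sum_subtractf)

lemma fr1_cmult: "fr1 (\<lambda>i. c * X i) a = c * fr1 X a"
  by (simp add: fr1_def sum_distrib_left mult_ac)

lemma fr1_sum: "fr1 (\<lambda>i. \<Sum>m\<in>(UNIV::'n set). X m i) a = (\<Sum>m\<in>UNIV. fr1 (X m) a)"
  unfolding fr1_def sum_distrib_left by (rule sum.swap)

lemma fr1_swap: "fr1 (\<lambda>j. fr1 (\<lambda>i. P i j) a) b = fr1 (\<lambda>i. fr1 (P i) b) a"
  unfolding fr1_def sum_distrib_left by (subst sum.swap) (simp add: mult_ac)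

lemma fr2_sym: "(\<And>i j. P i j = P j i) \<Longrightarrow> fr2 P a b = fr2 P b a"
  unfolding fr2_def by (subst fr1_swap[symmetric]) simp

lemma fr2_diff: "fr2 (\<lambda>i j. P i j - Q i j) a b = fr2 P a b - fr2 Q a b"
  unfolding fr2_def by (simp add: fr1_diff)

lemma fr2_cmult: "fr2 (\<lambda>i j. c * P i j) a b = c * fr2 P a b"
  unfolding fr2_def by (simp add: fr1_cmult)

lemma fr1_cmult_right: "fr1 (\<lambda>i. X i * c) a = fr1 X a * c"
  by (simp add: fr1_def sum_distrib_left mult_ac)

lemma fr2_sum: "fr2 (\<lambda>i j. \<Sum>m\<in>(UNIV::'n set). X m i j) a b = (\<Sum>m\<in>UNIV. fr2 (X m) a b)"
  unfolding fr2_def fr1_sum ..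

lemma fr2_product: "fr2 (\<lambda>i j. X i * Y j) a b = fr1 X a * fr1 Y b"
  unfolding fr2_def fr1_cmult fr1_cmult_right ..

lemma contract2: "(\<Sum>i\<in>UNIV. \<Sum>j\<in>UNIV. h i j * P i j) = (\<Sum>a\<in>UNIV. fr2 P a a)"
proof -
  have "(\<Sum>j\<in>UNIV. h i j * P i j) = (\<Sum>a\<in>UNIV. N i a * fr1 (P i) a)" for i
    unfolding h_N fr1_def sum_distrib_left sum_distrib_right by (subst sum.swap) (simp add: mult_ac)
  hence "(\<Sum>i\<in>UNIV. \<Sum>j\<in>UNIV. h i j * P i j) = (\<Sum>i\<in>UNIV. \<Sum>a\<in>UNIV. N i a * fr1 (P i) a)"
    by simp
  also have "\<dots> = (\<Sum>a\<in>UNIV. fr2 P a a)"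
    unfolding fr2_def by (subst sum.swap) (simp add: fr1_def)
  finally show ?thesis .
qed

lemma contract1: "(\<Sum>i\<in>UNIV. \<Sum>j\<in>UNIV. h i j * (X i * Y j)) = (\<Sum>a\<in>UNIV. fr1 X a * fr1 Y a)"
  unfolding contract2 fr2_product ..

text \<open>The left-hand sides here and below have the shapes produced by
  \<open>local_heat_flow.evolution\<close>, with gradients as vectors with raised index.\<close>

lemma pair_up: "(\<Sum>i\<in>UNIV. (\<Sum>j\<in>UNIV. h i j * Y j) * X i) = (\<Sum>a\<in>UNIV. fr1 X a * fr1 Y a)"
  by (simp add: contract1[symmetric] sum_distrib_left sum_distrib_right mult_ac)

lemma form_up:
  "(\<Sum>i\<in>UNIV. \<Sum>j\<in>UNIV. R i j * (\<Sum>k\<in>UNIV. h i k * X k) * (\<Sum>k\<in>UNIV. h j k * X k))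
     = (\<Sum>a\<in>UNIV. \<Sum>b\<in>UNIV. fr2 R a b * fr1 X a * fr1 X b)"
proof -
  have 1: "(\<Sum>j\<in>UNIV. R i j * (\<Sum>k\<in>UNIV. h j k * X k)) = (\<Sum>b\<in>UNIV. fr1 (R i) b * fr1 X b)" for i
    using pair_up[of X "R i"] by (simp add: mult.commute)
  have "(\<Sum>i\<in>UNIV. \<Sum>j\<in>UNIV. R i j * (\<Sum>k\<in>UNIV. h i k * X k) * (\<Sum>k\<in>UNIV. h j k * X k))
      = (\<Sum>i\<in>UNIV. (\<Sum>k\<in>UNIV. h i k * X k) * (\<Sum>b\<in>UNIV. fr1 (R i) b * fr1 X b))"
    unfolding 1[symmetric] sum_distrib_left[of "sum _ _"] by (simp add: mult_ac)
  also have "\<dots> = (\<Sum>a\<in>UNIV. fr1 (\<lambda>i. \<Sum>b\<in>UNIV. fr1 (R i) b * fr1 X b) a * fr1 X a)"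
    by (rule pair_up)
  also have "\<dots> = (\<Sum>a\<in>UNIV. \<Sum>b\<in>UNIV. fr2 R a b * fr1 X a * fr1 X b)"
    unfolding fr1_sum fr1_cmult_right fr2_def sum_distrib_right by (simp add: mult_ac)
  finally show ?thesis .
qed

lemma norm_up:
  assumes "\<And>i j. P i j = P j i"
  shows "(\<Sum>i\<in>UNIV. \<Sum>j\<in>UNIV. h i j * (\<Sum>k\<in>UNIV. \<Sum>l\<in>UNIV. h k l * (P i l * P j k)))
    = (\<Sum>a\<in>UNIV. \<Sum>b\<in>UNIV. (fr2 P a b)\<^sup>2)"
proof -
  have "(\<Sum>k\<in>UNIV. \<Sum>l\<in>UNIV. h k l * (P i l * P j k)) = (\<Sum>b\<in>UNIV. fr1 (P i) b * fr1 (P j) b)" for i j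
    using contract1[of "P j" "P i"] by (simp add: mult.commute)
  hence "(\<Sum>i\<in>UNIV. \<Sum>j\<in>UNIV. h i j * (\<Sum>k\<in>UNIV. \<Sum>l\<in>UNIV. h k l * (P i l * P j k)))
      = (\<Sum>a\<in>UNIV. fr2 (\<lambda>i j. \<Sum>b\<in>UNIV. fr1 (P i) b * fr1 (P j) b) a a)"
    by (simp only: contract2)
  also have "\<dots> = (\<Sum>a\<in>UNIV. \<Sum>b\<in>UNIV. (fr2 P a b)\<^sup>2)"
    unfolding fr2_sum fr2_product by (simp add: fr2_def power2_eq_square)
  finally show ?thesis .
qed

lemma pair2_up:
  "(\<Sum>a\<in>UNIV. \<Sum>b\<in>UNIV. s a b * (\<Sum>i\<in>UNIV. \<Sum>j\<in>UNIV. h a i * h b j * P i j)) = (\<Sum>a\<in>UNIV. \<Sum>b\<in>UNIV. fr2 s a b * fr2 P a b)"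
proof -
  have "(\<Sum>a\<in>UNIV. \<Sum>b\<in>UNIV. s a b * (\<Sum>i\<in>UNIV. \<Sum>j\<in>UNIV. h a i * h b j * P i j))
      = (\<Sum>a\<in>UNIV. \<Sum>i\<in>UNIV. h a i * (\<Sum>b\<in>UNIV. \<Sum>j\<in>UNIV. h b j * (s a b * P i j)))"
    unfolding sum_distrib_left
    by (rule sum.cong[OF refl], subst sum.swap) (simp add: mult_ac)
  also have "\<dots> = (\<Sum>a\<in>UNIV. fr2 (\<lambda>k i. \<Sum>b\<in>UNIV. fr1 (s k) b * fr1 (P i) b) a a)"
    unfolding contract1 contract2 ..
  also have "\<dots> = (\<Sum>a\<in>UNIV. \<Sum>b\<in>UNIV. fr2 s a b * fr2 P a b)"
    unfolding fr2_sum fr2_product by (simp add: fr2_def)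
  finally show ?thesis .
qed

lemma divergence_up:
  "(\<Sum>l\<in>UNIV. (\<Sum>k\<in>UNIV. h l k * X k) * (2 * (\<Sum>i\<in>UNIV. \<Sum>j\<in>UNIV. h i j * S i l j) - (\<Sum>i\<in>UNIV. \<Sum>j\<in>UNIV. h i j * S l i j)))
     = (\<Sum>c\<in>UNIV. fr1 X c * (\<Sum>a\<in>UNIV. 2 * fr3 S a c a - fr3 S c a a))"
proof -
  have "fr1 (\<lambda>l. 2 * (\<Sum>i\<in>UNIV. \<Sum>j\<in>UNIV. h i j * S i l j) - (\<Sum>i\<in>UNIV. \<Sum>j\<in>UNIV. h i j * S l i j)) c
      = (\<Sum>a\<in>UNIV. 2 * fr3 S a c a - fr3 S c a a)" for c
  proof -
    have "fr1 (\<lambda>l. fr2 (\<lambda>i. S i l) a a) c = fr3 S a c a" for a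
      unfolding fr2_def fr3_def by (rule fr1_swap)
    thus ?thesis
      by (simp add: contract2 fr1_diff fr1_cmult fr1_sum sum_subtractf sum_distrib_left) (simp add: fr3_def)
  qed
  thus ?thesis by (simp only: pair_up mult.commute[of "fr1 X _"])
qed

lemma fr1_pairing: "(\<Sum>a\<in>UNIV. fr1 X a * v a) = (\<Sum>i\<in>UNIV. X i * (\<Sum>a\<in>UNIV. N i a * v a))"
  unfolding fr1_def sum_distrib_left sum_distrib_right by (subst sum.swap) (simp add: mult_ac)

text \<open>The coordinates of the vector with frame components \<open>v\<close>. Through
  \<open>bil_fr2\<close> and \<open>bil_g\<close>, bounds against the metric become bounds against
  the Euclidean norm.\<close>

definition vec_of :: "real^'n \<Rightarrow> real^'n" where
  "vec_of v = (\<chi> i. \<Sum>a\<in>UNIV. N i a * v $ a)"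

lemma vec_of_nth: "vec_of v $ i = (\<Sum>a\<in>UNIV. N i a * v $ a)"
  by (simp add: vec_of_def)

lemma bil_fr2: "bil (fr2 R) v v = bil R (vec_of v) (vec_of v)"
proof -
  have "bil (fr2 R) v v = (\<Sum>b\<in>UNIV. (\<Sum>a\<in>UNIV. fr1 (\<lambda>i. fr1 (R i) b) a * v $ a) * v $ b)"
    unfolding bil_def fr2_def sum_distrib_right by (rule sum.swap)
  also have "\<dots> = (\<Sum>b\<in>UNIV. \<Sum>i\<in>UNIV. vec_of v $ i * (fr1 (R i) b * v $ b))"
    unfolding fr1_pairing[where v = "\<lambda>a. v $ a"] by (simp add: vec_of_def sum_distrib_left sum_distrib_right mult_ac)
  also have "\<dots> = (\<Sum>i\<in>UNIV. vec_of v $ i * (\<Sum>b\<in>UNIV. fr1 (R i) b * v $ b))"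
    unfolding sum_distrib_left by (rule sum.swap)
  also have "\<dots> = bil R (vec_of v) (vec_of v)"
    unfolding fr1_pairing vec_of_nth[symmetric] bil_def by (simp add: sum_distrib_left mult_ac)
  finally show ?thesis .
qed

lemma bil_g: "bil g (vec_of v) (vec_of v) = (\<Sum>i\<in>UNIV. (v $ i)\<^sup>2)"
proof -
  have "fr2 g a b = (if a = b then 1 else 0)" for a b
    using g_N[of a b] by (simp add: fr2_def fr1_def sum_distrib_left mult_ac)
  hence "fr2 g = (\<lambda>a b. if a = b then 1 else 0)" by (simp add: fun_eq_iff)
  thus ?thesis
    unfolding bil_fr2[symmetric] by (simp add: bil_def power2_eq_square if_distrib if_distribR cong: if_cong)
qed

text \<open>In the frame \<open>Q i j\<close> is the inner product of the components of
  \<open>H i\<close> and \<open>H j\<close>, so \<open>Q\<close> is a Gram matrix and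
  \<open>bil Q v v\<close> a sum of squares. For \<open>H^2\<close> this gives the lower bound that
  accompanies the assumed upper bound.\<close>

lemma gram_nonneg:
  assumes "\<And>i j. Q i j = (\<Sum>a\<in>UNIV. \<Sum>d\<in>UNIV. h a d * (\<Sum>b\<in>UNIV. \<Sum>e\<in>UNIV. h b e * (H i a b * H j d e)))"
  shows "bil Q v v \<ge> 0" "Q i j = Q j i"
proof -
  have Q: "Q i j = (\<Sum>a\<in>UNIV. \<Sum>b\<in>UNIV. fr2 (H i) a b * fr2 (H j) a b)" for i j
  proof -
    have "Q i j = (\<Sum>a\<in>UNIV. fr2 (\<lambda>a d. \<Sum>b\<in>UNIV. fr1 (H i a) b * fr1 (H j d) b) a a)"
      unfolding assms contract1 contract2 ..
    thus ?thesis
      unfolding fr2_sum fr2_product by (simp add: fr2_def)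
  qed
  show "Q i j = Q j i" unfolding Q by (simp add: mult.commute)
  have "bil Q v v = (\<Sum>i\<in>UNIV. \<Sum>a\<in>UNIV. \<Sum>j\<in>UNIV. \<Sum>b\<in>UNIV. fr2 (H i) a b * v $ i * (fr2 (H j) a b * v $ j))"
    unfolding bil_def Q sum_distrib_right by (rule sum.cong[OF refl], subst sum.swap) (simp add: mult_ac)
  also have "\<dots> = (\<Sum>a\<in>UNIV. \<Sum>i\<in>UNIV. \<Sum>b\<in>UNIV. \<Sum>j\<in>UNIV. fr2 (H i) a b * v $ i * (fr2 (H j) a b * v $ j))"
    by (subst sum.swap) (intro sum.cong refl sum.swap)
  also have "\<dots> = (\<Sum>a\<in>UNIV. \<Sum>b\<in>UNIV. \<Sum>i\<in>UNIV. \<Sum>j\<in>UNIV. fr2 (H i) a b * v $ i * (fr2 (H j) a b * v $ j))"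
    by (intro sum.cong refl sum.swap)
  also have "\<dots> = (\<Sum>a\<in>UNIV. \<Sum>b\<in>UNIV. (\<Sum>i\<in>UNIV. fr2 (H i) a b * v $ i)\<^sup>2)"
    by (simp add: power2_eq_square sum_product)
  also have "\<dots> \<ge> 0" by (intro sum_nonneg) simp
  finally show "bil Q v v \<ge> 0" .
qed

lemma norm3_up:
  "(\<Sum>i\<in>UNIV. \<Sum>j\<in>UNIV. h i j * (\<Sum>k\<in>UNIV. \<Sum>l\<in>UNIV. h k l * (\<Sum>m\<in>UNIV. \<Sum>n\<in>UNIV. h m n * (S i k m * S j l n))))
     = (\<Sum>a\<in>UNIV. \<Sum>b\<in>UNIV. \<Sum>c\<in>UNIV. (fr3 S a b c)\<^sup>2)"
proof -
  have "(\<Sum>k\<in>UNIV. \<Sum>l\<in>UNIV. h k l * (\<Sum>m\<in>UNIV. \<Sum>n\<in>UNIV. h m n * (S i k m * S j l n)))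
      = (\<Sum>b\<in>UNIV. \<Sum>c\<in>UNIV. fr2 (S i) b c * fr2 (S j) b c)" for i j
    unfolding contract1 contract2 fr2_sum fr2_product by (simp add: fr2_def)
  hence "(\<Sum>i\<in>UNIV. \<Sum>j\<in>UNIV. h i j * (\<Sum>k\<in>UNIV. \<Sum>l\<in>UNIV. h k l * (\<Sum>m\<in>UNIV. \<Sum>n\<in>UNIV. h m n * (S i k m * S j l n))))
     = (\<Sum>a\<in>UNIV. fr2 (\<lambda>i j. \<Sum>b\<in>UNIV. \<Sum>c\<in>UNIV. fr2 (S i) b c * fr2 (S j) b c) a a)"
    by (simp only: contract2)
  also have "\<dots> = (\<Sum>a\<in>UNIV. \<Sum>b\<in>UNIV. \<Sum>c\<in>UNIV. (fr3 S a b c)\<^sup>2)"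
    unfolding fr2_sum fr2_product by (simp add: fr3_def power2_eq_square)
  finally show ?thesis .
qed

end


section \<open>The flow in a chart\<close>

lemma pos_def_invertible:
  fixes M :: "real^'n^'n"
  assumes "\<And>v. v \<noteq> 0 \<Longrightarrow> bil (\<lambda>i j. M $ i $ j) v v > 0"
  shows "invertible M"
proof -
  have "v = 0" if "M *v v = 0" for v
  proof (rule ccontr)
    assume "v \<noteq> 0"
    have "bil (\<lambda>i j. M $ i $ j) v v = (\<Sum>i\<in>UNIV. v $ i * (M *v v) $ i)"
      by (simp add: bil_def matrix_vector_mult_def sum_distrib_left mult_ac)
    thus False using assms[OF \<open>v \<noteq> 0\<close>] that by simp
  qed
  thus ?thesis
    using matrix_left_invertible_ker[of M] invertible_left_inverse[of M] by blast
qed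

lemma multi_index_0: "multi_index 0 = {[]}"
  by (auto simp: multi_index_def)

lemma sum_multi_index_Suc:
  fixes F :: "'n::finite list \<Rightarrow> real"
  shows "(\<Sum>I\<in>multi_index (Suc k). F I) = (\<Sum>i\<in>UNIV. \<Sum>I\<in>multi_index k. F (i # I))"
proof -
  have "bij_betw (\<lambda>(i, I). i # I) (UNIV \<times> multi_index k) (multi_index (Suc k))"
    by (rule bij_betwI[where g = "\<lambda>I. (hd I, tl I)"]) (auto simp: multi_index_def length_Suc_conv)
  from sum.reindex_bij_betw[OF this, of F, symmetric] show ?thesis
    by (simp add: sum.cartesian_product case_prod_unfold)
qed

lemma tensor_inner_0: "tensor_inner 0 g c p X Y = X [] * Y []"
  by (simp add: tensor_inner_def multi_index_0)

text \<open>Peeling off one index at a time turns the sum over multi-indices into nested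
  contractions, the shape in which the frame lemmas apply.\<close>

lemma tensor_inner_Suc:
  "tensor_inner (Suc k) g c p X Y
    = (\<Sum>i\<in>UNIV. \<Sum>j\<in>UNIV. ginv g c p i j * tensor_inner k g c p (\<lambda>I. X (i # I)) (\<lambda>J. Y (j # J)))"
proof -
  have "tensor_inner (Suc k) g c p X Y = (\<Sum>i\<in>UNIV. \<Sum>j\<in>UNIV. \<Sum>I\<in>multi_index k. \<Sum>J\<in>multi_index k.
      (\<Prod>l<Suc k. ginv g c p ((i # I) ! l) ((j # J) ! l)) * X (i # I) * Y (j # J))"
    unfolding tensor_inner_def sum_multi_index_Suc by (intro sum.cong refl sum.swap)
  thus ?thesis
    unfolding prod.lessThan_Suc_shift by (simp add: tensor_inner_def sum_distrib_left mult_ac)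
qed

lemmas tensor_inner_simps = numeral_2_eq_2 numeral_3_eq_3 tensor_inner_Suc tensor_inner_0

section \<open>The flow in the coordinates of one chart\<close>

locale chart_flow =
  fixes A :: "('m::{t2_space, second_countable_topology}, 'n::finite) chart set"
    and g H :: "real \<Rightarrow> ('m, 'n) tensor" and u :: "real \<Rightarrow> 'm \<Rightarrow> real" and T :: real and c :: "('m, 'n) chart"
  assumes atlas: "smooth_atlas A" and T_pos: "T > 0" and flow: "generalized_ricci_flow A T g H"
    and smooth_u: "smooth_function_family A T u" and u_pos: "\<forall>t\<in>{0..T}. \<forall>p. u t p > 0"
    and heat: "heat_solution A T g u" and c: "c \<in> A"
begin

definition V :: "(real^'n) set" where "V = snd c ` fst c"

definition S :: "'n spacetime set" where "S = V \<times> {0..T}"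

definition up :: "(real \<Rightarrow> 'm \<Rightarrow> real) \<Rightarrow> 'n spacetime \<Rightarrow> real" where
  "up F z = F (snd z) (cinv c (fst z))"

lemma open_V: "open V" and open_domain: "open (fst c)"
  and homeo: "homeomorphism (fst c) V (snd c) (cinv c)"
  using atlas c unfolding smooth_atlas_def V_def by blast+

lemma fat_S: "fat S"
  unfolding S_def by (rule fat_Times_interval[OF open_V T_pos])

lemma interior_S: "x \<in> V \<Longrightarrow> 0 < t \<Longrightarrow> t < T \<Longrightarrow> (x, t) \<in> interior S"
  unfolding S_def interior_Times by (simp add: interior_open[OF open_V])

lemma cinv_in: "x \<in> V \<Longrightarrow> cinv c x \<in> fst c" and coord_cinv: "x \<in> V \<Longrightarrow> snd c (cinv c x) = x"
  and coord_in: "p \<in> fst c \<Longrightarrow> snd c p \<in> V" and cinv_coord: "p \<in> fst c \<Longrightarrow> cinv c (snd c p) = p"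
  using homeo unfolding homeomorphism_def by auto

text \<open>\<open>partial\<close> fixes the time, so it differentiates \<open>up F\<close> along a
  slice with constant \<open>t\<close>. Such a slice is open in space even for \<open>t = 0\<close>
  and \<open>t = T\<close>, hence the unrestricted derivative.\<close>

lemma partial_up:
  assumes F: "smooth_on S (up F)" and z: "(x, t) \<in> S"
  shows "partial c i (F t) (cinv c x) = dir S (axis i 1, 0) (up F) (x, t)"
proof -
  have x: "x \<in> V" and t: "t \<in> {0..T}" using z by (auto simp: S_def)
  have "((\<lambda>x. (x, t)) has_derivative (\<lambda>v. (v, 0))) (at x within V)"
    by (auto intro!: derivative_eq_intros)
  moreover have "(up F has_derivative (\<lambda>v. dir S v (up F) (x, t))) (at (x, t) within (\<lambda>x. (x, t)) ` V)"
    using smooth_on_has_derivative[OF F z] by (rule has_derivative_subset) (use t in \<open>auto simp: S_def\<close>)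
  ultimately have "((\<lambda>x. up F (x, t)) has_derivative (\<lambda>v. dir S (v, 0) (up F) (x, t))) (at x within V)"
    by (rule has_derivative_in_compose)
  hence "((\<lambda>x. F t (cinv c x)) has_derivative (\<lambda>v. dir S (v, 0) (up F) (x, t))) (at x)"
    using at_within_open[OF x open_V] by (simp add: up_def)
  from frechet_derivative_at[OF this] show ?thesis
    unfolding partial_def coord_cinv[OF x] by (metis (no_types))
qed

lemma has_real_derivative_up:
  assumes F: "smooth_on S (up F)" and z: "(x, t) \<in> S"
  shows "((\<lambda>s. F s (cinv c x)) has_real_derivative dir S (0, 1) (up F) (x, t)) (at t within {0..T})"
proof -
  have x: "x \<in> V" using z by (auto simp: S_def)
  have "((\<lambda>s. (x, s)) has_derivative (\<lambda>v. (0, v))) (at t within {0..T})"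
    by (auto intro!: derivative_eq_intros)
  moreover have D: "(up F has_derivative (\<lambda>v. dir S v (up F) (x, t))) (at (x, t) within (\<lambda>s. (x, s)) ` {0..T})"
    using smooth_on_has_derivative[OF F z] by (rule has_derivative_subset) (use x in \<open>auto simp: S_def\<close>)
  ultimately have "((\<lambda>s. up F (x, s)) has_derivative (\<lambda>v. dir S (0, v) (up F) (x, t))) (at t within {0..T})"
    by (rule has_derivative_in_compose)
  moreover have "(\<lambda>v. dir S (0, v) (up F) (x, t)) = (*) (dir S (0, 1) (up F) (x, t))"
  proof (rule ext)
    fix v
    have "dir S (v *\<^sub>R (0, 1)) (up F) (x, t) = v *\<^sub>R dir S (0, 1) (up F) (x, t)"
      by (rule linear_cmul[OF has_derivative_linear[OF D]])
    thus "dir S (0, v) (up F) (x, t) = dir S (0, 1) (up F) (x, t) * v" by simp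
  qed
  ultimately show ?thesis
    by (simp only: has_field_derivative_def up_def fst_conv snd_conv)
qed

lemma real_derivative_unique:
  assumes "(f has_real_derivative a) (at t within {0..T})" "(f has_real_derivative b) (at t within {0..T})" "t \<in> {0..T}"
  shows "a = b"
  using assms T_pos unfolding has_real_derivative_iff_has_vector_derivative cbox_interval[symmetric]
  by (intro vector_derivative_unique_within_closed_interval[of 0 T t f a b]) auto

definition gg :: "'n \<Rightarrow> 'n \<Rightarrow> 'n spacetime \<Rightarrow> real" where "gg i j = up (\<lambda>t p. g t c p [i, j])"
definition hh :: "'n \<Rightarrow> 'n \<Rightarrow> 'n spacetime \<Rightarrow> real" where "hh i j = up (\<lambda>t p. ginv (g t) c p i j)"
definition GG :: "'n \<Rightarrow> 'n \<Rightarrow> 'n \<Rightarrow> 'n spacetime \<Rightarrow> real" where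
  "GG k i j = up (\<lambda>t p. christoffel (g t) c p k i j)"
definition QQ :: "'n \<Rightarrow> 'n \<Rightarrow> 'n spacetime \<Rightarrow> real" where
  "QQ i j = up (\<lambda>t p. H_squared (g t) (H t) c p [i, j])"
definition BB :: "'n \<Rightarrow> 'n \<Rightarrow> 'n spacetime \<Rightarrow> real" where "BB i j z = 1 / 2 * QQ i j z"
definition uu :: "'n spacetime \<Rightarrow> real" where "uu = up u"
definition ff :: "'n spacetime \<Rightarrow> real" where "ff z = ln (uu z)"

lemma smooth_gg: "smooth_on S (gg i j)"
proof -
  have "[i, j] \<in> multi_index 2" by (simp add: multi_index_def)
  thus ?thesis
    using flow c unfolding generalized_ricci_flow_def smooth_tensor_family_def S_def V_def gg_def up_def[abs_def] case_prod_unfold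
    by blast
qed

lemma smooth_HH: "smooth_on S (up (\<lambda>t p. H t c p [i, j, k]))"
proof -
  have "[i, j, k] \<in> multi_index 3" by (simp add: multi_index_def)
  thus ?thesis
    using flow c unfolding generalized_ricci_flow_def smooth_tensor_family_def S_def V_def gg_def up_def[abs_def] case_prod_unfold
    by blast
qed

lemma smooth_uu: "smooth_on S uu"
  using smooth_u c unfolding smooth_function_family_def S_def V_def uu_def up_def[abs_def] case_prod_unfold
  by blast

lemma uu_pos: "z \<in> S \<Longrightarrow> uu z > 0"
  using u_pos by (auto simp: uu_def up_def S_def)

lemma smooth_ff: "smooth_on S ff"
  unfolding ff_def[abs_def] by (intro smooth_on_ln fat_S smooth_uu uu_pos)

lemma metric:
  assumes "t \<in> {0..T}" "p \<in> fst c"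
  shows "g t c p [i, j] = g t c p [j, i]" "v \<noteq> 0 \<Longrightarrow> bil (\<lambda>i j. g t c p [i, j]) v v > 0"
proof -
  have "riemannian_metric A (g t)"
    using flow assms(1) unfolding generalized_ricci_flow_def by blast
  hence m: "\<forall>c\<in>A. \<forall>p\<in>fst c. (\<forall>i j. g t c p [i, j] = g t c p [j, i]) \<and>
        (\<forall>v :: real ^ 'n. v \<noteq> 0 \<longrightarrow> (\<Sum>i\<in>UNIV. \<Sum>j\<in>UNIV. g t c p [i, j] * v $ i * v $ j) > 0)"
    unfolding riemannian_metric_def by (rule conjunct2)
  note m = m[rule_format, OF c assms(2)]
  show "g t c p [i, j] = g t c p [j, i]" using m by simp
  show "bil (\<lambda>i j. g t c p [i, j]) v v > 0" if "v \<noteq> 0" using m that by (simp add: bil_def)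
qed

lemma gg_sym: "z \<in> S \<Longrightarrow> gg i j z = gg j i z"
  unfolding gg_def up_def by (rule metric) (auto simp: S_def cinv_in)

lemma gg_pos: "z \<in> S \<Longrightarrow> v \<noteq> 0 \<Longrightarrow> bil (\<lambda>i j. gg i j z) v v > 0"
  unfolding gg_def up_def by (rule metric) (auto simp: S_def cinv_in)

definition MM :: "'n spacetime \<Rightarrow> real^'n^'n" where "MM z = (\<chi> i j. gg i j z)"

lemma hh_MM: "hh i j z = matrix_inv (MM z) $ i $ j"
  by (simp add: hh_def up_def ginv_def metric_matrix_def MM_def gg_def)

lemma invertible_MM: "z \<in> S \<Longrightarrow> invertible (MM z)"
  by (rule pos_def_invertible) (simp add: MM_def gg_pos)

lemma smooth_hh: "smooth_on S (hh i j)"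
  unfolding hh_MM[abs_def] using smooth_gg invertible_MM
  by (intro smooth_on_matrix_inv fat_S) (auto simp: MM_def invertible_det_nz)

lemma gg_hh: "z \<in> S \<Longrightarrow> (\<Sum>k\<in>UNIV. gg i k z * hh k j z) = (if i = j then 1 else 0)"
proof -
  assume z: "z \<in> S"
  have "(MM z ** matrix_inv (MM z)) $ i $ j = mat 1 $ i $ j"
    by (simp only: matrix_inv_invertible[OF invertible_MM[OF z]])
  thus "(\<Sum>k\<in>UNIV. gg i k z * hh k j z) = (if i = j then 1 else 0)"
    by (simp only: matrix_matrix_mult_def mat_def hh_MM vec_lambda_beta) (simp add: MM_def)
qed

lemma hh_sym:
  assumes z: "z \<in> S"
  shows "hh i j z = hh j i z"
proof -
  let ?N = "matrix_inv (MM z)"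
  note N = matrix_inv_invertible[OF invertible_MM[OF z]]
  have "transpose (MM z) = MM z"
    using gg_sym[OF z] by (simp add: transpose_def MM_def vec_eq_iff)
  moreover have "transpose ?N ** transpose (MM z) = mat 1"
    by (simp only: matrix_transpose_mul[symmetric] N transpose_mat)
  ultimately have "transpose ?N ** (MM z ** ?N) = mat 1 ** ?N"
    by (simp only: matrix_mul_assoc)
  hence "transpose ?N = ?N"
    by (simp only: N matrix_mul_lid matrix_mul_rid)
  hence "transpose ?N $ i $ j = ?N $ i $ j" by simp
  thus ?thesis by (simp add: hh_MM transpose_def)
qed

abbreviation DD :: "'n \<Rightarrow> ('n spacetime \<Rightarrow> real) \<Rightarrow> 'n spacetime \<Rightarrow> real" where
  "DD i \<equiv> dir S (axis i 1, 0)"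

lemma GG_eq:
  assumes "z \<in> S"
  shows "GG k i j z = 1 / 2 * (\<Sum>l\<in>UNIV. hh k l z * (DD i (gg j l) z + DD j (gg i l) z - DD l (gg i j) z))"
proof (cases z)
  case (Pair x t)
  have 1: "partial c i (\<lambda>q. g t c q [j, l]) (cinv c x) = DD i (gg j l) (x, t)" for i j l
    using partial_up[OF smooth_gg[unfolded gg_def], of x t] assms by (simp add: gg_def Pair)
  show ?thesis
    unfolding GG_def up_def hh_def christoffel_def by (simp add: Pair 1)
qed

lemma smooth_GG: "smooth_on S (GG k i j)"
proof -
  have "smooth_on S (\<lambda>z. 1 / 2 * (\<Sum>l\<in>UNIV. hh k l z * (DD i (gg j l) z + DD j (gg i l) z - DD l (gg i j) z)))"
    by (intro smooth_on_mult smooth_on_sum smooth_on_add smooth_on_diff smooth_on_const smooth_on_dir fat_S smooth_gg smooth_hh)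
  thus ?thesis by (subst smooth_on_cong[OF GG_eq])
qed

lemma QQ_eq: "QQ i j = (\<lambda>z. \<Sum>a\<in>UNIV. \<Sum>d\<in>UNIV. hh a d z * (\<Sum>b\<in>UNIV. \<Sum>e\<in>UNIV. hh b e z *
    (up (\<lambda>t p. H t c p [i, a, b]) z * up (\<lambda>t p. H t c p [j, d, e]) z)))"
  by (simp add: QQ_def up_def[abs_def] H_squared_def tensor_inner_simps interior_coord_def hh_def)

lemma smooth_QQ: "smooth_on S (QQ i j)"
proof -
  define HH where "HH i j k = up (\<lambda>t p. H t c p [i, j, k])" for i j k
  have "smooth_on S (HH i j k)" for i j k
    unfolding HH_def by (rule smooth_HH)
  thus ?thesis
    unfolding QQ_eq HH_def[symmetric]
    by (intro smooth_on_mult smooth_on_sum fat_S smooth_hh)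
qed

lemma smooth_BB: "smooth_on S (BB i j)"
  unfolding BB_def[abs_def] by (intro smooth_on_mult smooth_on_const fat_S smooth_QQ)

sublocale L: local_flow S gg hh GG BB ff
  by unfold_locales (intro fat_S smooth_gg smooth_hh smooth_GG smooth_BB smooth_ff)+

lemma GG_sym: "z \<in> S \<Longrightarrow> GG k i j z = GG k j i z"
proof -
  assume z: "z \<in> S"
  have "DD l (gg i j) z = DD l (gg j i) z" for l
    using z gg_sym by (rule dir_cong)
  thus ?thesis by (simp add: GG_eq z add.commute)
qed

text \<open>Lowering the upper index of \<open>GG\<close> gives the Christoffel symbols of the first
  kind. In the sum of those for \<open>i, j\<close> and \<open>j, i\<close> everything but the
  derivative of \<open>gg i j\<close> cancels.\<close>

lemma gg_parallel:
  assumes z: "z \<in> S"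
  shows "L.D k (gg i j) z = (\<Sum>m\<in>UNIV. GG m k i z * gg m j z) + (\<Sum>m\<in>UNIV. GG m k j z * gg i m z)"
proof -
  have sym: "DD l (gg i j) z = DD l (gg j i) z" for l i j
    using z gg_sym by (rule dir_cong)
  have lower: "(\<Sum>m\<in>UNIV. GG m k i z * gg j m z) = 1 / 2 * (DD k (gg i j) z + DD i (gg k j) z - DD j (gg k i) z)" for i j
  proof -
    define X where "X l = DD k (gg i l) z + DD i (gg k l) z - DD l (gg k i) z" for l
    have "(\<Sum>m\<in>UNIV. GG m k i z * gg j m z) = 1 / 2 * (\<Sum>m\<in>UNIV. \<Sum>l\<in>UNIV. gg j m z * hh m l z * X l)"
      by (simp add: GG_eq[OF z] X_def sum_distrib_left sum_distrib_right mult_ac)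
    also have "(\<Sum>m\<in>UNIV. \<Sum>l\<in>UNIV. gg j m z * hh m l z * X l) = (\<Sum>l\<in>UNIV. (if j = l then 1 else 0) * X l)"
      by (subst sum.swap) (simp add: sum_distrib_right[symmetric] gg_hh z)
    also have "\<dots> = X j"
      by (simp add: if_distrib[where f = "\<lambda>c. c * _"] cong: if_cong)
    finally show ?thesis by (simp add: X_def)
  qed
  have "(\<Sum>m\<in>UNIV. GG m k i z * gg m j z) = (\<Sum>m\<in>UNIV. GG m k i z * gg j m z)"
    by (intro sum.cong refl arg_cong2[where f = "(*)"] gg_sym z)
  thus ?thesis
    using lower[of i j] lower[of j i] sym[of k j i]
    by (simp only: L.D_def) (simp add: field_simps)
qed

text \<open>For iterated derivatives: \<open>\<phi>\<close> may itself be a derivative, known only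
  through its coordinate expression \<open>F\<close>. \<open>partial_up\<close> asks for a
  time-dependent function on the manifold, and \<open>\<Phi>\<close> provides one by composing
  \<open>F\<close> with the coordinate map.\<close>

lemma partial_chart:
  assumes F: "smooth_on S F" and z: "(x, t) \<in> S" and eq: "\<And>y. y \<in> V \<Longrightarrow> \<phi> (cinv c y) = F (y, t)"
  shows "partial c i \<phi> (cinv c x) = L.D i F (x, t)"
proof -
  have t: "t \<in> {0..T}" and x: "x \<in> V" using z by (auto simp: S_def)
  define \<Phi> where "\<Phi> s p = F (snd c p, s)" for s p
  have up: "up \<Phi> w = F w" if "w \<in> S" for w
    using that by (auto simp: up_def \<Phi>_def S_def coord_cinv)
  have "smooth_on S (up \<Phi>)"
    by (rule iffD2[OF smooth_on_cong[OF up] F])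
  from partial_up[OF this z] have "partial c i (\<Phi> t) (cinv c x) = dir S (axis i 1, 0) (up \<Phi>) (x, t)" .
  also have "\<dots> = L.D i F (x, t)"
    unfolding L.D_def using z up by (rule dir_cong)
  also have "partial c i (\<Phi> t) (cinv c x) = partial c i \<phi> (cinv c x)"
    unfolding partial_def coord_cinv[OF x]
  proof -
    have "frechet_derivative (\<lambda>y. \<Phi> t (cinv c y)) (at x within V) = frechet_derivative (\<lambda>y. \<phi> (cinv c y)) (at x within V)"
      using x by (rule frechet_derivative_cong_on) (simp add: \<Phi>_def eq coord_cinv)
    thus "frechet_derivative (\<lambda>x. \<Phi> t (cinv c x)) (at x) (axis i 1) = frechet_derivative (\<lambda>x. \<phi> (cinv c x)) (at x) (axis i 1)"
      using at_within_open[OF x open_V] by simp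
  qed
  finally show ?thesis .
qed

lemma ricci_chart:
  assumes z: "(x, t) \<in> S"
  shows "ricci (g t) c (cinv c x) [a, b] = L.Ricc a b (x, t)"
proof -
  have "riemann (g t) c (cinv c x) l k i j = L.Riem l k i j (x, t)" for l k i j
  proof -
    have "partial c i (\<lambda>q. christoffel (g t) c q l j k) (cinv c x) = L.D i (GG l j k) (x, t)" for i j k l
      by (rule partial_chart[OF smooth_GG z]) (simp add: GG_def up_def)
    thus ?thesis
      by (simp add: riemann_def L.Riem_def) (simp add: GG_def up_def)
  qed
  thus ?thesis by (simp add: ricci_def L.Ricc_def)
qed

lemma hess_chart:
  assumes F: "smooth_on S F" and z: "(x, t) \<in> S" and eq: "\<And>y. y \<in> V \<Longrightarrow> \<phi> (cinv c y) = F (y, t)"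
  shows "nabla (g t) (differential \<phi>) c (cinv c x) [i, j] = L.Hess F i j (x, t)"
proof -
  have t: "t \<in> {0..T}" using z by (auto simp: S_def)
  have 1: "partial c j \<phi> (cinv c y) = L.D j F (y, t)" if "y \<in> V" for y j
    using t that by (intro partial_chart F eq) (auto simp: S_def)
  have "partial c i (\<lambda>q. partial c j \<phi> q) (cinv c x) = L.D i (L.D j F) (x, t)"
    by (rule partial_chart[OF L.smooth_D[OF F] z 1])
  moreover have "partial c m \<phi> (cinv c x) = L.D m F (x, t)" for m
    using z by (intro 1) (auto simp: S_def)
  ultimately show ?thesis
    by (simp add: nabla_def differential_def L.Hess_def) (simp add: GG_def up_def)
qed

lemma laplacian_chart:
  assumes F: "smooth_on S F" and z: "(x, t) \<in> S" and eq: "\<And>y. y \<in> V \<Longrightarrow> \<phi> (cinv c y) = F (y, t)"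
  shows "laplacian (g t) \<phi> c (cinv c x) = L.Lap F (x, t)"
proof -
  have "nabla (g t) (differential \<phi>) c (cinv c x) [i, j] = L.Hess F i j (x, t)" for i j
    using F z eq by (rule hess_chart)
  thus ?thesis by (simp add: laplacian_def L.Lap_def hh_def up_def)
qed

lemma nabla_QQ_chart:
  assumes z: "(x, t) \<in> S"
  shows "nabla (g t) (H_squared (g t) (H t)) c (cinv c x) [k, i, j] = L.Cov k QQ i j (x, t)"
proof -
  have "partial c k (\<lambda>q. H_squared (g t) (H t) c q [i, j]) (cinv c x) = L.D k (QQ i j) (x, t)"
    by (rule partial_chart[OF smooth_QQ z]) (simp add: QQ_def up_def)
  thus ?thesis
    by (simp add: nabla_def L.Cov_def numeral_2_eq_2 lessThan_Suc) (simp add: QQ_def GG_def up_def algebra_simps)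
qed

lemma Dt_gg:
  assumes z: "z \<in> S"
  shows "L.Dt (gg i j) z = BB i j z - 2 * L.Ricc i j z"
proof (cases z)
  case (Pair x t)
  have zS: "(x, t) \<in> S" and t: "t \<in> {0..T}" and x: "x \<in> V" using z Pair by (auto simp: S_def)
  have "[i, j] \<in> multi_index 2" by (simp add: multi_index_def)
  hence "((\<lambda>s. g s c (cinv c x) [i, j]) has_real_derivative
      (- 2 * ricci (g t) c (cinv c x) [i, j] + 1 / 2 * H_squared (g t) (H t) c (cinv c x) [i, j])) (at t within {0..T})"
    using flow c t cinv_in[OF x] unfolding generalized_ricci_flow_def by blast
  moreover have "((\<lambda>s. g s c (cinv c x) [i, j]) has_real_derivative L.Dt (gg i j) (x, t)) (at t within {0..T})"
    unfolding L.Dt_def gg_def using smooth_gg zS by (intro has_real_derivative_up) (simp_all add: gg_def)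
  ultimately have "L.Dt (gg i j) (x, t) = - 2 * ricci (g t) c (cinv c x) [i, j] + 1 / 2 * H_squared (g t) (H t) c (cinv c x) [i, j]"
    using real_derivative_unique t by blast
  thus ?thesis by (simp add: ricci_chart[OF zS] Pair BB_def QQ_def up_def)
qed

lemma heat_uu:
  assumes z: "z \<in> S"
  shows "L.Dt uu z = L.Lap uu z"
proof (cases z)
  case (Pair x t)
  have zS: "(x, t) \<in> S" and t: "t \<in> {0..T}" and x: "x \<in> V" using z Pair by (auto simp: S_def)
  have "((\<lambda>s. u s (cinv c x)) has_real_derivative laplacian (g t) (u t) c (cinv c x)) (at t within {0..T})"
    using heat c t cinv_in[OF x] unfolding heat_solution_def by blast
  moreover have "((\<lambda>s. u s (cinv c x)) has_real_derivative L.Dt uu (x, t)) (at t within {0..T})"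
    unfolding L.Dt_def uu_def using smooth_uu zS by (intro has_real_derivative_up) (simp_all add: uu_def)
  moreover have "laplacian (g t) (u t) c (cinv c x) = L.Lap uu (x, t)"
    by (rule laplacian_chart[OF smooth_uu zS]) (simp add: uu_def up_def)
  ultimately show ?thesis
    using real_derivative_unique[of _ _ t] t Pair by auto
qed

lemma D_ff: "z \<in> S \<Longrightarrow> L.D i ff z = L.D i uu z * inverse (uu z)"
  and Dt_ff: "z \<in> S \<Longrightarrow> L.Dt ff z = L.Dt uu z * inverse (uu z)"
  unfolding L.D_def L.Dt_def ff_def[abs_def]
  by (simp_all add: dir_rules(5)[OF fat_S _ smooth_on_differentiable[OF smooth_uu] smooth_on_differentiable[OF smooth_uu]] uu_pos)

lemma Hess_ff:
  assumes z: "z \<in> S"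
  shows "L.Hess ff i j z = L.Hess uu i j z * inverse (uu z) - L.D i ff z * L.D j ff z"
proof -
  have uu: "smooth_on S (\<lambda>z. inverse (uu z))"
    using uu_pos by (intro smooth_on_inverse fat_S smooth_uu) fastforce
  have "L.D i (L.D j ff) z = L.D i (\<lambda>z. L.D j uu z * inverse (uu z)) z"
    unfolding L.D_def[of i] using z D_ff by (rule dir_cong)
  also have "\<dots> = L.D i (L.D j uu) z * inverse (uu z) + L.D j uu z * L.D i (\<lambda>z. inverse (uu z)) z"
    unfolding L.D_def[of i]
    by (intro dir_rules(2) fat_S z smooth_on_differentiable uu L.smooth_D smooth_uu)
  also have "L.D i (\<lambda>z. inverse (uu z)) z = - (inverse (uu z) * L.D i uu z * inverse (uu z))"
    unfolding L.D_def using uu_pos[OF z]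
    by (intro dir_rules(4)[where g = uu] fat_S z smooth_on_differentiable smooth_uu) simp
  finally show ?thesis
    by (simp add: L.Hess_def D_ff z algebra_simps sum_distrib_left)
qed

text \<open>Tracing \<open>Hess_ff\<close> shows that the Laplacian of the logarithm is
  \<open>L.Lap uu / uu\<close> minus the squared gradient, which turns the linear equation into this
  one.\<close>

lemma heat_ff:
  assumes z: "z \<in> S"
  shows "L.Dt ff z = L.Lap ff z + L.Gsq ff z"
proof -
  have "L.Lap ff z + L.Gsq ff z = L.Lap uu z * inverse (uu z)"
    unfolding L.Lap_def L.Gsq_def
    by (simp add: Hess_ff z sum.distrib[symmetric] sum_distrib_left right_diff_distrib mult_ac)
  thus ?thesis by (simp add: Dt_ff heat_uu z)
qed

sublocale LH: local_heat_flow S gg hh GG BB ff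
  by unfold_locales (fact gg_sym hh_sym GG_sym gg_hh gg_parallel heat_ff Dt_gg)+

end

text \<open>A positive second derivative would make \<open>\<phi>'\<close> positive just to the
  right of \<open>0\<close>, and by the mean value theorem \<open>\<phi>\<close> would exceed its
  maximum there.\<close>

lemma derivatives_at_max:
  fixes \<phi> \<phi>' :: "real \<Rightarrow> real"
  assumes \<delta>: "\<delta> > 0" and \<phi>: "\<And>s. \<bar>s\<bar> < \<delta> \<Longrightarrow> (\<phi> has_real_derivative \<phi>' s) (at s)"
    and \<phi>': "(\<phi>' has_real_derivative k) (at 0)" and max: "\<And>s. \<bar>s\<bar> < \<delta> \<Longrightarrow> \<phi> s \<le> \<phi> 0"
  shows "\<phi>' 0 = 0" "k \<le> 0"
proof -
  show 0: "\<phi>' 0 = 0"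
    using DERIV_local_max[OF \<phi>[of 0] \<delta>] \<delta> max by simp
  show "k \<le> 0"
  proof (rule ccontr)
    assume "\<not> k \<le> 0"
    then obtain d where d: "d > 0" "\<And>h. 0 < h \<Longrightarrow> h < d \<Longrightarrow> \<phi>' 0 < \<phi>' (0 + h)"
      using DERIV_pos_inc_right[OF \<phi>'] by auto
    define s where "s = min d \<delta> / 2"
    have s: "s > 0" "s < d" "s < \<delta>" using d \<delta> by (auto simp: s_def min_def)
    obtain \<xi> where \<xi>: "0 < \<xi>" "\<xi> < s" "\<phi> s - \<phi> 0 = (s - 0) * \<phi>' \<xi>"
      using MVT2[OF s(1), of \<phi> \<phi>'] \<phi> s by fastforce
    have "s * \<phi>' \<xi> > 0"
      using \<xi> s d(2)[of \<xi>] 0 by simp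
    thus False using \<xi> max[of s] s by simp
  qed
qed

lemma dir_lincomb:
  fixes S :: "'a::euclidean_space set"
  assumes "fat S" "z \<in> S" "smooth_on S F" "smooth_on S G"
  shows "dir S v (\<lambda>z. a * F z - b * G z) z = a * dir S v F z - b * dir S v G z"
proof -
  have diff: "(\<lambda>z. c * F z) differentiable_on S" if "smooth_on S F" for c :: real and F :: "'a \<Rightarrow> real"
    using that by (intro smooth_on_differentiable smooth_on_mult smooth_on_const assms(1))
  have dir: "dir S v (\<lambda>z. c * F z) z = c * dir S v F z" if "smooth_on S F" for c F
    using dir_rules(2)[OF assms(1,2) smooth_on_differentiable[OF smooth_on_const[OF assms(1)]] smooth_on_differentiable[OF that], of v c]
    by (simp add: dir_const[OF assms(1,2)])
  have "dir S v (\<lambda>z. a * F z + - b * G z) z = dir S v (\<lambda>z. a * F z) z + dir S v (\<lambda>z. - b * G z) z"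
    by (rule dir_rules(1)[OF assms(1,2) diff[OF assms(3)] diff[OF assms(4)]])
  thus ?thesis by (simp only: dir[OF assms(3)] dir[OF assms(4)]) simp
qed

section \<open>The evolution inequality at a spatial critical point\<close>

context chart_flow
begin

text \<open>The quantity of the theorem, \<open>|grad f|^2 - \<alpha> * Dt f\<close> for
  \<open>f = ln u\<close>, with the time derivative eliminated by \<open>heat_ff\<close>.\<close>

definition qq :: "real \<Rightarrow> 'n spacetime \<Rightarrow> real" where
  "qq \<alpha> z = (1 - \<alpha>) * L.Gsq ff z - \<alpha> * L.Lap ff z"

lemma smooth_lincomb: "smooth_on S F \<Longrightarrow> smooth_on S G \<Longrightarrow> smooth_on S (\<lambda>z. a * F z - b * G z :: real)"
  by (intro smooth_on_diff smooth_on_mult smooth_on_const fat_S)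

lemma smooth_qq: "smooth_on S (qq \<alpha>)"
  unfolding qq_def[abs_def] by (intro smooth_lincomb L.smooth_Gsq L.smooth_Lap smooth_ff)

lemma Lap_lincomb:
  assumes z: "z \<in> S" and F: "smooth_on S F" and G: "smooth_on S G"
  shows "L.Lap (\<lambda>z. a * F z - b * G z) z = a * L.Lap F z - b * L.Lap G z"
proof -
  have D: "L.D i (\<lambda>z. a * F z - b * G z) z = a * L.D i F z - b * L.D i G z"
    if "smooth_on S F" "smooth_on S G" "z \<in> S" for i F G z
    unfolding L.D_def using that by (intro dir_lincomb fat_S)
  have "L.D i (L.D j (\<lambda>z. a * F z - b * G z)) z = a * L.D i (L.D j F) z - b * L.D i (L.D j G) z" for i j
  proof -
    have "L.D i (L.D j (\<lambda>z. a * F z - b * G z)) z = L.D i (\<lambda>z. a * L.D j F z - b * L.D j G z) z"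
      unfolding L.D_def[of i] using z D[OF F G] by (rule dir_cong)
    thus ?thesis by (simp add: D L.smooth_D F G z)
  qed
  hence *: "L.Hess (\<lambda>z. a * F z - b * G z) i j z = a * L.Hess F i j z - b * L.Hess G i j z" for i j
    by (simp add: L.Hess_def D F G z algebra_simps sum_subtractf sum_distrib_left)
  show ?thesis
    unfolding L.Lap_def * by (simp add: algebra_simps sum_subtractf sum_distrib_left)
qed

lemma Cov_sym:
  assumes z: "z \<in> S" and P: "\<And>z i j. z \<in> S \<Longrightarrow> P i j z = P j i z"
  shows "L.Cov k P i j z = L.Cov k P j i z"
proof -
  have "L.D k (P i j) z = L.D k (P j i) z"
    unfolding L.D_def using z P by (rule dir_cong)
  thus ?thesis using z by (simp add: L.Cov_def P[of z] algebra_simps)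
qed

lemma frame_exists:
  assumes z: "z \<in> S"
  obtains N where "frame (\<lambda>i j. hh i j z) (\<lambda>i j. gg i j z) N"
proof -
  show ?thesis
  proof (rule orthonormal_frame_exists[of "\<lambda>i j. gg i j z" "\<lambda>i j. hh i j z", OF gg_sym[OF z] gg_pos[OF z] gg_hh[OF z]])
    fix N :: "'n \<Rightarrow> 'n \<Rightarrow> real"
    assume "\<And>i j. hh i j z = (\<Sum>a\<in>UNIV. N i a * N j a)"
      and "\<And>a b. (\<Sum>i\<in>UNIV. \<Sum>j\<in>UNIV. gg i j z * N i a * N j b) = (if a = b then 1 else 0)"
    hence "frame (\<lambda>i j. hh i j z) (\<lambda>i j. gg i j z) N"
      by unfold_locales
    thus ?thesis by (rule that)
  qed
qed

lemma QQ_sym: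
  assumes z: "z \<in> S"
  shows "QQ i j z = QQ j i z"
proof -
  obtain N where N: "frame (\<lambda>i j. hh i j z) (\<lambda>i j. gg i j z) N"
    using frame_exists[OF z] .
  show ?thesis
    by (rule frame.gram_nonneg(2)[OF N, where Q = "\<lambda>i j. QQ i j z"]) (simp add: QQ_eq)
qed

text \<open>Symmetry is read off the flow equation: \<open>2 * L.Ricc\<close> is \<open>BB\<close>
  minus the time derivative of the metric, and both are symmetric.\<close>

lemma Ricc_sym:
  assumes z: "z \<in> S"
  shows "L.Ricc i j z = L.Ricc j i z"
proof -
  have "L.Dt (gg i j) z = L.Dt (gg j i) z"
    unfolding L.Dt_def using z gg_sym by (rule dir_cong)
  thus ?thesis using Dt_gg[OF z] QQ_sym[OF z, of i j] by (simp add: BB_def)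
qed

text \<open>At a spatial critical point of \<open>qq\<close> the pairing of its gradient with that
  of \<open>ff\<close> vanishes, so \<open>LH.evolution\<close> leaves only reaction terms. In an
  orthonormal frame at \<open>z\<close> these are the terms of
  \<open>reaction_lower_bound\<close>.\<close>

lemma reaction_at_critical_point:
  fixes \<alpha> a b K1 K2 K3 K4 t :: real
  defines "n \<equiv> real CARD('n)"
  assumes z: "z \<in> interior S" and crit: "\<And>i. L.D i (qq \<alpha>) z = 0"
    and R_lower: "\<And>v. - K1 / t * bil (\<lambda>i j. gg i j z) v v \<le> bil (\<lambda>i j. L.Ricc i j z) v v"
    and R_upper: "\<And>v. bil (\<lambda>i j. L.Ricc i j z) v v \<le> K2 / t * bil (\<lambda>i j. gg i j z) v v"
    and Q_upper: "\<And>v. bil (\<lambda>i j. QQ i j z) v v \<le> K3 / t * bil (\<lambda>i j. gg i j z) v v"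
    and T_le: "(\<Sum>i\<in>UNIV. \<Sum>j\<in>UNIV. hh i j z * (\<Sum>k\<in>UNIV. \<Sum>l\<in>UNIV. hh k l z * (\<Sum>m\<in>UNIV. \<Sum>n\<in>UNIV. hh m n z *
       (L.Cov i QQ k m z * L.Cov j QQ l n z)))) \<le> K4\<^sup>2"
    and pos: "K1 > 0" "K2 > 0" "K3 > 0" "t > 0" "\<alpha> > 1" "a > 0" "b > 0" and ab: "a + 2 * b = 1 / \<alpha>"
  shows "L.Lap (qq \<alpha>) z - L.Dt (qq \<alpha>) z
     \<ge> 2 * \<alpha> * a / n * (L.Lap ff z)\<^sup>2 - \<alpha> * (2 * (K1 + (\<alpha> - 1) * K3 / (4 * \<alpha>)) / t + 1 / 8) * L.Gsq ff z
        - 3 / 8 * \<alpha> * n * K4\<^sup>2 - \<alpha> * n * max (K1\<^sup>2) (K2\<^sup>2) / (2 * b) / t\<^sup>2 - \<alpha> * n * K3\<^sup>2 / (32 * b) / t\<^sup>2"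
proof -
  have zS: "z \<in> S" using z interior_subset by blast
  obtain N where N: "frame (\<lambda>i j. hh i j z) (\<lambda>i j. gg i j z) N"
    using frame_exists[OF zS] .
  interpret frame "\<lambda>i j. hh i j z" "\<lambda>i j. gg i j z" N by (rule N)
  define x where "x = fr1 (\<lambda>i. L.D i ff z)"
  define P where "P = fr2 (\<lambda>i j. L.Hess ff i j z)"
  define R where "R = fr2 (\<lambda>i j. L.Ricc i j z)"
  define Q where "Q = fr2 (\<lambda>i j. QQ i j z)"
  define Tf where "Tf = fr3 (\<lambda>i j k. L.Cov i QQ j k z)"
  have W: "L.Gsq ff z = (\<Sum>c\<in>UNIV. (x c)\<^sup>2)"
    by (simp add: L.Gsq_def contract1 x_def power2_eq_square)
  have Lap: "L.Lap ff z = (\<Sum>c\<in>UNIV. P c c)"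
    by (simp add: L.Lap_def contract2 P_def)
  have Hess_sym: "L.Hess ff i j z = L.Hess ff j i z" for i j
  proof -
    have "L.D i (L.D j ff) z = L.D j (L.D i ff) z"
    proof -
      \<comment> \<open>Derivatives within \<open>S\<close> agree with those within its interior,
        where second derivatives commute.\<close>
      have eq: "dir S v (dir S w ff) z = dir (interior S) v (dir (interior S) w ff) z" for v w
      proof -
        have "dir S v (dir S w ff) z = dir (interior S) v (dir S w ff) z"
          by (rule dir_subset_open[symmetric]) (use z interior_subset in auto)
        also have "\<dots> = dir (interior S) v (dir (interior S) w ff) z"
          using z by (rule dir_cong) (rule dir_subset_open[symmetric], use interior_subset in auto)
        finally show ?thesis .
      qed
      have "smooth_on (interior S) ff"
        by (rule smooth_on_subset_open[OF smooth_ff]) (use interior_subset in auto)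
      thus ?thesis
        unfolding L.D_def eq by (intro dir_commute z) simp_all
    qed
    thus ?thesis by (simp add: L.Hess_def GG_sym[OF zS, of _ i j])
  qed
  have N2: "(\<Sum>i\<in>UNIV. \<Sum>j\<in>UNIV. hh i j z * (\<Sum>k\<in>UNIV. \<Sum>l\<in>UNIV. hh k l z * (L.Hess ff i l z * L.Hess ff j k z)))
      = (\<Sum>i\<in>UNIV. \<Sum>j\<in>UNIV. (P i j)\<^sup>2)"
    unfolding P_def by (rule norm_up) (rule Hess_sym)
  have form: "(\<Sum>k\<in>UNIV. \<Sum>b\<in>UNIV. F k b * L.Grad ff k z * L.Grad ff b z) = (\<Sum>i\<in>UNIV. \<Sum>j\<in>UNIV. fr2 F i j * x i * x j)" for F
    unfolding L.Grad_def form_up x_def ..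
  have Dt_g: "fr2 (\<lambda>i j. L.Dt (gg i j) z) = (\<lambda>i j. 1 / 2 * Q i j - 2 * R i j)"
    unfolding Dt_gg[OF zS] BB_def fun_eq_iff Q_def R_def by (simp only: fr2_diff fr2_cmult simp_thms)
  have Cov_BB: "L.Cov k BB i j z = 1 / 2 * L.Cov k QQ i j z" for k i j
  proof -
    \<comment> \<open>The summand with coefficient 0 fits the equation to
      \<open>dir_lincomb\<close>.\<close>
    have "L.D k (BB i j) z = L.D k (\<lambda>z. 1 / 2 * QQ i j z - 0 * QQ i j z) z"
      unfolding BB_def[abs_def] by simp
    also have "\<dots> = 1 / 2 * L.D k (QQ i j) z"
      unfolding L.D_def using dir_lincomb[OF fat_S zS smooth_QQ smooth_QQ, of "(axis k 1, 0)" "1 / 2" i j 0 i j] by simp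
    finally show ?thesis
      by (simp add: L.Cov_def BB_def sum_distrib_left[symmetric] sum_divide_distrib[symmetric] diff_divide_distrib)
  qed
  have div: "(\<Sum>l\<in>UNIV. L.Grad ff l z * (2 * (\<Sum>i\<in>UNIV. \<Sum>j\<in>UNIV. hh i j z * L.Cov i BB l j z)
          - (\<Sum>i\<in>UNIV. \<Sum>j\<in>UNIV. hh i j z * L.Cov l BB i j z)))
      = 1 / 2 * (\<Sum>c\<in>UNIV. x c * (\<Sum>a\<in>UNIV. 2 * Tf a c a - Tf c a a))"
  proof -
    have "(\<Sum>l\<in>UNIV. L.Grad ff l z * (2 * (\<Sum>i\<in>UNIV. \<Sum>j\<in>UNIV. hh i j z * L.Cov i BB l j z)
          - (\<Sum>i\<in>UNIV. \<Sum>j\<in>UNIV. hh i j z * L.Cov l BB i j z)))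
       = 1 / 2 * (\<Sum>l\<in>UNIV. L.Grad ff l z * (2 * (\<Sum>i\<in>UNIV. \<Sum>j\<in>UNIV. hh i j z * L.Cov i QQ l j z)
          - (\<Sum>i\<in>UNIV. \<Sum>j\<in>UNIV. hh i j z * L.Cov l QQ i j z)))"
      unfolding Cov_BB by (simp add: sum_distrib_left sum_subtractf algebra_simps)
    thus ?thesis
      unfolding L.Grad_def Tf_def x_def by (simp only: divergence_up)
  qed
  have Dt_q: "L.Dt (qq \<alpha>) z = (1 - \<alpha>) * L.Dt (L.Gsq ff) z - \<alpha> * L.Dt (L.Lap ff) z"
    unfolding qq_def[abs_def] L.Dt_def by (intro dir_lincomb fat_S zS L.smooth_Gsq L.smooth_Lap smooth_ff)
  have D_q: "(1 - \<alpha>) * L.D i (L.Gsq ff) z - \<alpha> * L.D i (L.Lap ff) z = 0" for i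
  proof -
    have "L.D i (qq \<alpha>) z = (1 - \<alpha>) * L.D i (L.Gsq ff) z - \<alpha> * L.D i (L.Lap ff) z"
      unfolding qq_def[abs_def] L.D_def by (intro dir_lincomb fat_S zS L.smooth_Gsq L.smooth_Lap smooth_ff)
    thus ?thesis using crit by simp
  qed
  have Lap_q: "L.Lap (qq \<alpha>) z = (1 - \<alpha>) * L.Lap (L.Gsq ff) z - \<alpha> * L.Lap (L.Lap ff) z"
    unfolding qq_def[abs_def] by (intro Lap_lincomb zS L.smooth_Gsq L.smooth_Lap smooth_ff)
  have grad_q: "(1 - \<alpha>) * (\<Sum>i\<in>UNIV. L.Grad ff i z * L.D i (L.Gsq ff) z) = \<alpha> * (\<Sum>i\<in>UNIV. L.Grad ff i z * L.D i (L.Lap ff) z)"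
  proof -
    have "(\<Sum>i\<in>UNIV. L.Grad ff i z * ((1 - \<alpha>) * L.D i (L.Gsq ff) z - \<alpha> * L.D i (L.Lap ff) z)) = 0"
      by (simp add: D_q)
    thus ?thesis by (simp add: right_diff_distrib sum_subtractf sum_distrib_left mult_ac)
  qed
  define Rxx where "Rxx = (\<Sum>i\<in>UNIV. \<Sum>j\<in>UNIV. R i j * x i * x j)"
  define Qxx where "Qxx = (\<Sum>i\<in>UNIV. \<Sum>j\<in>UNIV. Q i j * x i * x j)"
  define RP where "RP = (\<Sum>i\<in>UNIV. \<Sum>j\<in>UNIV. R i j * P i j)"
  define QP where "QP = (\<Sum>i\<in>UNIV. \<Sum>j\<in>UNIV. Q i j * P i j)"
  define Nsq where "Nsq = (\<Sum>i\<in>UNIV. \<Sum>j\<in>UNIV. (P i j)\<^sup>2)"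
  define X where "X = (\<Sum>c\<in>UNIV. x c * (\<Sum>a\<in>UNIV. 2 * Tf a c a - Tf c a a))"
  define GW where "GW = (\<Sum>i\<in>UNIV. L.Grad ff i z * L.D i (L.Gsq ff) z)"
  define GL where "GL = (\<Sum>i\<in>UNIV. L.Grad ff i z * L.D i (L.Lap ff) z)"
  have sxx: "(\<Sum>i\<in>UNIV. \<Sum>j\<in>UNIV. (1 / 2 * Q i j - 2 * R i j) * x i * x j) = 1 / 2 * Qxx - 2 * Rxx"
  proof -
    have "(1 / 2 * Q i j - 2 * R i j) * x i * x j = 1 / 2 * (Q i j * x i * x j) - 2 * (R i j * x i * x j)" for i j
      by (simp add: algebra_simps)
    thus ?thesis by (simp only: sum_subtractf Qxx_def Rxx_def sum_distrib_left)
  qed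
  have sP: "(\<Sum>i\<in>UNIV. \<Sum>j\<in>UNIV. (1 / 2 * Q i j - 2 * R i j) * P i j) = 1 / 2 * QP - 2 * RP"
  proof -
    have "(1 / 2 * Q i j - 2 * R i j) * P i j = 1 / 2 * (Q i j * P i j) - 2 * (R i j * P i j)" for i j
      by (simp add: algebra_simps)
    thus ?thesis by (simp only: sum_subtractf QP_def RP_def sum_distrib_left)
  qed
  \<comment> \<open>The Ricci term of Bochner's formula will cancel against the Ricci part of the
    time derivative of the metric.\<close>
  have e1: "L.Lap (L.Gsq ff) z - L.Dt (L.Gsq ff) z = 2 * Rxx + 2 * Nsq + (1 / 2 * Qxx - 2 * Rxx) - 2 * GW"
    using LH.evolution(1)[OF z]
    unfolding N2 form Dt_g R_def[symmetric] Rxx_def[symmetric] Nsq_def[symmetric] sxx GW_def[symmetric] .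
  have e2: "2 * (L.Lap (L.Lap ff) z - L.Dt (L.Lap ff) z) = 2 * (1 / 2 * QP - 2 * RP) + 1 / 2 * X - 2 * (2 * GL + 2 * Rxx + 2 * Nsq)"
    using LH.evolution(2)[OF z]
    unfolding N2 form pair2_up div Dt_g R_def[symmetric] P_def[symmetric] Rxx_def[symmetric] Nsq_def[symmetric] sP GL_def[symmetric]
      X_def[symmetric] .
  have e3: "(1 - \<alpha>) * GW = \<alpha> * GL"
    using grad_q by (simp only: GW_def GL_def)
  \<comment> \<open>The weight \<open>\<alpha> / 2\<close> compensates the doubling in
    \<open>e2\<close>.\<close>
  have "L.Lap (qq \<alpha>) z - L.Dt (qq \<alpha>) z
      = (1 - \<alpha>) * (L.Lap (L.Gsq ff) z - L.Dt (L.Gsq ff) z) - \<alpha> / 2 * (2 * (L.Lap (L.Lap ff) z - L.Dt (L.Lap ff) z))"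
    unfolding Lap_q Dt_q by (simp add: algebra_simps)
  also have "\<dots> = 2 * Nsq + 2 * \<alpha> * Rxx + (1 - \<alpha>) / 2 * Qxx + 2 * \<alpha> * RP - \<alpha> / 2 * QP - \<alpha> / 4 * X
      - 2 * ((1 - \<alpha>) * GW - \<alpha> * GL)"
    unfolding e1 e2 by (simp add: field_simps)
  finally have eq: "L.Lap (qq \<alpha>) z - L.Dt (qq \<alpha>) z
      = 2 * Nsq + 2 * \<alpha> * Rxx + (1 - \<alpha>) / 2 * Qxx + 2 * \<alpha> * RP - \<alpha> / 2 * QP - \<alpha> / 4 * X"
    by (simp add: e3)
  show ?thesis
    unfolding eq Nsq_def Rxx_def Qxx_def RP_def QP_def X_def W Lap n_def
  proof (rule reaction_lower_bound)
    show "R i j = R j i" for i j unfolding R_def by (rule fr2_sym) (rule Ricc_sym[OF zS])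
    show "Q i j = Q j i" for i j unfolding Q_def by (rule fr2_sym) (rule QQ_sym[OF zS])
    show "Tf k i j = Tf k j i" for k i j
      unfolding Tf_def fr3_def using Cov_sym[OF zS QQ_sym] by (subst fr2_sym) auto
    show "- K1 / t * (\<Sum>i\<in>UNIV. (v $ i)\<^sup>2) \<le> bil R v v" "bil R v v \<le> K2 / t * (\<Sum>i\<in>UNIV. (v $ i)\<^sup>2)"
      "bil Q v v \<le> K3 / t * (\<Sum>i\<in>UNIV. (v $ i)\<^sup>2)" for v
      unfolding R_def Q_def bil_fr2 bil_g[symmetric] by (rule R_lower R_upper Q_upper)+
    show "0 \<le> bil Q v v" for v
      unfolding Q_def bil_fr2 by (rule gram_nonneg) (simp add: QQ_eq)
    show "(\<Sum>k\<in>UNIV. \<Sum>i\<in>UNIV. \<Sum>j\<in>UNIV. (Tf k i j)\<^sup>2) \<le> K4\<^sup>2"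
      using T_le unfolding norm3_up Tf_def .
  qed (fact pos ab)+
qed

end


section \<open>The estimate at a maximum\<close>

lemma dir_sum:
  fixes S :: "'a::euclidean_space set"
  assumes fat: "fat S" and z: "z \<in> S" and F: "\<And>i. i \<in> I \<Longrightarrow> smooth_on S (F i)"
  shows "dir S v (\<lambda>z. \<Sum>i\<in>I. c i * F i z) z = (\<Sum>i\<in>I. c i * dir S v (F i) z)"
proof -
  have "((\<lambda>z. \<Sum>i\<in>I. c i * F i z) has_derivative (\<lambda>v. \<Sum>i\<in>I. c i * dir S v (F i) z)) (at z within S)"
    using smooth_on_has_derivative[OF F z] by (intro has_derivative_sum has_derivative_mult_right) auto
  thus ?thesis by (rule dir_unique[OF fat z])
qed

context chart_flow
begin

lemma dir_space:
  assumes F: "smooth_on S F" and z: "z \<in> S"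
  shows "dir S (w, 0) F z = (\<Sum>i\<in>UNIV. w $ i * L.D i F z)"
proof -
  interpret lin: linear "\<lambda>v. dir S v F z"
    using smooth_on_has_derivative[OF F z] by (rule has_derivative_linear)
  have "w = (\<Sum>i\<in>UNIV. w $ i *\<^sub>R axis i 1)"
    using basis_expansion[of w] by (simp add: scalar_mult_eq_scaleR)
  hence "(w, 0 :: real) = (\<Sum>i\<in>UNIV. w $ i *\<^sub>R (axis i 1, 0))"
    by (simp add: prod_eq_iff fst_sum snd_sum)
  hence "dir S (w, 0) F z = dir S (\<Sum>i\<in>UNIV. w $ i *\<^sub>R (axis i 1, 0)) F z"
    by metis
  thus ?thesis
    by (simp only: lin.sum lin.scale real_scaleR_def L.D_def)
qed

text \<open>Restriction to lines gives nonpositive second derivatives in all directions. At a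
  critical point the Christoffel terms of the Hessian vanish, so the Laplacian is the sum of the
  second derivatives along the frame vectors.\<close>

lemma derivatives_at_space_max:
  assumes F: "smooth_on S F" and xt: "x \<in> V" "0 < t" "t < T" and max: "\<And>y. y \<in> V \<Longrightarrow> F (y, t) \<le> F (x, t)"
  shows "L.D i F (x, t) = 0" "L.Lap F (x, t) \<le> 0"
proof -
  let ?z = "(x, t)"
  have z: "?z \<in> S" using xt by (simp add: S_def)
  have dd: "dir S (w, 0) F ?z = 0 \<and> dir S (w, 0) (dir S (w, 0) F) ?z \<le> 0" for w
  proof -
    have "open ((\<lambda>s. x + s *\<^sub>R w) -` V)"
      by (intro open_vimage open_V continuous_intros)
    moreover have "0 \<in> (\<lambda>s. x + s *\<^sub>R w) -` V"
      using xt(1) by simp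
    ultimately obtain \<delta> where \<delta>: "\<delta> > 0" "ball 0 \<delta> \<subseteq> (\<lambda>s. x + s *\<^sub>R w) -` V"
      by (rule openE)
    have V: "x + s *\<^sub>R w \<in> V" if "\<bar>s\<bar> < \<delta>" for s
      using subsetD[OF \<delta>(2), of s] that by simp
    have int: "?z + s *\<^sub>R (w, 0) \<in> interior S" if "\<bar>s\<bar> < \<delta>" for s
      using interior_S[OF V[OF that] xt(2,3)] by simp
    have 1: "((\<lambda>s. F (?z + s *\<^sub>R (w, 0))) has_real_derivative dir S (w, 0) F (?z + s *\<^sub>R (w, 0))) (at s)" if "\<bar>s\<bar> < \<delta>" for s
      by (rule DERIV_dir[OF int[OF that] F])
    have 2: "((\<lambda>s. dir S (w, 0) F (?z + s *\<^sub>R (w, 0))) has_real_derivative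
        dir S (w, 0) (dir S (w, 0) F) (?z + 0 *\<^sub>R (w, 0))) (at 0)"
      using \<delta>(1) by (intro DERIV_dir smooth_on_dir F int) simp
    have 3: "F (?z + s *\<^sub>R (w, 0)) \<le> F (?z + 0 *\<^sub>R (w, 0))" if "\<bar>s\<bar> < \<delta>" for s
      using max[OF V[OF that]] by simp
    show ?thesis
      using derivatives_at_max[OF \<delta>(1) 1 2 3] by simp
  qed
  show crit: "L.D i F ?z = 0" for i
    using dd[of "axis i 1"] by (simp add: L.D_def)
  have hess: "(\<Sum>i\<in>UNIV. w $ i * (\<Sum>j\<in>UNIV. w $ j * L.D i (L.D j F) ?z)) \<le> 0" for w
  proof -
    have "dir S (w, 0) (dir S (w, 0) F) ?z = dir S (w, 0) (\<lambda>z. \<Sum>j\<in>UNIV. w $ j * L.D j F z) ?z"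
      using z dir_space[OF F] by (rule dir_cong)
    also have "\<dots> = (\<Sum>j\<in>UNIV. w $ j * dir S (w, 0) (L.D j F) ?z)"
      by (intro dir_sum fat_S z L.smooth_D F)
    also have "\<dots> = (\<Sum>j\<in>UNIV. \<Sum>i\<in>UNIV. w $ j * (w $ i * L.D i (L.D j F) ?z))"
      by (simp add: dir_space z L.smooth_D F sum_distrib_left)
    also have "\<dots> = (\<Sum>i\<in>UNIV. w $ i * (\<Sum>j\<in>UNIV. w $ j * L.D i (L.D j F) ?z))"
      unfolding sum_distrib_left by (subst sum.swap) (simp add: mult_ac)
    finally show ?thesis using dd[of w] by simp
  qed
  obtain N where N: "frame (\<lambda>i j. hh i j ?z) (\<lambda>i j. gg i j ?z) N"
    using frame_exists[OF z] .
  interpret frame "\<lambda>i j. hh i j ?z" "\<lambda>i j. gg i j ?z" N by (rule N)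
  have "L.Lap F ?z = (\<Sum>a\<in>UNIV. fr2 (\<lambda>i j. L.D i (L.D j F) ?z) a a)"
    by (simp add: L.Lap_def L.Hess_def crit contract2)
  also have "\<dots> \<le> 0"
    using hess[of "\<chi> i. N i _"] by (intro sum_nonpos) (simp add: fr2_def fr1_def)
  finally show "L.Lap F ?z \<le> 0" .
qed

text \<open>On \<open>{0..t}\<close> the product \<open>s * F (x, s)\<close> is maximal at the right
  end; a negative derivative there would give larger values just before \<open>t\<close>.\<close>

lemma derivative_at_time_max:
  assumes F: "smooth_on S F" and xt: "x \<in> V" "0 < t" "t < T"
    and max: "\<And>s. s \<in> {0..t} \<Longrightarrow> s * F (x, s) \<le> t * F (x, t)"
  shows "F (x, t) + t * L.Dt F (x, t) \<ge> 0"
proof (rule ccontr)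
  have "((\<lambda>s. F ((x, 0) + s *\<^sub>R (0, 1))) has_real_derivative dir S (0, 1) F ((x, 0) + t *\<^sub>R (0, 1))) (at t)"
    using interior_S[OF xt] F by (intro DERIV_dir) simp_all
  hence "((\<lambda>s. F (x, s)) has_real_derivative L.Dt F (x, t)) (at t)"
    by (simp add: L.Dt_def)
  hence D: "((\<lambda>s. s * F (x, s)) has_real_derivative F (x, t) + t * L.Dt F (x, t)) (at t)"
    by (auto intro!: derivative_eq_intros simp: mult.commute)
  assume "\<not> ?thesis"
  then obtain d where d: "d > 0" "\<And>h. h > 0 \<Longrightarrow> h < d \<Longrightarrow> t * F (x, t) < (t - h) * F (x, t - h)"
    using DERIV_neg_dec_left[OF D] by auto
  define h where "h = min d t / 2"
  have "h > 0" "h < d" "h < t" using d xt by (auto simp: h_def min_def)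
  thus False using d(2)[of h] max[of "t - h"] by simp
qed

lemma Gsq_nonneg:
  assumes "z \<in> S"
  shows "L.Gsq ff z \<ge> 0"
proof -
  obtain N where N: "frame (\<lambda>i j. hh i j z) (\<lambda>i j. gg i j z) N"
    using frame_exists[OF assms] .
  interpret frame "\<lambda>i j. hh i j z" "\<lambda>i j. gg i j z" N by (rule N)
  show ?thesis by (simp add: L.Gsq_def contract1 sum_nonneg)
qed

text \<open>The maximum gives \<open>Lap q <= 0\<close> and \<open>- Dt q <= q / t\<close>, hence a
  quadratic inequality for \<open>q\<close>. Multiplied by \<open>t^2\<close> it is one for
  \<open>t * q\<close> without negative powers of \<open>t\<close>, and \<open>harnack_solve\<close>
  applies with \<open>N = n * \<alpha> / (2 * a)\<close>.\<close>

lemma estimate_at_max: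
  fixes \<alpha> a b K1 K2 K3 K4 t :: real
  defines "n \<equiv> real CARD('n)"
  defines "C \<equiv> K1 + (\<alpha> - 1) * K3 / (4 * \<alpha>)"
  defines "B1 \<equiv> n * \<alpha> ^ 3 / (512 * a * (\<alpha> - 1)\<^sup>2) + 3 * n * \<alpha> * K4\<^sup>2 / 8"
  defines "B2 \<equiv> n * \<alpha> ^ 3 / (2 * a * (\<alpha> - 1)\<^sup>2) * C\<^sup>2 + n * \<alpha> * max (K1\<^sup>2) (K2\<^sup>2) / (2 * b) + n * \<alpha> * K3\<^sup>2 / (32 * b)"
  defines "B3 \<equiv> n * \<alpha> ^ 3 / (16 * a * (\<alpha> - 1)\<^sup>2) * C"
  assumes p: "p \<in> fst c" and t: "0 < t" "t < T" and nonneg: "qq \<alpha> (snd c p, t) \<ge> 0"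
    and space_max: "\<And>y. y \<in> V \<Longrightarrow> qq \<alpha> (y, t) \<le> qq \<alpha> (snd c p, t)"
    and time_max: "\<And>s. s \<in> {0..t} \<Longrightarrow> s * qq \<alpha> (snd c p, s) \<le> t * qq \<alpha> (snd c p, t)"
    and R_lower: "tensor_le A (tensor_scale (- (K1 / t)) (g t)) (ricci (g t))"
    and R_upper: "tensor_le A (ricci (g t)) (tensor_scale (K2 / t) (g t))"
    and Q_upper: "tensor_le A (H_squared (g t) (H t)) (tensor_scale (K3 / t) (g t))"
    and T_le: "tensor_norm 3 (g t) c p (nabla (g t) (H_squared (g t) (H t)) c p) \<le> K4"
    and pos: "K1 > 0" "K2 > 0" "K3 > 0" "\<alpha> > 1" "a > 0" "b > 0" and ab: "a + 2 * b = 1 / \<alpha>"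
  shows "t * qq \<alpha> (snd c p, t)
    \<le> sqrt (n * \<alpha> / (2 * a)) * (sqrt (n * \<alpha> / (2 * a)) + sqrt B2 + sqrt B3 * sqrt t + sqrt B1 * t)"
proof -
  define x where "x = snd c p"
  let ?z = "(x, t)"
  have x: "x \<in> V" "cinv c x = p" using p by (simp_all add: x_def coord_in cinv_coord)
  have z: "?z \<in> S" "?z \<in> interior S" using x t interior_S by (simp_all add: S_def)
  have n: "n > 0" by (simp add: n_def)
  have gg: "g t c p [i, j] = gg i j ?z" for i j by (simp add: gg_def up_def x)
  have Ricc: "ricci (g t) c p [i, j] = L.Ricc i j ?z" for i j using ricci_chart[OF z(1)] by (simp add: x)
  have QQ: "H_squared (g t) (H t) c p [i, j] = QQ i j ?z" for i j by (simp add: QQ_def up_def x)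
  have scale: "(\<Sum>i\<in>UNIV. \<Sum>j\<in>UNIV. r * F i j * v $ i * v $ j) = r * bil F v v" for r v and F :: "'n \<Rightarrow> 'n \<Rightarrow> real"
    by (simp add: bil_def sum_distrib_left mult_ac)
  note le = R_lower[unfolded tensor_le_def, rule_format, OF c p] R_upper[unfolded tensor_le_def, rule_format, OF c p]
    Q_upper[unfolded tensor_le_def, rule_format, OF c p]
  define q where "q = qq \<alpha> ?z"
  have max: "L.D i (qq \<alpha>) ?z = 0" "L.Lap (qq \<alpha>) ?z \<le> 0" for i
    using derivatives_at_space_max[OF smooth_qq x(1) t, of \<alpha>] space_max unfolding x_def by blast+
  have time: "qq \<alpha> ?z + t * L.Dt (qq \<alpha>) ?z \<ge> 0"
    by (rule derivative_at_time_max[OF smooth_qq x(1) t]) (unfold x_def, rule time_max)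
  have "L.Lap (qq \<alpha>) ?z - L.Dt (qq \<alpha>) ?z
     \<ge> 2 * \<alpha> * a / n * (L.Lap ff ?z)\<^sup>2 - \<alpha> * (2 * C / t + 1 / 8) * L.Gsq ff ?z
        - 3 / 8 * \<alpha> * n * K4\<^sup>2 - \<alpha> * n * max (K1\<^sup>2) (K2\<^sup>2) / (2 * b) / t\<^sup>2 - \<alpha> * n * K3\<^sup>2 / (32 * b) / t\<^sup>2"
    unfolding n_def C_def
  proof (rule reaction_at_critical_point[OF z(2) max(1)])
    show "- K1 / t * bil (\<lambda>i j. gg i j ?z) v v \<le> bil (\<lambda>i j. L.Ricc i j ?z) v v"
      "bil (\<lambda>i j. L.Ricc i j ?z) v v \<le> K2 / t * bil (\<lambda>i j. gg i j ?z) v v"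
      "bil (\<lambda>i j. QQ i j ?z) v v \<le> K3 / t * bil (\<lambda>i j. gg i j ?z) v v" for v
      using le[of v] unfolding tensor_scale_def gg Ricc QQ scale by (simp_all add: bil_def)
    have "tensor_inner 3 (g t) c p (nabla (g t) (H_squared (g t) (H t)) c p) (nabla (g t) (H_squared (g t) (H t)) c p)
      = (\<Sum>i\<in>UNIV. \<Sum>j\<in>UNIV. hh i j ?z * (\<Sum>k\<in>UNIV. \<Sum>l\<in>UNIV. hh k l ?z * (\<Sum>m\<in>UNIV. \<Sum>n\<in>UNIV. hh m n ?z *
       (L.Cov i QQ k m ?z * L.Cov j QQ l n ?z))))" (is "?inner = ?sum")
      using nabla_QQ_chart[OF z(1)] by (simp add: tensor_inner_simps x) (simp add: hh_def up_def x)
    moreover have "?sum \<ge> 0"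
    proof -
      obtain N where N: "frame (\<lambda>i j. hh i j ?z) (\<lambda>i j. gg i j ?z) N"
        using frame_exists[OF z(1)] .
      interpret frame "\<lambda>i j. hh i j ?z" "\<lambda>i j. gg i j ?z" N by (rule N)
      show ?thesis unfolding norm3_up by (intro sum_nonneg) simp
    qed
    ultimately have "?sum = (tensor_norm 3 (g t) c p (nabla (g t) (H_squared (g t) (H t)) c p))\<^sup>2"
      by (simp add: tensor_norm_def)
    also have "\<dots> \<le> K4\<^sup>2"
      using T_le \<open>?sum \<ge> 0\<close> \<open>?inner = ?sum\<close> by (intro power_mono) (simp_all add: tensor_norm_def)
    finally show "?sum \<le> K4\<^sup>2" .
  qed (fact pos t ab)+
  moreover have "2 * \<alpha> * a / n * (L.Lap ff ?z)\<^sup>2 - \<alpha> * (2 * C / t + 1 / 8) * L.Gsq ff ?z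
    \<ge> 2 * a / (n * \<alpha>) * q\<^sup>2 - (n * \<alpha> ^ 3 / (2 * a * (\<alpha> - 1)\<^sup>2) * C\<^sup>2 / t\<^sup>2
        + n * \<alpha> ^ 3 / (16 * a * (\<alpha> - 1)\<^sup>2) * C / t + n * \<alpha> ^ 3 / (512 * a * (\<alpha> - 1)\<^sup>2))"
  proof (rule harnack_quadratic)
    show "- \<alpha> * L.Lap ff ?z = q + (\<alpha> - 1) * L.Gsq ff ?z"
      by (simp add: q_def qq_def algebra_simps)
    show "q \<ge> 0" using nonneg by (simp add: q_def x_def)
  qed (use pos t n Gsq_nonneg[OF z(1)] in auto)
  moreover have "n * \<alpha> ^ 3 / (2 * a * (\<alpha> - 1)\<^sup>2) * C\<^sup>2 / t\<^sup>2 + n * \<alpha> ^ 3 / (16 * a * (\<alpha> - 1)\<^sup>2) * C / t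
      + n * \<alpha> ^ 3 / (512 * a * (\<alpha> - 1)\<^sup>2) + 3 / 8 * \<alpha> * n * K4\<^sup>2 + \<alpha> * n * max (K1\<^sup>2) (K2\<^sup>2) / (2 * b) / t\<^sup>2
      + \<alpha> * n * K3\<^sup>2 / (32 * b) / t\<^sup>2 = B1 + B2 / t\<^sup>2 + B3 / t"
    by (simp add: B1_def B2_def B3_def add_divide_distrib mult_ac)
  moreover have "- L.Dt (qq \<alpha>) ?z \<le> q / t"
    using time t by (simp add: q_def field_simps)
  ultimately have "2 * a / (n * \<alpha>) * q\<^sup>2 \<le> q / t + (B1 + B2 / t\<^sup>2 + B3 / t)"
    using max(2) by linarith
  hence "2 * a / (n * \<alpha>) * q\<^sup>2 * t\<^sup>2 \<le> (q / t + (B1 + B2 / t\<^sup>2 + B3 / t)) * t\<^sup>2"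
    by (rule mult_right_mono) simp
  also have "\<dots> = t * q + B1 * t\<^sup>2 + B2 + B3 * t"
    using t by (simp add: distrib_right power2_eq_square)
  also have "2 * a / (n * \<alpha>) * q\<^sup>2 * t\<^sup>2 = (t * q)\<^sup>2 / (n * \<alpha> / (2 * a))"
    by (simp add: power_mult_distrib)
  finally have "(t * q)\<^sup>2 / (n * \<alpha> / (2 * a)) \<le> t * q + B1 * t\<^sup>2 + B2 + B3 * t" .
  moreover have "C > 0" using pos by (simp add: C_def add_pos_nonneg)
  ultimately show ?thesis
    unfolding x_def[symmetric] q_def[symmetric] using pos t n
    by (intro harnack_solve) (auto simp: B1_def B2_def B3_def le_max_iff_disj intro!: add_nonneg_nonneg divide_nonneg_nonneg mult_nonneg_nonneg)
qed

lemma qq_chart: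
  assumes p: "p \<in> fst c" and t: "t \<in> {0..T}"
  shows "(tensor_norm 1 (g t) c p (differential (u t) c p))\<^sup>2 / (u t p)\<^sup>2
      - \<alpha> * (vector_derivative (\<lambda>s. u s p) (at t within {0..T}) / u t p) = qq \<alpha> (snd c p, t)"
proof -
  let ?z = "(snd c p, t)"
  have z: "?z \<in> S" using coord_in[OF p] t by (simp add: S_def)
  note p_eq = cinv_coord[OF p]
  have uu: "uu ?z = u t p" by (simp add: uu_def up_def p_eq)
  have D: "partial c i (u t) p = L.D i uu ?z" for i
    using partial_up[OF smooth_uu[unfolded uu_def] z] by (simp add: p_eq L.D_def uu_def)
  have "tensor_inner 1 (g t) c p (differential (u t) c p) (differential (u t) c p)
      = (\<Sum>i\<in>UNIV. \<Sum>j\<in>UNIV. hh i j ?z * (L.D i uu ?z * L.D j uu ?z))"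
    unfolding One_nat_def tensor_inner_simps differential_def by (simp add: D) (simp add: hh_def up_def p_eq)
  also have "\<dots> = (uu ?z)\<^sup>2 * L.Gsq ff ?z"
    using uu_pos[OF z] by (simp add: L.Gsq_def D_ff z sum_distrib_left power2_eq_square field_simps)
  finally have "(tensor_norm 1 (g t) c p (differential (u t) c p))\<^sup>2 = (uu ?z)\<^sup>2 * L.Gsq ff ?z"
    using Gsq_nonneg[OF z] by (simp add: tensor_norm_def)
  moreover have "vector_derivative (\<lambda>s. u s p) (at t within {0..T}) = L.Dt uu ?z"
  proof -
    have "((\<lambda>s. u s p) has_vector_derivative L.Dt uu ?z) (at t within cbox 0 T)"
      using has_real_derivative_up[OF smooth_uu[unfolded uu_def] z]
      by (simp add: p_eq L.Dt_def uu_def has_real_derivative_iff_has_vector_derivative)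
    from vector_derivative_within_cbox[OF _ _ this] T_pos t show ?thesis by simp
  qed
  moreover have "L.Dt uu ?z / uu ?z = L.Lap ff ?z + L.Gsq ff ?z"
    using heat_ff[OF z] Dt_ff[OF z] by (simp add: divide_inverse)
  ultimately show ?thesis
    using uu_pos[OF z] unfolding uu[symmetric] by (simp add: qq_def algebra_simps)
qed

end


section \<open>The global maximum principle\<close>

lemma tensor_inner_1_matrix:
  "tensor_inner 1 g c p X Y = (\<chi> i. X [i]) \<bullet> (matrix_inv (metric_matrix g c p) *v (\<chi> i. Y [i]))"
  unfolding One_nat_def tensor_inner_simps
  by (simp add: inner_vec_def matrix_vector_mult_def ginv_def sum_distrib_left mult_ac)

text \<open>For \<open>y\<close> the solution of \<open>M' y = J^T w\<close>, cancelling
  \<open>J^T\<close> gives \<open>M (J y) = w\<close>. Both sides are therefore the inner product of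
  \<open>w\<close> with \<open>J y\<close>, and no formula for the inverse of \<open>M'\<close> is
  involved.\<close>

lemma inverse_form_congruence:
  fixes M M' J :: "real^'n^'n" and w :: "real^'n"
  assumes inv: "invertible M" "invertible M'" and M': "M' = transpose J ** M ** J"
  shows "(transpose J *v w) \<bullet> (matrix_inv M' *v (transpose J *v w)) = w \<bullet> (matrix_inv M *v w)"
proof -
  define y where "y = matrix_inv M' *v (transpose J *v w)"
  have "transpose J *v (M *v (J *v y)) = M' *v y"
    by (simp add: M' matrix_vector_mul_assoc matrix_mul_assoc)
  also have "\<dots> = transpose J *v w"
    by (simp add: y_def matrix_vector_mul_assoc matrix_inv_invertible[OF inv(2)])
  finally have eq: "transpose J *v (M *v (J *v y)) = transpose J *v w" .
  have "det M' \<noteq> 0" using inv(2) invertible_det_nz by blast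
  hence "det (transpose J) \<noteq> 0" by (simp add: M' det_mul)
  hence J: "invertible (transpose J)" by (simp add: invertible_det_nz)
  have cancel: "matrix_inv B *v (B *v v) = v" if "invertible B" for B :: "real^'n^'n" and v
    by (simp add: matrix_vector_mul_assoc matrix_inv_invertible(2)[OF that])
  have "M *v (J *v y) = w"
    using arg_cong[OF eq, of "\<lambda>v. matrix_inv (transpose J) *v v"] by (simp only: cancel[OF J])
  hence "J *v y = matrix_inv M *v w"
    using cancel[OF inv(1), of "J *v y"] by simp
  moreover have "(transpose J *v w) \<bullet> y = w \<bullet> (J *v y)"
    by (metis dot_lmul_matrix transpose_matrix_vector)
  ultimately show ?thesis by (simp add: y_def)
qed

text \<open>The chain rule for the transition map \<open>\<tau>\<close>, which is smooth on the open
  set \<open>W\<close>; differentiability of \<open>f\<close> is asked for in one chart and at one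
  point.\<close>

lemma partial_transition:
  assumes atlas: "smooth_atlas A" and c: "c \<in> A" "c' \<in> A" and p: "p \<in> fst c" "p \<in> fst c'"
    and f: "(\<lambda>x. f (cinv c x)) differentiable (at (snd c p))"
  shows "partial c' j f p = (\<Sum>i\<in>UNIV. jacobian c c' p i j * partial c i f p)"
proof -
  define W where "W = snd c' ` (fst c' \<inter> fst c)"
  have homeo: "homeomorphism (fst c) (snd c ` fst c) (snd c) (cinv c)"
    "homeomorphism (fst c') (snd c' ` fst c') (snd c') (cinv c')"
    and op: "open (fst c)" "open (snd c' ` fst c')"
    using atlas c unfolding smooth_atlas_def by blast+
  have inv: "cinv c (snd c q) = q" if "q \<in> fst c" for q
    using homeo(1) that unfolding homeomorphism_def by blast
  have inv': "cinv c' (snd c' q) = q" if "q \<in> fst c'" for q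
    using homeo(2) that unfolding homeomorphism_def by blast
  have "W = snd c' ` fst c' \<inter> cinv c' -` fst c"
    using inv' by (auto simp: W_def image_iff)
  moreover have "open \<dots>"
    using homeo(2) op unfolding homeomorphism_def by (metis continuous_on_open_vimage Int_commute)
  ultimately have W: "open W" by simp
  define x' where "x' = snd c' p"
  have x': "x' \<in> W" "cinv c' x' = p" using p inv' by (auto simp: W_def x'_def)
  define \<tau> where "\<tau> x = snd c (cinv c' x)" for x
  have "smooth_on W \<tau>"
    using atlas c unfolding smooth_atlas_def W_def \<tau>_def by blast
  hence "\<tau> differentiable_on W"
    unfolding smooth_on_def by (metis Ck_on.simps(2))
  then obtain \<tau>' where \<tau>': "(\<tau> has_derivative \<tau>') (at x')"
    using x'(1) at_within_open[OF x'(1) W] unfolding differentiable_on_def differentiable_def by metis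
  define f' where "f' = frechet_derivative (\<lambda>x. f (cinv c x)) (at (snd c p))"
  have f': "((\<lambda>x. f (cinv c x)) has_derivative f') (at (\<tau> x'))"
    using f x'(2) frechet_derivative_works by (auto simp: f'_def \<tau>_def)
  interpret f': linear f' using f' by (rule has_derivative_linear)
  have "((\<lambda>x. f (cinv c (\<tau> x))) has_derivative (\<lambda>v. f' (\<tau>' v))) (at x')"
    using diff_chain_at[OF \<tau>' f'] by (simp add: o_def)
  hence "((\<lambda>x. f (cinv c' x)) has_derivative (\<lambda>v. f' (\<tau>' v))) (at x')"
  proof (rule has_derivative_transform_within_open[OF _ W x'(1)])
    fix x assume "x \<in> W"
    hence "cinv c' x \<in> fst c" using inv' by (auto simp: W_def)
    thus "f (cinv c (\<tau> x)) = f (cinv c' x)" by (simp add: \<tau>_def inv)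
  qed
  hence "partial c' j f p = f' (\<tau>' (axis j 1))"
    unfolding partial_def x'_def[symmetric] by (metis frechet_derivative_at)
  also have "\<tau>' (axis j 1) = (\<Sum>i\<in>UNIV. \<tau>' (axis j 1) $ i *\<^sub>R axis i 1)"
    using basis_expansion[of "\<tau>' (axis j 1)"] by (simp add: scalar_mult_eq_scaleR)
  also have "f' \<dots> = (\<Sum>i\<in>UNIV. \<tau>' (axis j 1) $ i * f' (axis i 1))"
    by (simp add: f'.sum f'.scale)
  also have "\<dots> = (\<Sum>i\<in>UNIV. jacobian c c' p i j * partial c i f p)"
  proof (intro sum.cong refl)
    fix i
    have "((\<lambda>x. \<tau> x $ i) has_derivative (\<lambda>v. \<tau>' v $ i)) (at x')"
      using bounded_linear.has_derivative[OF bounded_linear_vec_nth \<tau>'] .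
    hence "jacobian c c' p i j = \<tau>' (axis j 1) $ i"
      unfolding jacobian_def partial_def x'_def[symmetric] \<tau>_def by (metis frechet_derivative_at)
    thus "\<tau>' (axis j 1) $ i * f' (axis i 1) = jacobian c c' p i j * partial c i f p"
      by (simp add: partial_def f'_def)
  qed
  finally show ?thesis .
qed

section \<open>The Harnack quantity as a function on the manifold\<close>

locale harnack_flow =
  fixes A :: "('m::{t2_space, second_countable_topology}, 'n::finite) chart set"
    and g H :: "real \<Rightarrow> ('m, 'n) tensor" and u :: "real \<Rightarrow> 'm \<Rightarrow> real" and T :: real
  assumes chart_flow: "c \<in> A \<Longrightarrow> chart_flow A g H u T c"
    and closed: "closed_manifold A"
begin

text \<open>The differential transforms with the transposed Jacobian and the metric by congruence,
  so \<open>inverse_form_congruence\<close> applies.\<close>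

lemma gradient_norm_chart_independent:
  assumes c: "c \<in> A" "c' \<in> A" and p: "p \<in> fst c" "p \<in> fst c'" and t: "t \<in> {0..T}"
  shows "tensor_norm 1 (g t) c' p (differential (u t) c' p) = tensor_norm 1 (g t) c p (differential (u t) c p)"
proof -
  interpret C: chart_flow A g H u T c using chart_flow[OF c(1)] .
  interpret C': chart_flow A g H u T c' using chart_flow[OF c(2)] .
  define J :: "real^'n^'n" where "J = (\<chi> i j. jacobian c c' p i j)"
  let ?M = "metric_matrix (g t) c p" and ?M' = "metric_matrix (g t) c' p"
  have z: "(snd c p, t) \<in> C.S" "(snd c' p, t) \<in> C'.S"
    using t C.coord_in[OF p(1)] C'.coord_in[OF p(2)] by (simp_all add: C.S_def C'.S_def)
  have inv: "invertible ?M" "invertible ?M'"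
    using C.invertible_MM[OF z(1)] C'.invertible_MM[OF z(2)]
    by (simp_all add: C.MM_def C'.MM_def C.gg_def C'.gg_def C.up_def C'.up_def C.cinv_coord[OF p(1)] C'.cinv_coord[OF p(2)]
        metric_matrix_def)
  have M': "?M' = transpose J ** ?M ** J"
  proof -
    have "tensor_field A 2 (g t)"
      using C.flow t unfolding generalized_ricci_flow_def smooth_tensor_family_def by blast
    moreover have "[k, l] \<in> multi_index 2" for k l :: 'n by (simp add: multi_index_def)
    ultimately have *: "g t c' p [k, l] = (\<Sum>I\<in>multi_index 2. (\<Prod>m<2. jacobian c c' p (I ! m) ([k, l] ! m)) * g t c p I)" for k l
      using c p unfolding tensor_field_def by blast
    have "g t c' p [k, l] = (\<Sum>i\<in>UNIV. \<Sum>j\<in>UNIV. jacobian c c' p i k * jacobian c c' p j l * g t c p [i, j])" for k l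
      unfolding * by (simp add: numeral_2_eq_2 sum_multi_index_Suc multi_index_0 lessThan_Suc mult_ac)
    moreover have "(transpose J ** ?M ** J) $ k $ l
        = (\<Sum>i\<in>UNIV. \<Sum>j\<in>UNIV. jacobian c c' p i k * jacobian c c' p j l * g t c p [i, j])" for k l
      unfolding matrix_matrix_mult_def transpose_def J_def metric_matrix_def
      by (simp add: sum_distrib_left sum_distrib_right) (subst sum.swap, simp add: mult_ac)
    ultimately show ?thesis by (simp add: vec_eq_iff metric_matrix_def)
  qed
  have diff: "(\<lambda>x. u t (cinv c x)) differentiable (at (snd c p))"
  proof -
    have x: "snd c p \<in> C.V" using C.coord_in[OF p(1)] .
    have "((\<lambda>x. (x, t)) has_derivative (\<lambda>v. (v, 0))) (at (snd c p) within C.V)"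
      by (auto intro!: derivative_eq_intros)
    moreover have "(C.uu has_derivative (\<lambda>v. dir C.S v C.uu (snd c p, t))) (at (snd c p, t) within (\<lambda>x. (x, t)) ` C.V)"
      using smooth_on_has_derivative[OF C.smooth_uu z(1)] by (rule has_derivative_subset) (use t in \<open>auto simp: C.S_def\<close>)
    ultimately have "((\<lambda>x. C.uu (x, t)) has_derivative (\<lambda>v. dir C.S (v, 0) C.uu (snd c p, t))) (at (snd c p) within C.V)"
      by (rule has_derivative_in_compose)
    thus ?thesis
      using at_within_open[OF x C.open_V] by (auto simp: C.uu_def C.up_def differentiable_def)
  qed
  define w :: "real^'n" where "w = (\<chi> i. partial c i (u t) p)"
  have "(\<chi> i. differential (u t) c' p [i]) = transpose J *v w"
    unfolding differential_def list.sel(1) partial_transition[OF C.atlas c p diff]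
    by (simp add: vec_eq_iff matrix_vector_mult_def transpose_def J_def w_def)
  moreover have "(\<chi> i. differential (u t) c p [i]) = w"
    by (simp add: differential_def w_def)
  ultimately show ?thesis
    unfolding tensor_norm_def tensor_inner_1_matrix using inverse_form_congruence[OF inv M', of w] by simp
qed

text \<open>A chart is chosen at each point. By chart independence the value is the same in every
  chart, and the result is a function that can be maximised over the compact manifold.\<close>

definition Q :: "real \<Rightarrow> real \<Rightarrow> 'm \<Rightarrow> real" where
  "Q \<alpha> t p = (let c = (SOME c. c \<in> A \<and> p \<in> fst c) in
     (tensor_norm 1 (g t) c p (differential (u t) c p))\<^sup>2 / (u t p)\<^sup>2
      - \<alpha> * (vector_derivative (\<lambda>s. u s p) (at t within {0..T}) / u t p))"

lemma Q_chart:
  assumes c: "c \<in> A" and p: "p \<in> fst c" and t: "t \<in> {0..T}"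
  shows "Q \<alpha> t p = (tensor_norm 1 (g t) c p (differential (u t) c p))\<^sup>2 / (u t p)\<^sup>2
      - \<alpha> * (vector_derivative (\<lambda>s. u s p) (at t within {0..T}) / u t p)"
proof -
  define c0 where "c0 = (SOME c. c \<in> A \<and> p \<in> fst c)"
  have c0: "c0 \<in> A" "p \<in> fst c0"
    using someI[of "\<lambda>c. c \<in> A \<and> p \<in> fst c" c] c p unfolding c0_def by blast+
  show ?thesis
    unfolding Q_def Let_def c0_def[symmetric] gradient_norm_chart_independent[OF c c0(1) p c0(2) t] ..
qed

lemma Q_eq_qq:
  assumes "c \<in> A" "p \<in> fst c" "t \<in> {0..T}"
  shows "Q \<alpha> t p = chart_flow.qq g u T c \<alpha> (snd c p, t)"
  using chart_flow.qq_chart[OF chart_flow[OF assms(1)] assms(2,3)] Q_chart[OF assms] by simp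

lemma covered: obtains c where "c \<in> A" "p \<in> fst c"
  using closed unfolding closed_manifold_def smooth_atlas_def by blast

text \<open>Continuity is local, and over the open domain of a chart \<open>Q\<close> is the smooth
  function \<open>qq\<close> of that chart.\<close>

lemma continuous_Q: "continuous_on (UNIV \<times> {0..T}) (\<lambda>(p, t). Q \<alpha> t p)"
  unfolding continuous_on_eq_continuous_within
proof
  fix z assume z: "z \<in> (UNIV :: 'm set) \<times> {0..T}"
  obtain c where c: "c \<in> A" "fst z \<in> fst c" by (rule covered)
  interpret C: chart_flow A g H u T c using chart_flow[OF c(1)] .
  have "continuous_on (fst c \<times> {0..T}) (\<lambda>z. C.qq \<alpha> (snd c (fst z), snd z))"
  proof (rule continuous_on_compose2[OF smooth_on_imp_continuous_on[OF C.smooth_qq]])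
    have "continuous_on (fst c) (snd c)" using C.homeo unfolding homeomorphism_def by blast
    hence "continuous_on (fst c \<times> {0..T}) (\<lambda>z. snd c (fst z))"
      by (rule continuous_on_compose2) (auto intro: continuous_intros)
    thus "continuous_on (fst c \<times> {0..T}) (\<lambda>z. (snd c (fst z), snd z))"
      by (intro continuous_intros)
  qed (auto simp: C.S_def C.coord_in)
  hence "continuous_on (fst c \<times> {0..T}) (\<lambda>(p, t). Q \<alpha> t p)"
    by (rule continuous_on_eq) (auto simp: Q_eq_qq[OF c(1)])
  hence "continuous (at z within fst c \<times> {0..T}) (\<lambda>(p, t). Q \<alpha> t p)"
    using z c by (cases z) (simp add: continuous_on_eq_continuous_within)
  moreover have "at z within fst c \<times> {0..T} = at z within UNIV \<times> {0..T}"
    using c by (intro at_within_nhd[where S = "fst c \<times> UNIV"]) (auto simp: mem_Times_iff intro: open_Times C.open_domain)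
  ultimately show "continuous (at z within UNIV \<times> {0..T}) (\<lambda>(p, t). Q \<alpha> t p)" by simp
qed

text \<open>The product \<open>s * Q \<alpha> s p\<close> is maximised over all points and all
  \<open>s \<le> t\<close>, so the maximum may occur at an earlier time \<open>t0\<close>. As
  \<open>\<Psi>\<close> is increasing, the bound at \<open>t0\<close> carries over to
  \<open>t\<close>.\<close>

lemma harnack_estimate:
  fixes \<alpha> a b K1 K2 K3 K4 t :: real
  defines "n \<equiv> real CARD('n)"
  defines "C \<equiv> K1 + (\<alpha> - 1) * K3 / (4 * \<alpha>)"
  defines "B1 \<equiv> n * \<alpha> ^ 3 / (512 * a * (\<alpha> - 1)\<^sup>2) + 3 * n * \<alpha> * K4\<^sup>2 / 8"
  defines "B2 \<equiv> n * \<alpha> ^ 3 / (2 * a * (\<alpha> - 1)\<^sup>2) * C\<^sup>2 + n * \<alpha> * max (K1\<^sup>2) (K2\<^sup>2) / (2 * b) + n * \<alpha> * K3\<^sup>2 / (32 * b)"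
  defines "B3 \<equiv> n * \<alpha> ^ 3 / (16 * a * (\<alpha> - 1)\<^sup>2) * C"
  defines "\<Psi> \<equiv> \<lambda>t. sqrt (n * \<alpha> / (2 * a)) * (sqrt (n * \<alpha> / (2 * a)) + sqrt B2 + sqrt B3 * sqrt t + sqrt B1 * t)"
  assumes R_lower: "\<forall>t\<in>{0<..T}. tensor_le A (tensor_scale (- (K1 / t)) (g t)) (ricci (g t))"
    and R_upper: "\<forall>t\<in>{0<..T}. tensor_le A (ricci (g t)) (tensor_scale (K2 / t) (g t))"
    and Q_upper: "\<forall>t\<in>{0<..T}. tensor_le A (H_squared (g t) (H t)) (tensor_scale (K3 / t) (g t))"
    and T_le: "\<forall>t\<in>{0..T}. \<forall>c\<in>A. \<forall>p\<in>fst c. tensor_norm 3 (g t) c p (nabla (g t) (H_squared (g t) (H t)) c p) \<le> K4"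
    and pos: "K1 > 0" "K2 > 0" "K3 > 0" "\<alpha> > 1" "a > 0" "b > 0" and ab: "a + 2 * b = 1 / \<alpha>"
    and t: "t \<in> {0<..T}"
  shows "t * Q \<alpha> t p \<le> \<Psi> t"
proof -
  have "C > 0" using pos by (simp add: C_def add_pos_nonneg)
  hence B: "B1 \<ge> 0" "B2 \<ge> 0" "B3 \<ge> 0" "n > 0"
    using pos by (auto simp: B1_def B2_def B3_def n_def le_max_iff_disj
        intro!: add_nonneg_nonneg divide_nonneg_nonneg mult_nonneg_nonneg)
  have \<Psi>_mono: "\<Psi> s \<le> \<Psi> t" if "0 \<le> s" "s \<le> t" for s t
    unfolding \<Psi>_def using that B pos by (intro mult_left_mono add_mono) auto
  have \<Psi>_nonneg: "\<Psi> s \<ge> 0" if "s \<ge> 0" for s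
    unfolding \<Psi>_def using that B pos by (intro mult_nonneg_nonneg add_nonneg_nonneg) auto
  have interior: "t * Q \<alpha> t p \<le> \<Psi> t" if t: "0 < t" "t < T" for t p
  proof -
    have "compact ((UNIV :: 'm set) \<times> {0..t})"
      using closed by (intro compact_Times) (simp_all add: closed_manifold_def)
    moreover have "(UNIV :: 'm set) \<times> {0..t} \<noteq> {}"
      using t by simp
    moreover have "continuous_on (UNIV \<times> {0..t}) (\<lambda>z. snd z * (case z of (p, t) \<Rightarrow> Q \<alpha> t p))"
      using t by (intro continuous_intros continuous_on_subset[OF continuous_Q]) auto
    ultimately have "\<exists>z0\<in>UNIV \<times> {0..t}. \<forall>z\<in>UNIV \<times> {0..t}.
        snd z * (case z of (p, t) \<Rightarrow> Q \<alpha> t p) \<le> snd z0 * (case z0 of (p, t) \<Rightarrow> Q \<alpha> t p)"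
      by (rule continuous_attains_sup)
    then obtain p0 t0 where z0: "t0 \<in> {0..t}" "\<forall>p. \<forall>s\<in>{0..t}. s * Q \<alpha> s p \<le> t0 * Q \<alpha> t0 p0"
      by auto
    have t0: "0 \<le> t0" "t0 \<le> t" using z0(1) by auto
    have max: "s * Q \<alpha> s p \<le> t0 * Q \<alpha> t0 p0" if "0 \<le> s" "s \<le> t" for s p
      using z0(2) that by simp
    show ?thesis
    proof (cases "t0 * Q \<alpha> t0 p0 \<le> 0")
      \<comment> \<open>A nonpositive maximum needs no estimate, since \<open>\<Psi>\<close> is
        nonnegative.\<close>
      case True
      thus ?thesis using max[of t p] \<Psi>_nonneg[of t] t by linarith
    next
      case False
      \<comment> \<open>A positive product excludes the time \<open>0\<close>, where the curvature
        bounds say nothing, and supplies the sign of \<open>q\<close> required by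
        \<open>harnack_quadratic\<close>.\<close>
      hence t0': "0 < t0" "Q \<alpha> t0 p0 > 0"
        using t0 by (auto simp: not_le zero_less_mult_iff)
      obtain c where c: "c \<in> A" "p0 \<in> fst c" by (rule covered)
      interpret C: chart_flow A g H u T c using chart_flow[OF c(1)] .
      have qq: "C.qq \<alpha> (y, s) = Q \<alpha> s (cinv c y)" if "y \<in> C.V" "s \<in> {0..T}" for y s
        using Q_eq_qq[OF c(1) C.cinv_in[OF that(1)] that(2)] C.coord_cinv[OF that(1)] by simp
      have qq0: "C.qq \<alpha> (snd c p0, s) = Q \<alpha> s p0" if "s \<in> {0..T}" for s
        using Q_eq_qq[OF c that] by simp
      have "t0 * C.qq \<alpha> (snd c p0, t0) \<le> \<Psi> t0"
        unfolding \<Psi>_def B1_def B2_def B3_def C_def n_def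
      proof (rule C.estimate_at_max[OF c(2)])
        show "0 < t0" "t0 < T" "0 \<le> C.qq \<alpha> (snd c p0, t0)"
          using t0 t0' t by (simp_all add: qq0)
        show "C.qq \<alpha> (y, t0) \<le> C.qq \<alpha> (snd c p0, t0)" if "y \<in> C.V" for y
          using max[of t0 "cinv c y"] t0 t0' t that by (simp add: qq qq0)
        show "s * C.qq \<alpha> (snd c p0, s) \<le> t0 * C.qq \<alpha> (snd c p0, t0)" if "s \<in> {0..t0}" for s
          using max[of s p0] t0 t that by (simp add: qq0)
      qed (use R_lower R_upper Q_upper T_le c t0 t0' t pos ab in auto)
      also have "C.qq \<alpha> (snd c p0, t0) = Q \<alpha> t0 p0" using t0 t by (simp add: qq0)
      finally show ?thesis
        using max[of t p] \<Psi>_mono[of t0 t] t t0 by linarith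
    qed
  qed
  show ?thesis
  proof (cases "t < T")
    case True
    thus ?thesis using interior t by simp
  next
    case False
    hence T: "t = T" "T > 0" using t by auto
    \<comment> \<open>The final time lies on the boundary of the space-time set; the inequality
      passes to the limit because both sides are continuous in time.\<close>
    have "continuous_on {0..T} (\<lambda>s. case (p, s) of (p, s) \<Rightarrow> Q \<alpha> s p)"
      by (rule continuous_on_compose2[OF continuous_Q]) (auto intro!: continuous_intros)
    hence "continuous_on (closure {0<..<T}) (\<lambda>s. s * Q \<alpha> s p - \<Psi> s)"
      unfolding \<Psi>_def using T by (auto intro!: continuous_intros)
    moreover have "T \<in> closure {0<..<T}" using T by simp
    ultimately have "T * Q \<alpha> T p - \<Psi> T \<le> 0"
      by (rule continuous_le_on_closure) (use interior in simp)
    thus ?thesis using T by simp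
  qed
qed

end

theorem theorem1p1:
  fixes A :: "('m::{t2_space, second_countable_topology}, 'n::finite) chart set"
    and g H :: "real \<Rightarrow> ('m, 'n) tensor"
    and u :: "real \<Rightarrow> 'm \<Rightarrow> real"
    and T K1 K2 K3 K4 \<alpha> a b :: real
  assumes "closed_manifold A"
    and "T > 0" and "K1 > 0" and "K2 > 0" and "K3 > 0" and "K4 > 0"
    and "generalized_ricci_flow A T g H"
    and "\<forall>t\<in>{0<..T}. tensor_le A (tensor_scale (- (K1 / t)) (g t)) (ricci (g t))"
    and "\<forall>t\<in>{0<..T}. tensor_le A (ricci (g t)) (tensor_scale (K2 / t) (g t))"
    and "\<forall>t\<in>{0<..T}. tensor_le A (H_squared (g t) (H t)) (tensor_scale (K3 / t) (g t))"
    and "\<forall>t\<in>{0..T}. \<forall>c\<in>A. \<forall>p\<in>fst c.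
           tensor_norm 3 (g t) c p (nabla (g t) (H_squared (g t) (H t)) c p) \<le> K4"
    and "smooth_function_family A T u"
    and "\<forall>t\<in>{0..T}. \<forall>p. u t p > 0"
    and "heat_solution A T g u"
    and "\<alpha> > 1" and "a > 0" and "b > 0" and "a + 2 * b = 1 / \<alpha>"
  shows "let n = real CARD('n);
             K = max (K1\<^sup>2) (K2\<^sup>2);
             B1 = n * \<alpha> ^ 3 / (512 * a * (\<alpha> - 1)\<^sup>2) + 3 * n * \<alpha> * K4\<^sup>2 / 8;
             B2 = n * \<alpha> ^ 3 / (2 * a * (\<alpha> - 1)\<^sup>2) * (K1 + (\<alpha> - 1) * K3 / (4 * \<alpha>))\<^sup>2
                    + n * \<alpha> * K / (2 * b) + n * \<alpha> * K3\<^sup>2 / (32 * b);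
             B3 = n * \<alpha> ^ 3 / (16 * a * (\<alpha> - 1)\<^sup>2) * (K1 + (\<alpha> - 1) * K3 / (4 * \<alpha>))
         in \<forall>t\<in>{0<..T}. \<forall>c\<in>A. \<forall>p\<in>fst c.
              (tensor_norm 1 (g t) c p (differential (u t) c p))\<^sup>2 / (u t p)\<^sup>2
                - \<alpha> * (vector_derivative (\<lambda>s. u s p) (at t within {0..T}) / u t p)
              \<le> sqrt (n * \<alpha> / (2 * a)) *
                  ((sqrt (n * \<alpha> / (2 * a)) + sqrt B2) * (1 / t) + sqrt B3 / sqrt t + sqrt B1)"
  unfolding Let_def
proof (intro ballI, goal_cases)
  case (1 t c p)
  have chart: "chart_flow A g H u T c" if "c \<in> A" for c
    using assms(1,2,7,12-14) that by unfold_locales (simp_all add: closed_manifold_def)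
  interpret harnack_flow A g H u T
    by (rule harnack_flow.intro) (fact chart, fact assms(1))
  \<comment> \<open>Division of the estimate for \<open>t * q\<close> by \<open>t\<close>, which
    turns \<open>r3 * sqrt t\<close> into \<open>r3 / sqrt t\<close>.\<close>
  have absorb: "q \<le> s * ((s + r2) * (1 / t) + r3 / sqrt t + r1)"
    if "t * q \<le> s * (s + r2 + r3 * sqrt t + r1 * t)" for q s r1 r2 r3
  proof -
    have "t > 0" using 1 by simp
    hence r3: "r3 / sqrt t = r3 * sqrt t / t"
      by (simp add: field_simps)
    have "s * ((s + r2) * (1 / t) + r3 / sqrt t + r1) = s * (s + r2 + r3 * sqrt t + r1 * t) / t"
      unfolding r3 using \<open>t > 0\<close> by (simp add: field_simps)
    thus ?thesis using that \<open>t > 0\<close> by (simp add: pos_le_divide_eq mult.commute)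
  qed
  have t: "t \<in> {0..T}" using 1 by simp
  show ?case
    unfolding Q_chart[OF 1(2,3) t, symmetric]
    by (intro absorb harnack_estimate assms 1(1))
qed

end
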